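(* Let $H$ be a positive Hankel operator on $H^2(\mathbb{C}_+)$ with Carleson measure $\mu_H$ on $\mathbb{R}_+$, and define $$h_H : \mathbb{R} \to i\mathbb{R}, \qquad h_H(p) := \frac{i}{\pi}\int_{\mathbb{R}_+} \frac{p}{\lambda^2+p^2}\, d\mu_H(\lambda).$$ Then $h_H \in L^\infty(\mathbb{R},\mathbb{C})$, and the Hankel operator $H_{h_H}$ associated to $h_H$ equals $H$.
   Context: $\mathbb{R}_+ = (0,\infty)$ and $\mathbb{C}_+ = \{z \in \mathbb{C} : \operatorname{Im} z > 0\}$. $H^2(\mathbb{C}_+)$ is the Hardy space of the upper half plane, identified via non-tangential boundary values $f \mapsto f^*$ with a closed subspace of $L^2(\mathbb{R})$ (Lebesgue measure); scalar products are antilinear in the first argument. $P_+ : L^2(\mathbb{R}) \to H^2(\mathbb{C}_+)$ is the orthogonal projection (so $P_+^*$ is the inclusion) and $(Rf)(x) := f(-x)$ on $L^2(\mathbb{R})$. For $h \in L^\infty(\mathbb{R})$ the associated Hankel operator on $H^2(\mathbb{C}_+)$ is $H_h := P_+ h R P_+^*$ (apply $R$, then multiply by $h$, then project). A Hankel operator on $H^2(\mathbb{C}_+)$ is a bounded operator of the form $H_h$ with $h \in L^\infty(\mathbb{R})$. The Carleson measure $\mu_H$ of a positive Hankel operator $H$ is the unique positive Borel measure on $\mathbb{R}_+$ with $\langle f, Hg\rangle = \int_{\mathbb{R}_+} \overline{f(i\lambda)}\, g(i\lambda)\, d\mu_H(\lambda)$ for all $f,g \in H^2(\mathbb{C}_+)$.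 *)

theory Defs
  imports "HOL-Complex_Analysis.Complex_Analysis"
begin

definition upper_half_plane :: "complex set" where
  "upper_half_plane = {z. 0 < Im z}"

(* Elements of H^2 are normalised to vanish off the half plane, so that equality of
   elements of H^2 is equality of functions. *)
definition H2 :: "(complex \<Rightarrow> complex) set" where
  "H2 = {F. F holomorphic_on upper_half_plane \<and> (\<forall>z. z \<notin> upper_half_plane \<longrightarrow> F z = 0) \<and>
     (SUP y\<in>{0<..}. \<integral>\<^sup>+x. ennreal ((norm (F (Complex x y)))\<^sup>2) \<partial>lebesgue) < \<infinity>}"

definition stolz_cone :: "real \<Rightarrow> real \<Rightarrow> complex set" where
  "stolz_cone \<alpha> x = {z. 0 < Im z \<and> \<bar>Re z - x\<bar> < \<alpha> * Im z}"

(* Convergence along this filter is convergence in cones of every aperture,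
   see tendsto_nontangential_iff. *)
definition nontangential :: "real \<Rightarrow> complex filter" where
  "nontangential x = (SUP \<alpha>\<in>{0<..}. at (complex_of_real x) within stolz_cone \<alpha> x)"

lemma tendsto_nontangential_iff:
  "(F \<longlongrightarrow> l) (nontangential x) \<longleftrightarrow>
     (\<forall>\<alpha>>0. (F \<longlongrightarrow> l) (at (complex_of_real x) within stolz_cone \<alpha> x))"
  by (auto simp: nontangential_def filterlim_iff eventually_Sup)

(* The boundary function f^*; unspecified at points without a nontangential limit,
   which form a Lebesgue null set if F is in H^2. *)
definition bdry :: "(complex \<Rightarrow> complex) \<Rightarrow> real \<Rightarrow> complex" where
  "bdry F x = Lim (nontangential x) F"

(* Elements of L^2 and L^infinity of the line are represented by Lebesgue measurable
   functions, not by classes modulo null sets. *)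
definition L2_inner :: "(real \<Rightarrow> complex) \<Rightarrow> (real \<Rightarrow> complex) \<Rightarrow> complex" where
  "L2_inner f g = (LINT x|lebesgue. cnj (f x) * g x)"

definition Linf :: "(real \<Rightarrow> complex) set" where
  "Linf = {h \<in> borel_measurable lebesgue. \<exists>C. AE x in lebesgue. norm (h x) \<le> C}"

definition H2_inner :: "(complex \<Rightarrow> complex) \<Rightarrow> (complex \<Rightarrow> complex) \<Rightarrow> complex" where
  "H2_inner F G = L2_inner (bdry F) (bdry G)"

definition H2_norm :: "(complex \<Rightarrow> complex) \<Rightarrow> real" where
  "H2_norm F = sqrt (Re (H2_inner F F))"

(* For square integrable f: the unique F in H^2 with f - F^* orthogonal to the image
   of H^2 in L^2. *)
definition P_plus :: "(real \<Rightarrow> complex) \<Rightarrow> complex \<Rightarrow> complex" where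
  "P_plus f = (THE F. F \<in> H2 \<and> (\<forall>G\<in>H2. L2_inner (bdry G) (\<lambda>x. f x - bdry F x) = 0))"

definition reflect :: "(real \<Rightarrow> complex) \<Rightarrow> real \<Rightarrow> complex" where
  "reflect f x = f (- x)"

definition hankel :: "(real \<Rightarrow> complex) \<Rightarrow> (complex \<Rightarrow> complex) \<Rightarrow> complex \<Rightarrow> complex" where
  "hankel h F = P_plus (\<lambda>x. h x * reflect (bdry F) x)"

(* Operators on H^2 are functions whose values outside the set H2 are irrelevant. *)
definition bounded_operator_H2 :: "((complex \<Rightarrow> complex) \<Rightarrow> complex \<Rightarrow> complex) \<Rightarrow> bool" where
  "bounded_operator_H2 T \<longleftrightarrow>
     (\<forall>F\<in>H2. T F \<in> H2) \<and>
     (\<forall>F\<in>H2. \<forall>G\<in>H2. T (\<lambda>z. F z + G z) = (\<lambda>z. T F z + T G z)) \<and>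
     (\<forall>c. \<forall>F\<in>H2. T (\<lambda>z. c * F z) = (\<lambda>z. c * T F z)) \<and>
     (\<exists>C. \<forall>F\<in>H2. H2_norm (T F) \<le> C * H2_norm F)"

definition hankel_operator :: "((complex \<Rightarrow> complex) \<Rightarrow> complex \<Rightarrow> complex) \<Rightarrow> bool" where
  "hankel_operator H \<longleftrightarrow> bounded_operator_H2 H \<and> (\<exists>h\<in>Linf. \<forall>F\<in>H2. H F = hankel h F)"

definition positive_operator :: "((complex \<Rightarrow> complex) \<Rightarrow> complex \<Rightarrow> complex) \<Rightarrow> bool" where
  "positive_operator H \<longleftrightarrow> (\<forall>F\<in>H2. H2_inner F (H F) \<in> \<real>\<^sub>\<ge>\<^sub>0)"

(* A Borel measure on the space (0, infinity). Integrability is required explicitly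
   because the Bochner integral of a non-integrable function is 0 by convention. *)
definition carleson_measure ::
  "((complex \<Rightarrow> complex) \<Rightarrow> complex \<Rightarrow> complex) \<Rightarrow> real measure \<Rightarrow> bool" where
  "carleson_measure H \<mu> \<longleftrightarrow> sets \<mu> = sets (restrict_space borel {0<..}) \<and>
     (\<forall>F\<in>H2. \<forall>G\<in>H2.
        integrable \<mu> (\<lambda>l. cnj (F (\<i> * of_real l)) * G (\<i> * of_real l)) \<and>
        H2_inner F (H G) = (LINT l|\<mu>. cnj (F (\<i> * of_real l)) * G (\<i> * of_real l)))"

definition hankel_symbol :: "real measure \<Rightarrow> real \<Rightarrow> complex" where
  "hankel_symbol \<mu> p = \<i> / of_real pi * of_real (LINT l|\<mu>. p / (l\<^sup>2 + p\<^sup>2))"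

end

(*
  For F, G in H^2 put K(z) = cnj (F (- cnj z)) * G z, so that K(i l) = cnj (F (i l)) * G (i l).
  Apply the Cauchy formula to K on a horizontal line with the poles i l and - i l and let the
  line sink to the real axis: the integral of K(p) * p / (p^2 + l^2) dp equals pi * i * K(i l).
  Integrating in l against the Carleson measure and using Fubini, the form of the Hankel operator
  with symbol h_H is the form defined by the Carleson measure.  The bound needed for Fubini and
  for the boundedness of h_H comes from testing H on the Szego kernels 1 / (z + i p).

  The boundary theory rests on the semigroup law F_(y+s) = P_s * F_y for the restrictions F_y of
  F to horizontal lines.  As P_s is symmetric, <F_a, F_b> is the square of the norm of
  F_((a+b)/2), so |F_a - F_b|^2 <= |F_a|^2 - |F_b|^2 for a < b, and F_y converges in L^2 as y
  tends to 0.
*)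
theory Submission
  imports Defs "HOL-Probability.Sinc_Integral"
begin

text \<open>The obstacle is that \<open>bdry\<close> is a \<open>Lim\<close> and
  \<open>P_plus\<close> a \<open>THE\<close>: nothing can be said about \<open>hankel\<close> before
  nontangential limits are known to exist almost everywhere and H^2 is known to admit orthogonal
  projections. Two measures are in play: limits and Fubini arguments are carried out for Borel
  functions and \<open>lborel\<close>, while \<open>bdry F\<close> is only Lebesgue measurable and
  enters through a Borel representative \<open>\<phi>\<close>. A symbol is not determined by its
  Hankel operator, since bounded analytic functions of the lower half plane are symbols of 0. So the
  given symbol h and \<open>hankel_symbol \<mu>\<close> are compared through the forms that they
  define on H^2. The Szego kernels yield the bound because 1 / (z + i p) has squared norm pi / p on
  the line and squared modulus 1 / (l + p)^2 at i l: if |h| <= C, the integral of 1 / (l + p)^2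
  against \<open>\<mu>\<close> is at most C pi / p. As (l + p)^2 <= 2 (l^2 + p^2), the factor p in
  h_H compensates 1 / p, and |h_H| <= 2 |C| uniformly in p.\<close>

section \<open>Square integrable functions\<close>

definition sq_int :: "'a measure \<Rightarrow> ('a \<Rightarrow> complex) \<Rightarrow> bool" where
  "sq_int M f \<longleftrightarrow> f \<in> borel_measurable M \<and> integrable M (\<lambda>x. (cmod (f x))\<^sup>2)"

text \<open>The square of the L^2 norm. Where |f|^2 is not integrable the value is 0 by convention,
  so a bound on \<open>nsq\<close> says something only together with \<open>sq_int\<close>. The
  measure is a parameter because both \<open>lborel\<close> and \<open>lebesgue\<close>
  occur.\<close>

definition nsq :: "'a measure \<Rightarrow> ('a \<Rightarrow> complex) \<Rightarrow> real" where
  "nsq M f = (LINT x|M. (cmod (f x))\<^sup>2)"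

lemma sq_int_measurable [measurable_dest]: "sq_int M f \<Longrightarrow> f \<in> borel_measurable M"
  by (simp add: sq_int_def)

lemma sq_int_integrable: "sq_int M f \<Longrightarrow> integrable M (\<lambda>x. (cmod (f x))\<^sup>2)"
  by (simp add: sq_int_def)

lemma nsq_nonneg [simp]: "0 \<le> nsq M f"
  by (simp add: nsq_def)

lemma nn_integral_sq_int:
  "sq_int M f \<Longrightarrow> (\<integral>\<^sup>+x. ennreal ((cmod (f x))\<^sup>2) \<partial>M) = ennreal (nsq M f)"
  unfolding nsq_def by (rule nn_integral_eq_integral) (auto simp: sq_int_def)

text \<open>Bounds obtained with nonnegative integrals, which need no integrability beforehand,
  become square integrability here.\<close>

lemma sq_intI_nn:
  assumes "f \<in> borel_measurable M" "(\<integral>\<^sup>+x. ennreal ((cmod (f x))\<^sup>2) \<partial>M) \<le> ennreal B" "0 \<le> B"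
  shows "sq_int M f" "nsq M f \<le> B"
proof -
  have "integrable M (\<lambda>x. (cmod (f x))\<^sup>2)"
    using assms by (intro integrableI_nonneg) (auto simp: le_less_trans)
  then show s: "sq_int M f" using assms by (simp add: sq_int_def)
  show "nsq M f \<le> B"
    using nn_integral_sq_int[OF s] assms(2,3) by simp
qed

lemma sq_int_AE_cong:
  assumes "sq_int M f" "g \<in> borel_measurable M" "AE x in M. f x = g x"
  shows "sq_int M g"
proof -
  have "integrable M (\<lambda>x. (cmod (f x))\<^sup>2) = integrable M (\<lambda>x. (cmod (g x))\<^sup>2)"
    using assms by (intro integrable_cong_AE) (auto simp: sq_int_def)
  with assms show ?thesis by (auto simp: sq_int_def)
qed

lemma nsq_AE_cong:
  assumes "f \<in> borel_measurable M" "g \<in> borel_measurable M" "AE x in M. f x = g x"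
  shows "nsq M f = nsq M g"
  unfolding nsq_def using assms by (intro integral_cong_AE) auto

lemma sq_int_cmult:
  assumes "sq_int M f" shows "sq_int M (\<lambda>x. c * f x)"
  using assms by (auto simp: sq_int_def norm_mult power_mult_distrib)

lemma nsq_cmult: "nsq M (\<lambda>x. c * f x) = (cmod c)\<^sup>2 * nsq M f"
  by (simp add: nsq_def norm_mult power_mult_distrib)

lemma sq_int_bounded_mult:
  assumes "sq_int M f" "h \<in> borel_measurable M" "AE x in M. cmod (h x) \<le> C"
  shows "sq_int M (\<lambda>x. h x * f x)"
proof -
  have [measurable]: "f \<in> borel_measurable M" "h \<in> borel_measurable M" using assms by (auto simp: sq_int_def)
  have "integrable M (\<lambda>x. (cmod (h x * f x))\<^sup>2)"
  proof (rule Bochner_Integration.integrable_bound)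
    show "integrable M (\<lambda>x. C\<^sup>2 * (cmod (f x))\<^sup>2)"
      using assms by (auto simp: sq_int_def)
    show "AE x in M. norm ((cmod (h x * f x))\<^sup>2) \<le> norm (C\<^sup>2 * (cmod (f x))\<^sup>2)"
      using assms(3) by eventually_elim (auto simp: norm_mult power_mult_distrib intro!: mult_right_mono power_mono)
  qed auto
  then show ?thesis by (simp add: sq_int_def)
qed

lemma sq_int_cnj: "sq_int M f \<Longrightarrow> sq_int M (\<lambda>x. cnj (f x))"
proof -
  have "cnj \<in> borel_measurable borel"
    by (intro borel_measurable_continuous_onI continuous_intros)
  then show "sq_int M f \<Longrightarrow> sq_int M (\<lambda>x. cnj (f x))"
    using measurable_compose[of f M borel cnj] by (simp add: sq_int_def)
qed

lemma sq_int_prod: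
  assumes "sq_int M f" "sq_int M g"
  shows "integrable M (\<lambda>x. f x * g x)"
proof -
  have [measurable]: "f \<in> borel_measurable M" "g \<in> borel_measurable M" using assms by (auto simp: sq_int_def)
  show ?thesis
  proof (rule Bochner_Integration.integrable_bound)
    show "integrable M (\<lambda>x. (cmod (f x))\<^sup>2 + (cmod (g x))\<^sup>2)"
      using assms by (auto simp: sq_int_def)
    have "cmod (f x) * cmod (g x) \<le> (cmod (f x))\<^sup>2 + (cmod (g x))\<^sup>2" for x
      using sum_squares_bound[of "cmod (f x)" "cmod (g x)"] mult_nonneg_nonneg[OF norm_ge_zero norm_ge_zero, of "f x" "g x"]
      unfolding mult.assoc by linarith
    then show "AE x in M. cmod (f x * g x) \<le> norm ((cmod (f x))\<^sup>2 + (cmod (g x))\<^sup>2)"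
      by (auto simp: norm_mult)
  qed auto
qed

lemma sq_int_cnj_prod: "sq_int M f \<Longrightarrow> sq_int M g \<Longrightarrow> integrable M (\<lambda>x. cnj (f x) * g x)"
  by (intro sq_int_prod sq_int_cnj)

lemma sq_int_add:
  assumes "sq_int M f" "sq_int M g"
  shows "sq_int M (\<lambda>x. f x + g x)"
proof -
  have [measurable]: "f \<in> borel_measurable M" "g \<in> borel_measurable M" using assms by (auto simp: sq_int_def)
  have "integrable M (\<lambda>x. (cmod (f x + g x))\<^sup>2)"
  proof (rule Bochner_Integration.integrable_bound)
    show "integrable M (\<lambda>x. 2 * (cmod (f x))\<^sup>2 + 2 * (cmod (g x))\<^sup>2)"
      using assms by (auto simp: sq_int_def)
    have "(cmod (f x + g x))\<^sup>2 \<le> 2 * (cmod (f x))\<^sup>2 + 2 * (cmod (g x))\<^sup>2" for x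
    proof -
      have "(cmod (f x + g x))\<^sup>2 \<le> (cmod (f x) + cmod (g x))\<^sup>2"
        by (intro power_mono norm_triangle_ineq) auto
      also have "\<dots> \<le> 2 * (cmod (f x))\<^sup>2 + 2 * (cmod (g x))\<^sup>2"
        using sum_squares_bound[of "cmod (f x)" "cmod (g x)"] by (simp add: power2_sum)
      finally show ?thesis .
    qed
    then show "AE x in M. norm ((cmod (f x + g x))\<^sup>2) \<le> norm (2 * (cmod (f x))\<^sup>2 + 2 * (cmod (g x))\<^sup>2)"
      by auto
  qed auto
  then show ?thesis by (simp add: sq_int_def)
qed

lemma sq_int_diff:
  assumes "sq_int M f" "sq_int M g"
  shows "sq_int M (\<lambda>x. f x - g x)"
  using sq_int_add[OF assms(1) sq_int_cmult[OF assms(2), of "-1"]] by simp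

text \<open>The moduli stand inside the integral because \<open>half_plane_Cauchy\<close> asks for
  bounds on absolute integrals over horizontal lines.\<close>

lemma Cauchy_Schwarz_abs:
  assumes "sq_int M f" "sq_int M g"
  shows "(LINT x|M. cmod (f x) * cmod (g x)) \<le> sqrt (nsq M f) * sqrt (nsq M g)"
proof -
  have [measurable]: "f \<in> borel_measurable M" "g \<in> borel_measurable M" using assms by (auto simp: sq_int_def)
  have i: "integrable M (\<lambda>x. cmod (f x) * cmod (g x))"
    using integrable_norm[OF sq_int_prod[OF assms]] by (simp add: norm_mult)
  let ?I = "LINT x|M. cmod (f x) * cmod (g x)"
  have "0 \<le> ?I" by simp
  have e: "(\<integral>\<^sup>+x. ennreal (cmod (f x)) * ennreal (cmod (g x)) \<partial>M) = ennreal ?I"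
    using nn_integral_eq_integral[OF i] by (simp add: ennreal_mult)
  have "(ennreal ?I)\<^sup>2 \<le> ennreal (nsq M f) * ennreal (nsq M g)"
    using Cauchy_Schwarz_nn_integral[of "\<lambda>x. ennreal (cmod (f x))" M "\<lambda>x. ennreal (cmod (g x))"]
    by (simp add: e ennreal_power nn_integral_sq_int assms)
  then have "?I\<^sup>2 \<le> nsq M f * nsq M g"
    by (simp add: ennreal_power flip: ennreal_mult)
  then have "?I \<le> sqrt (nsq M f * nsq M g)" by (rule real_le_rsqrt)
  then show ?thesis by (simp add: real_sqrt_mult)
qed

lemma Cauchy_Schwarz_int:
  assumes "sq_int M f" "sq_int M g"
  shows "cmod (LINT x|M. f x * g x) \<le> sqrt (nsq M f) * sqrt (nsq M g)"
  using integral_norm_bound[of M "\<lambda>x. f x * g x"] Cauchy_Schwarz_abs[OF assms]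
  by (simp add: norm_mult)

lemma nsq_cnj [simp]: "nsq M (\<lambda>x. cnj (f x)) = nsq M f"
  by (simp add: nsq_def)

lemma nsq_diff:
  assumes "sq_int M f" "sq_int M g"
  shows "nsq M (\<lambda>x. f x - g x) = nsq M f + nsq M g - 2 * Re (LINT x|M. cnj (f x) * g x)"
proof -
  have "(cmod (a - b))\<^sup>2 = (cmod a)\<^sup>2 + (cmod b)\<^sup>2 - 2 * Re (cnj a * b)" for a b :: complex
    unfolding cmod_power2 by (simp add: power2_eq_square algebra_simps)
  then have "nsq M (\<lambda>x. f x - g x) = (LINT x|M. (cmod (f x))\<^sup>2 + (cmod (g x))\<^sup>2 - 2 * Re (cnj (f x) * g x))"
    by (simp add: nsq_def)
  also have "\<dots> = (LINT x|M. (cmod (f x))\<^sup>2 + (cmod (g x))\<^sup>2) - (LINT x|M. 2 * Re (cnj (f x) * g x))"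
    by (intro Bochner_Integration.integral_diff Bochner_Integration.integrable_add
        integrable_mult_right integrable_Re sq_int_cnj_prod sq_int_integrable assms)
  also have "(LINT x|M. (cmod (f x))\<^sup>2 + (cmod (g x))\<^sup>2) = nsq M f + nsq M g"
    unfolding nsq_def using assms
    by (intro Bochner_Integration.integral_add) (auto simp: sq_int_def)
  also have "(LINT x|M. 2 * Re (cnj (f x) * g x)) = 2 * (LINT x|M. Re (cnj (f x) * g x))"
    by (rule integral_mult_right_zero)
  also have "(LINT x|M. Re (cnj (f x) * g x)) = Re (LINT x|M. cnj (f x) * g x)"
    by (rule integral_Re[OF sq_int_cnj_prod[OF assms]])
  finally show ?thesis .
qed

lemma nsq_eq_inner:
  assumes "sq_int M f" shows "(LINT x|M. cnj (f x) * f x) = of_real (nsq M f)"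
proof -
  have *: "cnj z * z = complex_of_real ((cmod z)\<^sup>2)" for z
    by (metis complex_norm_square mult.commute)
  show ?thesis unfolding nsq_def * by (rule integral_complex_of_real)
qed

lemma sqrt_nsq_diff_le:
  assumes "sq_int M f" "sq_int M g"
  shows "sqrt (nsq M (\<lambda>x. f x - g x)) \<le> sqrt (nsq M f) + sqrt (nsq M g)"
proof (rule real_le_lsqrt)
  have "- Re (LINT x|M. cnj (f x) * g x) \<le> cmod (LINT x|M. cnj (f x) * g x)"
    using abs_Re_le_cmod[of "LINT x|M. cnj (f x) * g x"] by linarith
  also have "\<dots> \<le> sqrt (nsq M f) * sqrt (nsq M g)"
    using Cauchy_Schwarz_int[OF sq_int_cnj[OF assms(1)] assms(2)] by simp
  finally show "nsq M (\<lambda>x. f x - g x) \<le> (sqrt (nsq M f) + sqrt (nsq M g))\<^sup>2"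
    by (simp add: nsq_diff[OF assms] power2_sum)
qed auto

text \<open>Lower semicontinuity of the norm under almost everywhere convergence. It takes the place
  of completeness of L^2: limits are formed pointwise, and distances to them are estimated
  afterwards.\<close>

lemma sq_int_Fatou:
  assumes f: "\<And>n::nat. sq_int M (f n)" and "\<And>n. nsq M (f n) \<le> B"
    and [measurable]: "g \<in> borel_measurable M" and lim: "AE x in M. (\<lambda>n. f n x) \<longlonglongrightarrow> g x"
  shows "sq_int M g" "nsq M g \<le> B"
proof -
  have B: "0 \<le> B" using assms(2)[of 0] nsq_nonneg[of M "f 0"] by linarith
  have "(\<integral>\<^sup>+x. ennreal ((cmod (g x))\<^sup>2) \<partial>M) = (\<integral>\<^sup>+x. liminf (\<lambda>n. ennreal ((cmod (f n x))\<^sup>2)) \<partial>M)"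
  proof (rule nn_integral_cong_AE, use lim in eventually_elim)
    fix x assume "(\<lambda>n. f n x) \<longlonglongrightarrow> g x"
    then have "(\<lambda>n. ennreal ((cmod (f n x))\<^sup>2)) \<longlonglongrightarrow> ennreal ((cmod (g x))\<^sup>2)"
      by (intro tendsto_intros tendsto_ennrealI)
    then show "ennreal ((cmod (g x))\<^sup>2) = liminf (\<lambda>n. ennreal ((cmod (f n x))\<^sup>2))"
      by (metis lim_imp_Liminf trivial_limit_sequentially)
  qed
  also have "\<dots> \<le> liminf (\<lambda>n. \<integral>\<^sup>+x. ennreal ((cmod (f n x))\<^sup>2) \<partial>M)"
    using f by (intro nn_integral_liminf) (auto simp: sq_int_def)
  also have "\<dots> \<le> ennreal B"
    by (rule Liminf_le) (use assms(2) B in \<open>auto simp: nn_integral_sq_int f ennreal_leI\<close>)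
  finally show "sq_int M g" "nsq M g \<le> B" using sq_intI_nn B assms(3) by blast+
qed

(* The weights 2^n turn summability of the squared increments into summability of the
   increments themselves, since 2 r <= 2^n r^2 + 2^(-n). *)
lemma sq_int_fast_Cauchy_AE_convergent:
  assumes f: "\<And>n::nat. sq_int M (f n)" 
    and d: "\<And>n. nsq M (\<lambda>x. f (Suc n) x - f n x) \<le> (1/4)^n"
  shows "AE x in M. convergent (\<lambda>n. f n x)"
proof -
  have [measurable]: "\<And>n. f n \<in> borel_measurable M" using f by (auto simp: sq_int_def)
  let ?d = "\<lambda>n x. (cmod (f (Suc n) x - f n x))\<^sup>2"
  have "(\<integral>\<^sup>+x. (\<Sum>n. ennreal (2^n * ?d n x)) \<partial>M) = (\<Sum>n. \<integral>\<^sup>+x. ennreal (2^n * ?d n x) \<partial>M)"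
    by (intro nn_integral_suminf) auto
  also have "\<dots> \<le> (\<Sum>n. ennreal ((1/2)^n))"
  proof (rule suminf_le)
    fix n
    have "(\<integral>\<^sup>+x. ennreal (2^n * ?d n x) \<partial>M) = ennreal (2^n) * ennreal (nsq M (\<lambda>x. f (Suc n) x - f n x))"
      by (simp add: ennreal_mult nn_integral_cmult flip: nn_integral_sq_int[OF sq_int_diff[OF f f]])
    also have "\<dots> \<le> ennreal (2^n) * ennreal ((1/4)^n)"
      by (intro mult_left_mono ennreal_leI d) auto
    also have "\<dots> = ennreal ((1/2)^n)"
      by (simp flip: ennreal_mult power_mult_distrib)
    finally show "(\<integral>\<^sup>+x. ennreal (2^n * ?d n x) \<partial>M) \<le> ennreal ((1/2)^n)" .
  qed auto
  also have "\<dots> < \<infinity>"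
    by (subst suminf_ennreal2) (auto intro!: summable_geometric)
  finally have "AE x in M. (\<Sum>n. ennreal (2^n * ?d n x)) \<noteq> \<infinity>"
    by (intro nn_integral_noteq_infinite) auto
  then show ?thesis
  proof eventually_elim
    case (elim x)
    then have s: "summable (\<lambda>n. 2^n * ?d n x)"
      by (intro summable_suminf_not_top) auto
    have "summable (\<lambda>n. f (Suc n) x - f n x)"
    proof (rule summable_comparison_test')
      show "summable (\<lambda>n. 2^n * ?d n x + (1/2)^n)"
        by (intro summable_add s) (auto intro!: summable_geometric)
      fix n :: nat
      define r where "r = cmod (f (Suc n) x - f n x)"
      define u where "u = (2::real)^n"
      have u: "u > 0" by (simp add: u_def)
      have "r * u \<le> (r*u)\<^sup>2 + 1"
        using sum_squares_bound[of "r*u" 1] zero_le_power2[of "r*u"] unfolding mult_1_right one_power2 by linarith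
      then have "r \<le> u * r\<^sup>2 + 1 / u"
        using u by (simp add: field_simps power2_eq_square)
      then show "norm (f (Suc n) x - f n x) \<le> 2^n * ?d n x + (1/2)^n"
        by (simp add: r_def u_def power_one_over)
    qed
    then have "convergent (\<lambda>n. \<Sum>i<n. f (Suc i) x - f i x)"
      by (simp add: summable_iff_convergent)
    then have "convergent (\<lambda>n. f n x - f 0 x)"
      by (simp add: sum_lessThan_telescope[of "\<lambda>n. f n x"])
    then have "convergent (\<lambda>n. (f n x - f 0 x) + f 0 x)"
      by (intro convergent_add convergent_const)
    then show ?case by simp
  qed
qed

section \<open>The Cauchy formula in the half plane\<close>

lemma borel_measurable_Complex [measurable (raw)]:
  assumes [measurable]: "f \<in> borel_measurable M" "g \<in> borel_measurable M"
  shows "(\<lambda>x. Complex (f x) (g x)) \<in> borel_measurable M"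
  unfolding Complex_eq by measurable

lemma open_upper_half_plane: "open upper_half_plane"
  unfolding upper_half_plane_def by (rule open_halfspace_Im_gt)

lemma convex_upper_half_plane: "convex upper_half_plane"
  unfolding upper_half_plane_def by (rule convex_halfspace_Im_gt)

lemma in_upper_half_plane [simp]: "z \<in> upper_half_plane \<longleftrightarrow> 0 < Im z"
  by (simp add: upper_half_plane_def)

text \<open>The horizontal counterpart of \<open>has_contour_integral_linepath_same_Re_iff\<close>,
  reduced to a segment of the real axis by the translation by i c.\<close>

lemma has_contour_integral_linepath_same_Im_iff:
  assumes "a < b"
  shows "(f has_contour_integral I) (linepath (Complex a c) (Complex b c)) \<longleftrightarrow>
         ((\<lambda>x. f (Complex x c)) has_integral I) {a..b}"
proof -
  have "linepath (Complex a c) (Complex b c) x = linepath (of_real a) (of_real b) x + \<i> * of_real c" for x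
    by (simp add: linepath_def Complex_eq algebra_simps scaleR_conv_of_real)
  then have "(f has_contour_integral I) (linepath (Complex a c) (Complex b c)) \<longleftrightarrow>
     ((\<lambda>w. f (w + \<i> * of_real c)) has_contour_integral I) (linepath (of_real a) (of_real b))"
    by (simp add: has_contour_integral_linepath Complex_eq)
  also have "\<dots> \<longleftrightarrow> ((\<lambda>x. f (Complex x c)) has_integral I) {a..b}"
    using assms by (subst has_contour_integral_linepath_Reals_iff) (auto simp: Complex_eq)
  finally show ?thesis .
qed

text \<open>z may have any height other than a and b, also one below the half plane: the kernels
  used later combine the formula for a point above a line with that for its mirror image below the
  line, which contributes 0.\<close>

lemma rectangle_Cauchy:
  fixes f :: "complex \<Rightarrow> complex" and z :: complex and X a b :: real
  defines "q \<equiv> \<lambda>w. f w / (w - z)"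
  assumes hol: "f holomorphic_on upper_half_plane" and ab: "0 < a" "a < b"
    and X: "\<bar>Re z\<bar> < X" and Im: "Im z \<noteq> a" "Im z \<noteq> b"
  shows "(LBINT x:{-X..X}. q (Complex x a)) - (LBINT x:{-X..X}. q (Complex x b))
     + \<i> * (LBINT s:{a..b}. q (Complex X s)) - \<i> * (LBINT s:{a..b}. q (Complex (-X) s))
     = (if a < Im z \<and> Im z < b then 2 * of_real pi * \<i> * f z else 0)"
proof -
  have cf: "continuous_on upper_half_plane f" by (rule holomorphic_on_imp_continuous_on[OF hol])
  have contH: "continuous_on {-X..X} (\<lambda>x. q (Complex x c))" if "c > 0" "c \<noteq> Im z" for c
    unfolding q_def using that
    by (intro continuous_intros continuous_on_compose2[OF cf]) (auto simp: complex_eq_iff Complex_eq intro!: continuous_intros)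
  have contV: "continuous_on {a..b} (\<lambda>s. q (Complex c s))" if "c \<noteq> Re z" for c
    unfolding q_def using that ab
    by (intro continuous_intros continuous_on_compose2[OF cf]) (auto simp: complex_eq_iff Complex_eq intro!: continuous_intros)
  have H: "(q has_contour_integral (LBINT x:{-X..X}. q (Complex x c))) (linepath (Complex (-X) c) (Complex X c))"
    if "c > 0" "c \<noteq> Im z" for c
  proof -
    have "-X < X" using X by linarith
    then show ?thesis
      using set_borel_integral_eq_integral[OF borel_integrable_atLeastAtMost'[OF contH[OF that]]]
      by (subst has_contour_integral_linepath_same_Im_iff) (auto simp: has_integral_integral)
  qed
  have V: "(q has_contour_integral \<i> * (LBINT s:{a..b}. q (Complex c s))) (linepath (Complex c a) (Complex c b))"
    if "c \<noteq> Re z" for c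
    using set_borel_integral_eq_integral[OF borel_integrable_atLeastAtMost'[OF contV[OF that]]] ab
    by (subst has_contour_integral_linepath_same_Re_iff[where a=a and b=b and c=c]) (auto simp: has_integral_integral mult.assoc[symmetric])
  let ?R = "rectpath (Complex (-X) a) (Complex X b)"
  have "(q has_contour_integral ((LBINT x:{-X..X}. q (Complex x a)) + (\<i> * (LBINT s:{a..b}. q (Complex X s))
     + (- (LBINT x:{-X..X}. q (Complex x b)) + - (\<i> * (LBINT s:{a..b}. q (Complex (-X) s))))))) ?R"
    unfolding rectpath_def Let_def using X Im ab
    by (intro has_contour_integral_join H[of a, simplified] V[of X] valid_path_join valid_path_linepath
        has_contour_integral_reverse_linepath[OF H[of b]] has_contour_integral_reverse_linepath[OF V[of "-X"]]
       | simp add: complex_eq_iff)+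
  moreover have "(q has_contour_integral (if a < Im z \<and> Im z < b then 2 * of_real pi * \<i> * f z else 0)) ?R"
  proof (cases "Im z > 0")
    case True
    have sub: "path_image ?R \<subseteq> upper_half_plane - {z}"
      using X Im ab by (auto simp: path_image_rectpath)
    have "(q has_contour_integral (2*pi * \<i> * winding_number ?R z * f z)) ?R"
      unfolding q_def
    proof (rule Cauchy_integral_formula_convex_simple[OF convex_upper_half_plane hol])
      show "z \<in> interior upper_half_plane" 
        using True by (simp add: interior_open open_upper_half_plane)
    qed (use sub in auto)
    moreover have "winding_number ?R z = (if a < Im z \<and> Im z < b then 1 else 0)"
    proof (cases "a < Im z \<and> Im z < b")
      case True
      then have "z \<in> box (Complex (-X) a) (Complex X b)"
        using X by (auto simp: in_box_complex_iff)
      then show ?thesis using True by (simp add: winding_number_rectpath)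
    next
      case False
      then have "z \<notin> cbox (Complex (-X) a) (Complex X b)"
        using Im by (auto simp: in_cbox_complex_iff)
      then show ?thesis using False X ab by (simp add: winding_number_rectpath_outside)
    qed
    ultimately show ?thesis by (auto split: if_splits)
  next
    case False
    have "(q has_contour_integral 0) ?R"
    proof (rule Cauchy_theorem_convex_simple[OF _ convex_upper_half_plane])
      show "q holomorphic_on upper_half_plane"
        unfolding q_def using False by (intro holomorphic_intros hol) auto
      show "path_image ?R \<subseteq> upper_half_plane"
        using X ab by (auto simp: path_image_rectpath)
    qed auto
    then show ?thesis using False ab by auto
  qed
  ultimately show ?thesis
    using has_contour_integral_unique by (fastforce simp: algebra_simps)
qed

text \<open>A function that stays above a positive constant on a half line has infinite integral
  there, so integrability alone provides small values at arbitrarily large points.\<close>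

lemma exists_small_value:
  fixes g :: "real \<Rightarrow> ennreal"
  assumes [measurable]: "g \<in> borel_measurable borel"
    and fin: "(\<integral>\<^sup>+x. g x * indicator {c..} x \<partial>lborel) < \<infinity>" and "0 < e"
  shows "\<exists>x\<ge>d. g x < e"
proof (rule ccontr)
  assume "\<not> ?thesis"
  then have ge: "e \<le> g x" if "d \<le> x" for x using that by (auto simp: not_less)
  have "\<infinity> = e * emeasure lborel {max c d..}"
  proof -
    have "emeasure lborel {max c d..} = \<infinity>"
    proof -
      have "ennreal r \<le> emeasure lborel {max c d..}" for r
      proof (cases "0 \<le> r")
        case True
        then have "ennreal r = emeasure lborel {max c d..max c d + r}" by simp
        also have "\<dots> \<le> emeasure lborel {max c d..}" by (intro emeasure_mono) auto
        finally show ?thesis .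
      qed (simp add: ennreal_neg)
      then show ?thesis
        by (metis ennreal_less_top infinity_ennreal_def leD less_top not_less ennreal_cases ennreal_le_iff2 le_less_trans ennreal_Ex_less_of_nat ennreal_of_nat_eq_real_of_nat)
    qed
    then show ?thesis using \<open>0 < e\<close> by (simp add: ennreal_mult_top)
  qed
  also have "\<dots> = (\<integral>\<^sup>+x. e * indicator {max c d..} x \<partial>lborel)"
    by (simp add: nn_integral_cmult_indicator)
  also have "\<dots> \<le> (\<integral>\<^sup>+x. g x * indicator {c..} x \<partial>lborel)"
    by (intro nn_integral_mono) (auto simp: ge split: split_indicator)
  finally show False using fin by simp
qed

text \<open>The kernel with pole z is traded for the fixed weight 1 / |w + i|, which is regular on
  the closed half plane: |w + i| <= |w - z| + |z + i|, and the last term is at most |z + i| / d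
  times |w - z|.\<close>

lemma Cauchy_kernel_ratio:
  assumes "0 < d" "d \<le> cmod (w - z)" "w \<noteq> -\<i>"
  shows "cmod (v / (w - z)) \<le> (1 + cmod (z + \<i>) / d) * (cmod v / cmod (w + \<i>))"
proof -
  have p: "cmod (w - z) > 0" "cmod (w + \<i>) > 0" using assms by (auto simp: add_eq_0_iff2)
  have "cmod (w + \<i>) \<le> cmod (w - z) + cmod (z + \<i>)"
    using norm_triangle_ineq[of "w - z" "z + \<i>"] by simp
  also have "cmod (z + \<i>) \<le> cmod (z + \<i>) / d * cmod (w - z)"
    using assms mult_right_mono[OF assms(2), of "cmod (z + \<i>)"] by (simp add: field_simps)
  finally have "cmod (w + \<i>) \<le> (1 + cmod (z + \<i>) / d) * cmod (w - z)"
    by (simp add: algebra_simps)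
  then have "cmod v * cmod (w + \<i>) \<le> cmod v * ((1 + cmod (z + \<i>) / d) * cmod (w - z))"
    by (intro mult_left_mono) auto
  then show ?thesis using p by (simp add: norm_divide divide_simps mult_ac)
qed

lemma nn_integral_uminus:
  fixes f :: "real \<Rightarrow> ennreal"
  assumes "f \<in> borel_measurable borel"
  shows "(\<integral>\<^sup>+x. f (- x) \<partial>lborel) = (\<integral>\<^sup>+x. f x \<partial>lborel)"
  using nn_integral_real_affine[OF assms, of "-1" 0] by simp

(* The contribution of the vertical sides x = X and x = - X of a rectangle is integrable in X,
   so it is small for suitable arbitrarily large X; no pointwise decay of f is needed. *)
theorem half_plane_Cauchy:
  fixes f :: "complex \<Rightarrow> complex" and m :: "real \<Rightarrow> real"
  assumes hol: "f holomorphic_on upper_half_plane" and meas [measurable]: "f \<in> borel_measurable borel"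
    and a: "0 < a" and z: "Im z \<noteq> a"
    and bound: "\<And>y. a \<le> y \<Longrightarrow> (\<integral>\<^sup>+x. ennreal (cmod (f (Complex x y)) / cmod (Complex x y + \<i>)) \<partial>lborel) \<le> ennreal (m y)"
    and m: "\<And>y. a \<le> y \<Longrightarrow> 0 \<le> m y" "\<And>y. a \<le> y \<Longrightarrow> m y \<le> B" "(m \<longlongrightarrow> 0) at_top"
  shows "integrable lborel (\<lambda>x. f (Complex x a) / (Complex x a - z))"
    and "(LBINT x. f (Complex x a) / (Complex x a - z)) = (if a < Im z then 2 * of_real pi * \<i> * f z else 0)"
proof -
  define q where "q = (\<lambda>w. f w / (w - z))"
  define r where "r = (\<lambda>w. cmod (f w) / cmod (w + \<i>))"
  have [measurable]: "q \<in> borel_measurable borel" "r \<in> borel_measurable borel"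
    unfolding q_def r_def by measurable
  \<comment> \<open>On the line at height y the distance from z is at least |y - Im z|, which serves
    as d in \<open>Cauchy_kernel_ratio\<close>. On vertical lines at distance at least 1 from z,
    \<open>qr'\<close> takes d = 1, uniformly in the height.\<close>
  define K where "K = (\<lambda>y. 1 + cmod (z + \<i>) / \<bar>y - Im z\<bar>)"
  have K0: "0 \<le> K y" for y by (simp add: K_def)
  have qr: "cmod (q (Complex x y)) \<le> K y * r (Complex x y)" if "0 < y" "y \<noteq> Im z" for x y
    unfolding q_def r_def K_def using that abs_Im_le_cmod[of "Complex x y - z"]
    by (intro Cauchy_kernel_ratio) (auto simp: complex_eq_iff)
  have qr': "cmod (q (Complex x y)) \<le> (1 + cmod (z + \<i>)) * r (Complex x y)" 
    if "0 < y" "1 \<le> \<bar>x - Re z\<bar>" for x y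
    using Cauchy_kernel_ratio[of 1 "Complex x y" z "f (Complex x y)"] that abs_Re_le_cmod[of "Complex x y - z"]
    unfolding q_def r_def by (auto simp: complex_eq_iff)
  have nnr: "(\<integral>\<^sup>+x. ennreal (r (Complex x y)) \<partial>lborel) \<le> ennreal (m y)" if "a \<le> y" for y
    using bound[OF that] by (simp add: r_def)
  have int: "integrable lborel (\<lambda>x. q (Complex x y))"
    and qbound: "cmod (LBINT x. q (Complex x y)) \<le> K y * m y" if "a \<le> y" "y \<noteq> Im z" for y
  proof -
    have "(\<integral>\<^sup>+x. ennreal (cmod (q (Complex x y))) \<partial>lborel) \<le> (\<integral>\<^sup>+x. ennreal (K y) * ennreal (r (Complex x y)) \<partial>lborel)"
      using that a qr by (intro nn_integral_mono) (auto simp: r_def K0 simp flip: ennreal_mult intro!: ennreal_leI)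
    also have "\<dots> = ennreal (K y) * (\<integral>\<^sup>+x. ennreal (r (Complex x y)) \<partial>lborel)"
      by (rule nn_integral_cmult) measurable
    also have "\<dots> \<le> ennreal (K y) * ennreal (m y)"
      by (intro mult_left_mono nnr that) auto
    also have "\<dots> = ennreal (K y * m y)" using K0 m(1) that by (simp add: ennreal_mult)
    finally have le: "(\<integral>\<^sup>+x. ennreal (cmod (q (Complex x y))) \<partial>lborel) \<le> ennreal (K y * m y)" .
    show i: "integrable lborel (\<lambda>x. q (Complex x y))"
      by (rule integrableI_bounded) (use le in \<open>auto simp: le_less_trans\<close>)
    have "ennreal (cmod (LBINT x. q (Complex x y))) \<le> (\<integral>\<^sup>+x. ennreal (cmod (q (Complex x y))) \<partial>lborel)"
      by (rule integral_norm_bound_ennreal[OF i])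
    with le have "ennreal (cmod (LBINT x. q (Complex x y))) \<le> ennreal (K y * m y)" by (rule order_trans[rotated])
    then show "cmod (LBINT x. q (Complex x y)) \<le> K y * m y"
      using K0 m(1) that by (simp add: ennreal_le_iff)
  qed
  show "integrable lborel (\<lambda>x. f (Complex x a) / (Complex x a - z))"
    using int[of a] z unfolding q_def by simp
  have diff: "(LBINT x. q (Complex x a)) - (LBINT x. q (Complex x b)) 
      = (if a < Im z \<and> Im z < b then 2 * of_real pi * \<i> * f z else 0)" if b: "a < b" "Im z \<noteq> b" for b
  proof -
    \<comment> \<open>The absolute integrals over both vertical sides are added, so that one choice
      of X makes the two sides small together.\<close>
    define g :: "real \<Rightarrow> ennreal" where
      "g = (\<lambda>X. \<integral>\<^sup>+s. indicator {a..b} s * (ennreal (cmod (q (Complex X s))) + ennreal (cmod (q (Complex (-X) s)))) \<partial>lborel)"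
    have [measurable]: "g \<in> borel_measurable borel"
      unfolding g_def by measurable
    define c where "c = \<bar>Re z\<bar> + 1"
    define C where "C = 1 + cmod (z + \<i>)"
    have C0: "0 \<le> C" by (simp add: C_def)
    have gfin: "(\<integral>\<^sup>+X. g X * indicator {c..} X \<partial>lborel) < \<infinity>"
    proof -
      have "(\<integral>\<^sup>+X. g X * indicator {c..} X \<partial>lborel)
        = (\<integral>\<^sup>+X. \<integral>\<^sup>+s. indicator {a..b} s * (ennreal (cmod (q (Complex X s))) + ennreal (cmod (q (Complex (-X) s)))) * indicator {c..} X \<partial>lborel \<partial>lborel)"
        unfolding g_def by (intro nn_integral_cong nn_integral_multc[symmetric]) measurable
      \<comment> \<open>After the exchange of integrals each height s between a and b contributes at
        most 2 C B, by the bound assumed on horizontal lines.\<close>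
      also have "\<dots> = (\<integral>\<^sup>+s. \<integral>\<^sup>+X. indicator {a..b} s * (ennreal (cmod (q (Complex X s))) + ennreal (cmod (q (Complex (-X) s)))) * indicator {c..} X \<partial>lborel \<partial>lborel)"
        by (intro lborel_pair.Fubini' ) measurable
      also have "\<dots> \<le> (\<integral>\<^sup>+s. indicator {a..b} s * ennreal (2 * C * B) \<partial>lborel)"
      proof (intro nn_integral_mono)
        fix s :: real
        show "(\<integral>\<^sup>+X. indicator {a..b} s * (ennreal (cmod (q (Complex X s))) + ennreal (cmod (q (Complex (-X) s)))) * indicator {c..} X \<partial>lborel)
            \<le> indicator {a..b} s * ennreal (2 * C * B)"
        proof (cases "s \<in> {a..b}")
          case True
          then have s: "a \<le> s" "0 < s" using a by auto
          have R: "r (Complex X s) \<ge> 0" for X by (simp add: r_def)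
          have "(\<integral>\<^sup>+X. indicator {a..b} s * (ennreal (cmod (q (Complex X s))) + ennreal (cmod (q (Complex (-X) s)))) * indicator {c..} X \<partial>lborel)
            \<le> (\<integral>\<^sup>+X. ennreal C * (ennreal (r (Complex X s)) + ennreal (r (Complex (-X) s))) \<partial>lborel)"
          proof (intro nn_integral_mono)
            fix X :: real
            have "cmod (q (Complex X s)) \<le> C * r (Complex X s)" "cmod (q (Complex (-X) s)) \<le> C * r (Complex (-X) s)"
              if "X \<ge> c"
              using that s unfolding C_def by (auto intro!: qr' simp: c_def)
            then show "indicator {a..b} s * (ennreal (cmod (q (Complex X s))) + ennreal (cmod (q (Complex (-X) s)))) * indicator {c..} X
              \<le> ennreal C * (ennreal (r (Complex X s)) + ennreal (r (Complex (-X) s)))"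
              using C0 R by (auto simp: distrib_left simp flip: ennreal_mult split: split_indicator intro!: add_mono ennreal_leI)
          qed
          also have "\<dots> = ennreal C * ((\<integral>\<^sup>+X. ennreal (r (Complex X s)) \<partial>lborel) + (\<integral>\<^sup>+X. ennreal (r (Complex (-X) s)) \<partial>lborel))"
            by (subst nn_integral_cmult, measurable, subst nn_integral_add) auto
          also have "(\<integral>\<^sup>+X. ennreal (r (Complex (-X) s)) \<partial>lborel) = (\<integral>\<^sup>+X. ennreal (r (Complex X s)) \<partial>lborel)"
            by (rule nn_integral_uminus) measurable
          also have "ennreal C * ((\<integral>\<^sup>+X. ennreal (r (Complex X s)) \<partial>lborel) + (\<integral>\<^sup>+X. ennreal (r (Complex X s)) \<partial>lborel))
             \<le> ennreal C * (ennreal B + ennreal B)"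
            using nnr[OF s(1)] m(2)[OF s(1)] by (intro mult_left_mono add_mono) (auto intro: order_trans ennreal_leI)
          also have "\<dots> = ennreal (2 * C * B)"
          proof -
            have "B \<ge> 0" using m(1,2)[of a] by linarith
            then show ?thesis using C0 by (simp add: algebra_simps flip: ennreal_plus ennreal_mult)
          qed
          finally show ?thesis using True by simp
        qed simp
      qed
      also have "\<dots> < \<infinity>"
        using b by (simp add: nn_integral_multc ennreal_mult_less_top)
      finally show ?thesis .
    qed
    have "\<exists>x\<ge>max c (real n). g x < ennreal (1 / real (Suc n))" for n
      by (rule exists_small_value[OF _ gfin]) auto
    then obtain X where X: "\<And>n. max c (real n) \<le> X n" "\<And>n. g (X n) < ennreal (1 / real (Suc n))"
      by metis
    have Xtop: "filterlim X at_top sequentially"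
      using X(1) by (intro filterlim_at_top_mono[OF filterlim_real_sequentially]) auto
    have lim: "(\<lambda>n. LBINT x:{-X n..X n}. q (Complex x y)) \<longlonglongrightarrow> (LBINT x. q (Complex x y))"
      if "a \<le> y" "y \<noteq> Im z" for y
      unfolding set_lebesgue_integral_def
    proof (rule integral_dominated_convergence)
      show "integrable lborel (\<lambda>x. cmod (q (Complex x y)))"
        using int[OF that] by (rule integrable_norm)
      show "AE x in lborel. (\<lambda>n. indicator {- X n..X n} x *\<^sub>R q (Complex x y)) \<longlonglongrightarrow> q (Complex x y)"
      proof (rule AE_I2)
        fix x :: real
        have "eventually (\<lambda>n. \<bar>x\<bar> \<le> X n) sequentially"
          using Xtop by (auto simp: filterlim_at_top)
        then have "eventually (\<lambda>n. indicator {- X n..X n} x *\<^sub>R q (Complex x y) = q (Complex x y)) sequentially"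
          by eventually_elim (simp add: indicator_def abs_le_iff)
        then show "(\<lambda>n. indicator {- X n..X n} x *\<^sub>R q (Complex x y)) \<longlonglongrightarrow> q (Complex x y)"
          by (rule tendsto_eventually)
      qed
      show "AE x in lborel. cmod (indicator {- X n..X n} x *\<^sub>R q (Complex x y)) \<le> cmod (q (Complex x y))" for n
        by (auto split: split_indicator)
    qed (auto simp: measurable_lborel1)
    have vert: "cmod (LBINT s:{a..b}. q (Complex (X n) s)) \<le> 1 / real (Suc n)"
               "cmod (LBINT s:{a..b}. q (Complex (- X n) s)) \<le> 1 / real (Suc n)" for n
    proof -
      have cn: "cmod (LBINT s:{a..b}. h s) \<le> 1 / real (Suc n)"
        if le: "\<And>s. ennreal (cmod (h s)) \<le> ennreal (cmod (q (Complex (X n) s))) + ennreal (cmod (q (Complex (-X n) s)))"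
        and [measurable]: "h \<in> borel_measurable borel" for h :: "real \<Rightarrow> complex"
      proof -
        have nn: "(\<integral>\<^sup>+s. ennreal (cmod (indicator {a..b} s *\<^sub>R h s)) \<partial>lborel) \<le> g (X n)"
          unfolding g_def using le by (intro nn_integral_mono) (auto split: split_indicator)
        have i: "integrable lborel (\<lambda>s. indicator {a..b} s *\<^sub>R h s)"
        proof (rule integrableI_bounded)
          show "(\<integral>\<^sup>+s. ennreal (cmod (indicator {a..b} s *\<^sub>R h s)) \<partial>lborel) < \<infinity>"
            using nn X(2)[of n] by (auto intro: le_less_trans less_trans)
        qed measurable
        have "ennreal (cmod (LBINT s:{a..b}. h s)) \<le> ennreal (1 / real (Suc n))"
          unfolding set_lebesgue_integral_def
          using integral_norm_bound_ennreal[OF i] nn X(2)[of n] by (meson less_imp_le order_trans)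
        then show ?thesis by (simp add: ennreal_le_iff)
      qed
      show "cmod (LBINT s:{a..b}. q (Complex (X n) s)) \<le> 1 / real (Suc n)"
        by (rule cn) auto
      show "cmod (LBINT s:{a..b}. q (Complex (- X n) s)) \<le> 1 / real (Suc n)"
        by (rule cn) auto
    qed
    have v0: "(\<lambda>n. LBINT s:{a..b}. q (Complex (X n) s)) \<longlonglongrightarrow> 0" "(\<lambda>n. LBINT s:{a..b}. q (Complex (- X n) s)) \<longlonglongrightarrow> 0"
      using vert by (intro tendsto_0_le[where K=1, OF LIMSEQ_inverse_real_of_nat]; simp add: inverse_eq_divide)+
    have "(\<lambda>n. (LBINT x:{-X n..X n}. q (Complex x a)) - (LBINT x:{-X n..X n}. q (Complex x b))
     + \<i> * (LBINT s:{a..b}. q (Complex (X n) s)) - \<i> * (LBINT s:{a..b}. q (Complex (-X n) s)))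
      \<longlonglongrightarrow> (LBINT x. q (Complex x a)) - (LBINT x. q (Complex x b)) + \<i> * 0 - \<i> * 0"
      using b z by (intro tendsto_intros lim v0) auto
    moreover have "(LBINT x:{-X n..X n}. q (Complex x a)) - (LBINT x:{-X n..X n}. q (Complex x b))
     + \<i> * (LBINT s:{a..b}. q (Complex (X n) s)) - \<i> * (LBINT s:{a..b}. q (Complex (-X n) s))
      = (if a < Im z \<and> Im z < b then 2 * of_real pi * \<i> * f z else 0)" for n
      unfolding q_def using X(1)[of n] z b a
      by (intro rectangle_Cauchy hol) (auto simp: c_def)
    ultimately show ?thesis
      using LIMSEQ_unique[OF _ tendsto_const] by fastforce
  qed
  \<comment> \<open>Only the upper side is left. \<open>K b\<close> stays bounded as b tends to
    infinity, so the decay of m makes its contribution vanish.\<close>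
  have "((\<lambda>b. LBINT x. q (Complex x b)) \<longlongrightarrow> 0) at_top"
  proof (rule Lim_null_comparison)
    show "eventually (\<lambda>b. cmod (LBINT x. q (Complex x b)) \<le> (1 + cmod (z + \<i>)) * m b) at_top"
      using eventually_ge_at_top[of a] eventually_ge_at_top[of "Im z + 1"]
    proof eventually_elim
      case (elim b)
      then have "cmod (LBINT x. q (Complex x b)) \<le> K b * m b" by (intro qbound) auto
      also have "K b \<le> 1 + cmod (z + \<i>)"
        unfolding K_def using elim mult_left_mono[of 1 "b - Im z" "cmod (z + \<i>)"] by (simp add: divide_le_eq)
      finally show ?case using m(1)[of b] elim by (simp add: mult_right_mono)
    qed
    show "((\<lambda>b. (1 + cmod (z + \<i>)) * m b) \<longlongrightarrow> 0) at_top"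
      using tendsto_mult_right_zero[OF m(3)] by simp
  qed
  then have "((\<lambda>b. (LBINT x. q (Complex x a)) - (LBINT x. q (Complex x b))) \<longlongrightarrow> (LBINT x. q (Complex x a)) - 0) at_top"
    by (intro tendsto_intros)
  moreover have "eventually (\<lambda>b. (LBINT x. q (Complex x a)) - (LBINT x. q (Complex x b))
     = (if a < Im z then 2 * of_real pi * \<i> * f z else 0)) at_top"
    using eventually_gt_at_top[of a] eventually_gt_at_top[of "Im z"]
    by eventually_elim (auto simp: diff)
  then have "((\<lambda>b. (LBINT x. q (Complex x a)) - (LBINT x. q (Complex x b))) \<longlongrightarrow> (if a < Im z then 2 * of_real pi * \<i> * f z else 0)) at_top"
    by (rule tendsto_eventually)
  ultimately show "(LBINT x. f (Complex x a) / (Complex x a - z)) = (if a < Im z then 2 * of_real pi * \<i> * f z else 0)"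
    unfolding q_def using tendsto_unique[OF trivial_limit_at_top_linorder] by fastforce
qed

section \<open>The Poisson kernel\<close>

definition poisson_kernel :: "real \<Rightarrow> real \<Rightarrow> real" where
  "poisson_kernel s u = s / (pi * (u\<^sup>2 + s\<^sup>2))"

definition poisson :: "real \<Rightarrow> (real \<Rightarrow> complex) \<Rightarrow> real \<Rightarrow> complex" where
  "poisson s f x = (LINT t|lborel. of_real (poisson_kernel s (x - t)) * f t)"

lemma poisson_kernel_measurable [measurable]: "poisson_kernel s \<in> borel_measurable borel"
  unfolding poisson_kernel_def by measurable

lemma poisson_kernel_nonneg [simp]: "0 < s \<Longrightarrow> 0 \<le> poisson_kernel s u"
  by (simp add: poisson_kernel_def)

lemma poisson_kernel_minus [simp]: "poisson_kernel s (- u) = poisson_kernel s u"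
  by (simp add: poisson_kernel_def)

lemma poisson_kernel_commute: "poisson_kernel s (x - t) = poisson_kernel s (t - x)"
  using poisson_kernel_minus[of s "x - t"] by simp

lemma poisson_kernel_le: "0 < s \<Longrightarrow> poisson_kernel s u \<le> 1 / (pi * s)"
proof -
  assume s: "0 < s"
  have "u\<^sup>2 + s\<^sup>2 > 0" using s by (simp add: add_nonneg_pos)
  then show ?thesis using s unfolding poisson_kernel_def by (simp add: divide_simps power2_eq_square)
qed

lemma has_bochner_integral_poisson_kernel_0:
  assumes s: "0 < s" shows "has_bochner_integral lborel (poisson_kernel s) 1"
proof -
  have eq: "poisson_kernel s (0 + s * x) = inverse (1 + x\<^sup>2) * (1 / (pi * s))" for x
  proof -
    have "1 + x\<^sup>2 \<noteq> 0" by (smt (verit) zero_le_power2)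
    moreover have "(s * x)\<^sup>2 + s\<^sup>2 = s\<^sup>2 * (1 + x\<^sup>2)" by (simp add: power_mult_distrib algebra_simps)
    ultimately show ?thesis using s by (simp add: poisson_kernel_def divide_simps power2_eq_square)
  qed
  have i: "integrable lborel (\<lambda>x::real. inverse (1 + x\<^sup>2))" "(LBINT x. inverse (1 + x\<^sup>2)) = pi"
    using integrable_inverse_1_plus_square LBINT_inverse_1_plus_square
    by (simp_all add: interval_lebesgue_integral_def set_integrable_def set_lebesgue_integral_def)
  have "integrable lborel (\<lambda>x. poisson_kernel s (0 + s * x))"
    unfolding eq using i by auto
  then have "integrable lborel (poisson_kernel s)"
    using lborel_integrable_real_affine_iff[of s "poisson_kernel s" 0] s by simp
  moreover have "(LBINT x. poisson_kernel s x) = 1"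
    unfolding lborel_integral_real_affine[OF less_imp_neq[OF s, symmetric], of "poisson_kernel s" 0] eq
    using s i by simp
  ultimately show ?thesis by (simp add: has_bochner_integral_iff)
qed

lemma has_bochner_integral_poisson_kernel:
  assumes "0 < s" shows "has_bochner_integral lborel (\<lambda>t. poisson_kernel s (x - t)) 1"
  using has_bochner_integral_poisson_kernel_0[OF assms]
    lborel_integral_real_affine[of "-1" "poisson_kernel s" x] 
    lborel_integrable_real_affine_iff[of "-1" "poisson_kernel s" x]
  by (simp add: has_bochner_integral_iff)

lemma nn_integral_poisson_kernel:
  assumes "0 < s" shows "(\<integral>\<^sup>+t. ennreal (poisson_kernel s (x - t)) \<partial>lborel) = 1"
  using has_bochner_integral_poisson_kernel[OF assms, of x] assms
  by (subst nn_integral_eq_integral) (auto simp: has_bochner_integral_iff)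

text \<open>The square of the kernel is at most its maximum 1 / (pi s) times the kernel, which has
  mass 1. The exact value is 1 / (2 pi s); the constant does not matter.\<close>

lemma sq_int_poisson_kernel:
  assumes "0 < s" 
  shows "sq_int lborel (\<lambda>t. of_real (poisson_kernel s (x - t)))"
    and "nsq lborel (\<lambda>t. of_real (poisson_kernel s (x - t))) \<le> 1 / (pi * s)"
proof -
  have "(\<integral>\<^sup>+t. ennreal ((cmod (of_real (poisson_kernel s (x - t))))\<^sup>2) \<partial>lborel)
    \<le> (\<integral>\<^sup>+t. ennreal (1 / (pi * s)) * ennreal (poisson_kernel s (x - t)) \<partial>lborel)"
  proof (intro nn_integral_mono)
    fix t
    have "poisson_kernel s (x - t) * poisson_kernel s (x - t) \<le> 1 / (pi * s) * poisson_kernel s (x - t)"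
      by (intro mult_right_mono poisson_kernel_le) (use assms in auto)
    then show "ennreal ((cmod (of_real (poisson_kernel s (x - t))))\<^sup>2) \<le> ennreal (1 / (pi * s)) * ennreal (poisson_kernel s (x - t))"
      using assms by (simp add: power2_eq_square ennreal_leI flip: ennreal_mult)
  qed
  also have "\<dots> = ennreal (1 / (pi * s))"
    using assms by (subst nn_integral_cmult) (auto simp: nn_integral_poisson_kernel)
  finally show "sq_int lborel (\<lambda>t. of_real (poisson_kernel s (x - t)))"
    and "nsq lborel (\<lambda>t. of_real (poisson_kernel s (x - t))) \<le> 1 / (pi * s)"
    using assms by (auto intro!: sq_intI_nn)
qed

lemma poisson_integrable:
  assumes "0 < s" "sq_int lborel f"
  shows "integrable lborel (\<lambda>t. of_real (poisson_kernel s (x - t)) * f t)"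
  by (intro sq_int_prod sq_int_poisson_kernel assms)

text \<open>By Cauchy-Schwarz against the kernel. This turns mean square convergence on lines into
  pointwise convergence in the half plane.\<close>

lemma poisson_bound:
  assumes "0 < s" "sq_int lborel f"
  shows "(cmod (poisson s f x))\<^sup>2 \<le> nsq lborel f / (pi * s)"
proof -
  have "cmod (poisson s f x) \<le> sqrt (nsq lborel (\<lambda>t. of_real (poisson_kernel s (x - t)))) * sqrt (nsq lborel f)"
    unfolding poisson_def by (intro Cauchy_Schwarz_int sq_int_poisson_kernel assms)
  then have "(cmod (poisson s f x))\<^sup>2 \<le> (sqrt (nsq lborel (\<lambda>t. of_real (poisson_kernel s (x - t)))) * sqrt (nsq lborel f))\<^sup>2"
    by (intro power_mono) auto
  also have "\<dots> = nsq lborel (\<lambda>t. of_real (poisson_kernel s (x - t))) * nsq lborel f"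
    by (simp add: power_mult_distrib)
  also have "\<dots> \<le> 1 / (pi * s) * nsq lborel f"
    using sq_int_poisson_kernel[OF assms(1)] by (intro mult_right_mono) auto
  finally show ?thesis by simp
qed

lemma poisson_diff:
  assumes "0 < s" "sq_int lborel f" "sq_int lborel g"
  shows "poisson s (\<lambda>t. f t - g t) x = poisson s f x - poisson s g x"
  using poisson_integrable[OF assms(1,2)] poisson_integrable[OF assms(1,3)]
  by (simp add: poisson_def algebra_simps)

text \<open>The kernel is a probability density in t, so this is Jensen's inequality for the square;
  it follows from Cauchy-Schwarz by splitting the kernel into two square roots.\<close>

lemma poisson_jensen_nn:
  assumes "0 < s" and [measurable]: "f \<in> borel_measurable borel"
  shows "(\<integral>\<^sup>+t. ennreal (poisson_kernel s (x - t)) * ennreal (cmod (f t)) \<partial>lborel)\<^sup>2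
      \<le> (\<integral>\<^sup>+t. ennreal (poisson_kernel s (x - t)) * ennreal ((cmod (f t))\<^sup>2) \<partial>lborel)"
proof -
  let ?p = "\<lambda>t. poisson_kernel s (x - t)"
  have "(\<integral>\<^sup>+t. ennreal (?p t) * ennreal (cmod (f t)) \<partial>lborel)\<^sup>2
     = (\<integral>\<^sup>+t. ennreal (sqrt (?p t)) * (ennreal (sqrt (?p t)) * ennreal (cmod (f t))) \<partial>lborel)\<^sup>2"
    using assms by (simp flip: mult.assoc ennreal_mult)
  also have "\<dots> \<le> (\<integral>\<^sup>+t. (ennreal (sqrt (?p t)))\<^sup>2 \<partial>lborel) * (\<integral>\<^sup>+t. (ennreal (sqrt (?p t)) * ennreal (cmod (f t)))\<^sup>2 \<partial>lborel)"
    by (intro Cauchy_Schwarz_nn_integral) measurable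
  also have "\<dots> = (\<integral>\<^sup>+t. ennreal (?p t) \<partial>lborel) * (\<integral>\<^sup>+t. ennreal (?p t) * ennreal ((cmod (f t))\<^sup>2) \<partial>lborel)"
    using assms by (simp add: ennreal_power power_mult_distrib)
  finally show ?thesis by (simp add: nn_integral_poisson_kernel assms)
qed

text \<open>The convolution is taken with |f| rather than f, so that the estimate gives both the
  contraction property and the absolute integrability behind the exchange of integrals in
  \<open>poisson_symmetric\<close>.\<close>

lemma poisson_abs_sq_nn:
  assumes "0 < s" and [measurable]: "f \<in> borel_measurable borel"
  shows "(\<integral>\<^sup>+x. (\<integral>\<^sup>+t. ennreal (poisson_kernel s (x - t)) * ennreal (cmod (f t)) \<partial>lborel)\<^sup>2 \<partial>lborel)
      \<le> (\<integral>\<^sup>+t. ennreal ((cmod (f t))\<^sup>2) \<partial>lborel)"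
proof -
  have "(\<integral>\<^sup>+x. (\<integral>\<^sup>+t. ennreal (poisson_kernel s (x - t)) * ennreal (cmod (f t)) \<partial>lborel)\<^sup>2 \<partial>lborel)
     \<le> (\<integral>\<^sup>+x. \<integral>\<^sup>+t. ennreal (poisson_kernel s (x - t)) * ennreal ((cmod (f t))\<^sup>2) \<partial>lborel \<partial>lborel)"
    by (intro nn_integral_mono poisson_jensen_nn assms)
  also have "\<dots> = (\<integral>\<^sup>+t. \<integral>\<^sup>+x. ennreal (poisson_kernel s (x - t)) * ennreal ((cmod (f t))\<^sup>2) \<partial>lborel \<partial>lborel)"
    by (intro lborel_pair.Fubini') measurable
  also have "\<dots> = (\<integral>\<^sup>+t. ennreal ((cmod (f t))\<^sup>2) \<partial>lborel)"
  proof (intro nn_integral_cong)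
    fix t
    have "(\<integral>\<^sup>+x. ennreal (poisson_kernel s (x - t)) * ennreal ((cmod (f t))\<^sup>2) \<partial>lborel)
        = (\<integral>\<^sup>+x. ennreal (poisson_kernel s (t - x)) \<partial>lborel) * ennreal ((cmod (f t))\<^sup>2)"
      by (subst nn_integral_multc) (auto simp: poisson_kernel_commute[of s _ t])
    then show "(\<integral>\<^sup>+x. ennreal (poisson_kernel s (x - t)) * ennreal ((cmod (f t))\<^sup>2) \<partial>lborel) = ennreal ((cmod (f t))\<^sup>2)"
      by (simp add: nn_integral_poisson_kernel assms)
  qed
  finally show ?thesis .
qed

lemma poisson_measurable [measurable]:
  assumes [measurable]: "f \<in> borel_measurable borel"
  shows "poisson s f \<in> borel_measurable borel"
  unfolding poisson_def by measurable

lemma poisson_contraction: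
  assumes "0 < s" "sq_int lborel f"
  shows "sq_int lborel (poisson s f)" "nsq lborel (poisson s f) \<le> nsq lborel f"
proof -
  have [measurable]: "f \<in> borel_measurable borel" using assms by (simp add: sq_int_def)
  have "(\<integral>\<^sup>+x. ennreal ((cmod (poisson s f x))\<^sup>2) \<partial>lborel)
     \<le> (\<integral>\<^sup>+x. (\<integral>\<^sup>+t. ennreal (poisson_kernel s (x - t)) * ennreal (cmod (f t)) \<partial>lborel)\<^sup>2 \<partial>lborel)"
  proof (intro nn_integral_mono)
    fix x
    have "ennreal (cmod (poisson s f x)) \<le> (\<integral>\<^sup>+t. ennreal (cmod (of_real (poisson_kernel s (x - t)) * f t)) \<partial>lborel)"
      unfolding poisson_def by (rule integral_norm_bound_ennreal[OF poisson_integrable[OF assms]])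
    also have "\<dots> = (\<integral>\<^sup>+t. ennreal (poisson_kernel s (x - t)) * ennreal (cmod (f t)) \<partial>lborel)"
      using assms by (simp add: norm_mult ennreal_mult)
    finally show "ennreal ((cmod (poisson s f x))\<^sup>2) \<le> (\<integral>\<^sup>+t. ennreal (poisson_kernel s (x - t)) * ennreal (cmod (f t)) \<partial>lborel)\<^sup>2"
      by (simp add: power_mono flip: ennreal_power)
  qed
  also have "\<dots> \<le> (\<integral>\<^sup>+t. ennreal ((cmod (f t))\<^sup>2) \<partial>lborel)"
    by (intro poisson_abs_sq_nn assms) measurable
  also have "\<dots> = ennreal (nsq lborel f)" by (rule nn_integral_sq_int[OF assms(2)])
  finally show "sq_int lborel (poisson s f)" "nsq lborel (poisson s f) \<le> nsq lborel f"
    by (auto intro!: sq_intI_nn)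
qed

text \<open>Exchange of integrals and evenness of the kernel. Cauchy-Schwarz and
  \<open>poisson_abs_sq_nn\<close> make the double integral absolutely convergent.\<close>

lemma poisson_symmetric:
  assumes s: "0 < s" and f: "sq_int lborel f" and g: "sq_int lborel g"
  shows "(LINT x|lborel. cnj (poisson s f x) * g x) = (LINT x|lborel. cnj (f x) * poisson s g x)"
proof -
  have [measurable]: "f \<in> borel_measurable borel" "g \<in> borel_measurable borel" using f g by (auto simp: sq_int_def)
  have [measurable]: "(\<lambda>x. cnj (f x)) \<in> borel_measurable borel"
    using sq_int_cnj[OF f] by (simp add: sq_int_def)
  define k where "k = (\<lambda>(x,t). complex_of_real (poisson_kernel s (x - t)) * cnj (f t) * g x)"
  have [measurable]: "k \<in> borel_measurable (lborel \<Otimes>\<^sub>M lborel)"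
    unfolding k_def by measurable
  have "integrable (lborel \<Otimes>\<^sub>M lborel) k"
  proof (rule integrableI_bounded)
    have "(\<integral>\<^sup>+p. ennreal (cmod (k p)) \<partial>(lborel \<Otimes>\<^sub>M lborel)) = (\<integral>\<^sup>+x. \<integral>\<^sup>+t. ennreal (cmod (k (x,t))) \<partial>lborel \<partial>lborel)"
      by (rule lborel.nn_integral_fst[symmetric]) measurable
    also have "\<dots> = (\<integral>\<^sup>+x. (\<integral>\<^sup>+t. ennreal (poisson_kernel s (x - t)) * ennreal (cmod (f t)) \<partial>lborel) * ennreal (cmod (g x)) \<partial>lborel)"
      using s by (intro nn_integral_cong) 
        (auto simp: k_def norm_mult ennreal_mult mult.assoc nn_integral_multc[symmetric] intro!: nn_integral_cong)
    finally have e: "(\<integral>\<^sup>+p. ennreal (cmod (k p)) \<partial>(lborel \<Otimes>\<^sub>M lborel)) = \<dots>" .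
    have "(\<integral>\<^sup>+p. ennreal (cmod (k p)) \<partial>(lborel \<Otimes>\<^sub>M lborel))\<^sup>2
      \<le> (\<integral>\<^sup>+x. (\<integral>\<^sup>+t. ennreal (poisson_kernel s (x - t)) * ennreal (cmod (f t)) \<partial>lborel)\<^sup>2 \<partial>lborel) * (\<integral>\<^sup>+x. (ennreal (cmod (g x)))\<^sup>2 \<partial>lborel)"
      unfolding e by (rule Cauchy_Schwarz_nn_integral) measurable
    also have "\<dots> \<le> ennreal (nsq lborel f) * ennreal (nsq lborel g)"
      using poisson_abs_sq_nn[OF s, of f] by (intro mult_mono) (auto simp: ennreal_power nn_integral_sq_int f g)
    also have "\<dots> < \<infinity>" by (simp add: ennreal_mult_less_top)
    finally show "(\<integral>\<^sup>+p. ennreal (cmod (k p)) \<partial>(lborel \<Otimes>\<^sub>M lborel)) < \<infinity>"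
      by (simp add: power_less_top_ennreal)
  qed measurable
  then have "(LINT x|lborel. LINT t|lborel. k (x,t)) = (LINT t|lborel. LINT x|lborel. k (x,t))"
    by (intro lborel_pair.Fubini_integral[symmetric]) (simp add: split_beta')
  moreover have "(LINT t|lborel. k (x,t)) = cnj (poisson s f x) * g x" for x
  proof -
    have "cnj (poisson s f x) = (LINT t|lborel. cnj (of_real (poisson_kernel s (x - t)) * f t))"
      unfolding poisson_def by (rule Bochner_Integration.integral_cnj[symmetric])
    then show ?thesis by (simp add: k_def)
  qed
  moreover have "(LINT x|lborel. k (x,t)) = cnj (f t) * poisson s g t" for t
  proof -
    have "(LINT x|lborel. k (x,t)) = (LINT x|lborel. cnj (f t) * (complex_of_real (poisson_kernel s (t - x)) * g x))"
      unfolding k_def by (simp add: poisson_kernel_commute[of s _ t] mult_ac)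
    then show ?thesis unfolding poisson_def by simp
  qed
  ultimately show ?thesis by simp
qed

section \<open>Boundary functions in the mean square sense\<close>

text \<open>The squared modulus is pi / |Im w| times the Poisson kernel at height |Im w| centred at
  Re w, and that kernel has mass 1.\<close>

lemma sq_int_inv_linear:
  assumes "Im w \<noteq> 0"
  shows "sq_int lborel (\<lambda>x. 1 / (of_real x - w))" "nsq lborel (\<lambda>x. 1 / (of_real x - w)) = pi / \<bar>Im w\<bar>"
proof -
  let ?s = "\<bar>Im w\<bar>"
  have s: "0 < ?s" using assms by simp
  have eq: "(cmod (1 / (of_real x - w)))\<^sup>2 = pi / ?s * poisson_kernel ?s (Re w - x)" for x
    using s by (simp add: norm_divide power_divide cmod_power2 poisson_kernel_def power2_commute)
  have i: "integrable lborel (\<lambda>x. poisson_kernel ?s (Re w - x))" "(LBINT x. poisson_kernel ?s (Re w - x)) = 1"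
    using has_bochner_integral_poisson_kernel[OF s, of "Re w"] by (auto simp: has_bochner_integral_iff)
  show "sq_int lborel (\<lambda>x. 1 / (of_real x - w))"
    unfolding sq_int_def eq using i by auto
  show "nsq lborel (\<lambda>x. 1 / (of_real x - w)) = pi / ?s"
    unfolding nsq_def eq using i by simp
qed

section \<open>Hardy functions on horizontal lines\<close>

lemma H2_holomorphic: "F \<in> H2 \<Longrightarrow> F holomorphic_on upper_half_plane"
  and H2_outside: "F \<in> H2 \<Longrightarrow> Im z \<le> 0 \<Longrightarrow> F z = 0"
  by (auto simp: H2_def)

text \<open>Holomorphy gives continuity on the open half plane, and the convention that F vanishes
  elsewhere makes F Borel on the whole plane, as \<open>half_plane_Cauchy\<close> requires.\<close>

lemma H2_measurable [measurable_dest]: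
  assumes "F \<in> H2" shows "F \<in> borel_measurable borel"
proof -
  have "(\<lambda>z. indicator upper_half_plane z *\<^sub>R F z) \<in> borel_measurable borel"
    using holomorphic_on_imp_continuous_on[OF H2_holomorphic[OF assms]] open_upper_half_plane
    by (intro borel_measurable_continuous_on_indicator) auto
  moreover have "(\<lambda>z. indicator upper_half_plane z *\<^sub>R F z) = F"
    using H2_outside[OF assms] by (auto simp: fun_eq_iff split: split_indicator)
  ultimately show ?thesis by simp
qed

lemma H2_lines_bounded:
  assumes "F \<in> H2"
  shows "\<exists>M\<ge>0. \<forall>y>0. sq_int lborel (\<lambda>x. F (Complex x y)) \<and> nsq lborel (\<lambda>x. F (Complex x y)) \<le> M"
proof -
  let ?S = "SUP y\<in>{0<..}. \<integral>\<^sup>+x. ennreal ((norm (F (Complex x y)))\<^sup>2) \<partial>lebesgue"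
  have [measurable]: "F \<in> borel_measurable borel" by (rule H2_measurable[OF assms])
  have "?S < \<infinity>" using assms by (simp add: H2_def)
  then obtain M where M: "0 \<le> M" "?S = ennreal M"
    by (cases ?S) auto
  have "(\<integral>\<^sup>+x. ennreal ((cmod (F (Complex x y)))\<^sup>2) \<partial>lborel) \<le> ennreal M" if "0 < y" for y
    unfolding M(2)[symmetric] nn_integral_completion[symmetric, of lborel]
    using that by (intro SUP_upper) auto
  moreover have "(\<lambda>x. F (Complex x y)) \<in> borel_measurable lborel" for y by measurable
  ultimately have "\<forall>y>0. sq_int lborel (\<lambda>x. F (Complex x y)) \<and> nsq lborel (\<lambda>x. F (Complex x y)) \<le> M"
    using M(1) sq_intI_nn by blast
  then show ?thesis using M(1) by blast
qed

lemma H2_I: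
  assumes "F holomorphic_on upper_half_plane" "\<And>z. Im z \<le> 0 \<Longrightarrow> F z = 0"
    "\<And>y. 0 < y \<Longrightarrow> sq_int lborel (\<lambda>x. F (Complex x y))"
    "\<And>y. 0 < y \<Longrightarrow> nsq lborel (\<lambda>x. F (Complex x y)) \<le> M"
  shows "F \<in> H2"
proof -
  have "(SUP y\<in>{0<..}. \<integral>\<^sup>+x. ennreal ((norm (F (Complex x y)))\<^sup>2) \<partial>lebesgue) \<le> ennreal M"
    using assms(3,4) by (intro SUP_least) (auto simp: nn_integral_completion nn_integral_sq_int intro: ennreal_leI)
  then show ?thesis using assms(1,2) by (auto simp: H2_def le_less_trans not_less)
qed

lemma H2_sq_int: "F \<in> H2 \<Longrightarrow> 0 < y \<Longrightarrow> sq_int lborel (\<lambda>x. F (Complex x y))"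
  using H2_lines_bounded by blast

lemma Cauchy_kernel_weight_tendsto: "((\<lambda>y. sqrt M * sqrt (pi / (y + 1))) \<longlongrightarrow> 0) at_top"
proof -
  have "((\<lambda>y. sqrt M * sqrt (pi * inverse (y + 1))) \<longlongrightarrow> sqrt M * sqrt (pi * 0)) at_top"
    by (intro tendsto_intros tendsto_inverse_0_at_top filterlim_at_top_add_at_top[OF filterlim_ident, of _]
        filterlim_tendsto_add_at_top[OF tendsto_const filterlim_ident, of 1, unfolded add.commute[of 1]])
  then show ?thesis by (simp add: divide_inverse)
qed

lemma H2_Cauchy:
  assumes F: "F \<in> H2" and a: "0 < a" and z: "Im z \<noteq> a"
  shows "integrable lborel (\<lambda>x. F (Complex x a) / (Complex x a - z))"
    and "(LBINT x. F (Complex x a) / (Complex x a - z)) = (if a < Im z then 2 * of_real pi * \<i> * F z else 0)"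
proof -
  obtain M where M: "0 \<le> M" "\<And>y. 0 < y \<Longrightarrow> sq_int lborel (\<lambda>x. F (Complex x y))"
    "\<And>y. 0 < y \<Longrightarrow> nsq lborel (\<lambda>x. F (Complex x y)) \<le> M" using H2_lines_bounded[OF F] by blast
  \<comment> \<open>Cauchy-Schwarz on the line at height y: F contributes at most sqrt M, and the
    weight 1 / |x + i (y + 1)| has squared norm pi / (y + 1).\<close>
  let ?m = "\<lambda>y. sqrt M * sqrt (pi / (y + 1))"
  have bound: "(\<integral>\<^sup>+x. ennreal (cmod (F (Complex x y)) / cmod (Complex x y + \<i>)) \<partial>lborel) \<le> ennreal (?m y)" if "a \<le> y" for y
  proof -
    let ?w = "Complex 0 (- (y + 1))"
    have y: "0 < y" using a that by simp
    have k: "sq_int lborel (\<lambda>x. 1 / (of_real x - ?w))" "nsq lborel (\<lambda>x. 1 / (of_real x - ?w)) = pi / (y + 1)"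
      using sq_int_inv_linear[of ?w] y by auto
    have e: "of_real x - ?w = Complex x y + \<i>" for x by (simp add: complex_eq_iff)
    have "(\<integral>\<^sup>+x. ennreal (cmod (F (Complex x y)) / cmod (Complex x y + \<i>)) \<partial>lborel)
       = (\<integral>\<^sup>+x. ennreal (cmod (F (Complex x y)) * cmod (1 / (of_real x - ?w))) \<partial>lborel)"
      unfolding e by (simp add: norm_divide)
    also have "\<dots> = ennreal (LBINT x. cmod (F (Complex x y)) * cmod (1 / (of_real x - ?w)))"
      by (intro nn_integral_eq_integral integrable_norm[OF sq_int_prod[OF M(2)[OF y] k(1)], unfolded norm_mult]) auto
    also have "\<dots> \<le> ennreal (?m y)"
    proof (rule ennreal_leI)
      have "(LBINT x. cmod (F (Complex x y)) * cmod (1 / (of_real x - ?w))) 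
        \<le> sqrt (nsq lborel (\<lambda>x. F (Complex x y))) * sqrt (pi / (y + 1))"
        using Cauchy_Schwarz_abs[OF M(2)[OF y] k(1)] unfolding k(2) .
      also have "\<dots> \<le> ?m y" using M(3)[OF y] y by (intro mult_right_mono) auto
      finally show "(LBINT x. cmod (F (Complex x y)) * cmod (1 / (of_real x - ?w))) \<le> ?m y" .
    qed
    finally show ?thesis .
  qed
  have m: "0 \<le> ?m y" "?m y \<le> ?m a" if "a \<le> y" for y
    using that a M(1) by (auto intro!: mult_left_mono divide_left_mono)
  show "integrable lborel (\<lambda>x. F (Complex x a) / (Complex x a - z))"
    by (rule half_plane_Cauchy(1)[OF H2_holomorphic[OF F] H2_measurable[OF F] a z bound m Cauchy_kernel_weight_tendsto])
  show "(LBINT x. F (Complex x a) / (Complex x a - z)) = (if a < Im z then 2 * of_real pi * \<i> * F z else 0)"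
    by (rule half_plane_Cauchy(2)[OF H2_holomorphic[OF F] H2_measurable[OF F] a z bound m Cauchy_kernel_weight_tendsto])
qed

text \<open>Subtract from the Cauchy formula at x + i (y + s) the one at the mirror image x + i (y -
  s), which lies below the line of integration and contributes 0. The difference of the two Cauchy
  kernels is 2 pi i times the Poisson kernel.\<close>

lemma H2_poisson:
  assumes F: "F \<in> H2" and y: "0 < y" and s: "0 < s"
  shows "F (Complex x (y + s)) = poisson s (\<lambda>t. F (Complex t y)) x"
proof -
  let ?z = "Complex x (y + s)" and ?z' = "Complex x (y - s)"
  have "2 * of_real pi * \<i> * F ?z = (LBINT t. F (Complex t y) / (Complex t y - ?z)) - (LBINT t. F (Complex t y) / (Complex t y - ?z'))"
    using s by (simp add: H2_Cauchy[OF F y])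
  also have "\<dots> = (LBINT t. F (Complex t y) / (Complex t y - ?z) - F (Complex t y) / (Complex t y - ?z'))"
    using s by (intro Bochner_Integration.integral_diff[symmetric] H2_Cauchy[OF F y]) auto
  also have "\<dots> = (LBINT t. 2 * of_real pi * \<i> * (of_real (poisson_kernel s (x - t)) * F (Complex t y)))"
  proof (rule arg_cong[where f="integral\<^sup>L lborel"], rule ext)
    fix t
    define u where "u = x - t"
    have e: "Complex t y - ?z = - (of_real u + \<i> * of_real s)" "Complex t y - ?z' = - (of_real u - \<i> * of_real s)"
      by (auto simp: complex_eq_iff u_def)
    have n: "of_real u + \<i> * of_real s \<noteq> 0" "of_real u - \<i> * of_real s \<noteq> 0"
      using s by (auto simp: complex_eq_iff)
    have "(of_real u + \<i> * of_real s) * (of_real u - \<i> * of_real s) = complex_of_real (u\<^sup>2 + s\<^sup>2)"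
      by (simp add: algebra_simps power2_eq_square)
    moreover have "1 / - A - 1 / - B = (A - B) / (A * B)" if "A \<noteq> 0" "B \<noteq> 0" for A B :: complex
      using that by (simp add: field_simps)
    note this[OF n]
    ultimately have "2 * \<i> * of_real s / complex_of_real (u\<^sup>2 + s\<^sup>2) = 1 / - (of_real u + \<i> * of_real s) - 1 / - (of_real u - \<i> * of_real s)"
      by (simp only:) simp
    moreover have "2 * of_real pi * \<i> * of_real (poisson_kernel s u) = 2 * \<i> * of_real s / complex_of_real (u\<^sup>2 + s\<^sup>2)"
      by (simp add: poisson_kernel_def)
    ultimately have k: "1 / (Complex t y - ?z) - 1 / (Complex t y - ?z') = 2 * of_real pi * \<i> * of_real (poisson_kernel s (x - t))"
      unfolding e u_def[symmetric] by (simp only:)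
    have "F (Complex t y) / (Complex t y - ?z) - F (Complex t y) / (Complex t y - ?z')
       = (1 / (Complex t y - ?z) - 1 / (Complex t y - ?z')) * F (Complex t y)"
      unfolding left_diff_distrib by (simp only: times_divide_eq_left mult_1)
    then show "F (Complex t y) / (Complex t y - ?z) - F (Complex t y) / (Complex t y - ?z')
      = 2 * of_real pi * \<i> * (of_real (poisson_kernel s (x - t)) * F (Complex t y))"
      unfolding k by (simp only: mult.assoc)
  qed
  also have "\<dots> = 2 * of_real pi * \<i> * poisson s (\<lambda>t. F (Complex t y)) x"
    unfolding poisson_def by simp
  finally show ?thesis by simp
qed

lemma H2_nsq_antimono:
  assumes F: "F \<in> H2" and "0 < a" "a \<le> b"
  shows "nsq lborel (\<lambda>x. F (Complex x b)) \<le> nsq lborel (\<lambda>x. F (Complex x a))"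
proof (cases "a = b")
  case False
  then have "(\<lambda>x. F (Complex x b)) = poisson (b - a) (\<lambda>x. F (Complex x a))"
    using H2_poisson[OF F, of a "b - a"] assms by auto
  then show ?thesis using poisson_contraction[of "b - a"] H2_sq_int[OF F] False assms by simp
qed simp

lemma H2_nsq_diff:
  assumes F: "F \<in> H2" and a: "0 < a" "a \<le> b"
  shows "nsq lborel (\<lambda>x. F (Complex x a) - F (Complex x b))
    \<le> nsq lborel (\<lambda>x. F (Complex x a)) - nsq lborel (\<lambda>x. F (Complex x b))"
proof (cases "a = b")
  case True then show ?thesis by (simp add: nsq_def)
next
  case False
  let ?F = "\<lambda>y x. F (Complex x y)"
  define c s where "c = (a + b) / 2" and "s = (b - a) / 2"
  have c: "0 < c" "0 < s" "a + s = c" "c + s = b" "c \<le> b" using a False by (auto simp: c_def s_def field_simps)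
  have sq: "sq_int lborel (?F y)" if "0 < y" for y using H2_sq_int[OF F that] .
  have "(LINT x|lborel. cnj (?F a x) * ?F b x) = (LINT x|lborel. cnj (?F a x) * poisson s (?F c) x)"
    using H2_poisson[OF F c(1,2)] c(4) by simp
  also have "\<dots> = (LINT x|lborel. cnj (poisson s (?F a) x) * ?F c x)"
    by (rule poisson_symmetric[symmetric]) (use a c sq in auto)
  also have "\<dots> = (LINT x|lborel. cnj (?F c x) * ?F c x)"
    using H2_poisson[OF F a(1) c(2)] c(3) by simp
  also have "\<dots> = of_real (nsq lborel (?F c))" by (intro nsq_eq_inner sq c)
  finally have "nsq lborel (\<lambda>x. ?F a x - ?F b x) = nsq lborel (?F a) + nsq lborel (?F b) - 2 * nsq lborel (?F c)"
    using a by (subst nsq_diff) (auto intro: sq)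
  \<comment> \<open>Norms decrease with the height, so 2 |F_c|^2 may be replaced by 2 |F_b|^2, which
    leaves |F_a|^2 - |F_b|^2.\<close>
  moreover have "nsq lborel (?F b) \<le> nsq lborel (?F c)"
    by (intro H2_nsq_antimono F c)
  ultimately show ?thesis by simp
qed

text \<open>Here the boundary function is a mean square limit with a Borel representative
  \<open>\<phi>\<close>. That it agrees with the nontangential limits is shown later, from its
  Poisson integral.\<close>

lemma H2_L2_boundary:
  assumes F: "F \<in> H2"
  obtains \<phi> where "sq_int lborel \<phi>"
    "((\<lambda>y. nsq lborel (\<lambda>x. F (Complex x y) - \<phi> x)) \<longlongrightarrow> 0) (at_right 0)"
    "\<And>s x. 0 < s \<Longrightarrow> F (Complex x s) = poisson s \<phi> x"
proof -
  let ?F = "\<lambda>y x. F (Complex x y)"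
  define N where "N = (\<lambda>y. nsq lborel (?F y))"
  obtain M where M: "0 \<le> M" "\<And>y. 0 < y \<Longrightarrow> sq_int lborel (?F y)" "\<And>y. 0 < y \<Longrightarrow> N y \<le> M" 
    unfolding N_def using H2_lines_bounded[OF F] by blast
  have [measurable]: "F \<in> borel_measurable borel" by (rule H2_measurable[OF F])
  define L where "L = (SUP y\<in>{0<..}. N y)"
  have bdd: "bdd_above (N ` {0<..})" using M(3) by (auto intro!: bdd_aboveI)
  have NL: "N y \<le> L" if "0 < y" for y unfolding L_def using that by (intro cSUP_upper bdd) auto
  have Nanti: "N b \<le> N a" if "0 < a" "a \<le> b" for a b unfolding N_def by (intro H2_nsq_antimono F that)
  have near: "\<exists>d>0. L - e < N d" if "0 < e" for e
  proof -
    have "L - e < L" using that by simp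
    then show ?thesis unfolding L_def using less_cSUP_iff[OF _ bdd] by auto
  qed
  have "\<exists>d>0. L - (1/4)^n < N d" for n by (rule near) simp
  then obtain d where d: "\<And>n. 0 < d n" "\<And>n. L - (1/4)^n < N (d n)" by metis
  \<comment> \<open>The minimum makes Y decreasing and at most 1 / (n + 1). Since Y n <= d n, the
    value N (Y n) is within 4^(-n) of L, which by \<open>H2_nsq_diff\<close> bounds the squared
    increments along Y.\<close>
  define Y where "Y n = Min (insert (1 / real (Suc n)) (d ` {..n}))" for n
  have Ypos: "0 < Y n" for n unfolding Y_def using d by auto
  have Yd: "Y n \<le> d n" and Yn: "Y n \<le> 1 / real (Suc n)" for n
    unfolding Y_def by (intro Min_le; simp)+
  have Ydec: "Y (Suc n) \<le> Y n" for n
  proof -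
    have "Y (Suc n) \<le> 1 / real (Suc n)" using Yn[of "Suc n"] by (rule order_trans) (auto simp: divide_simps)
    moreover have "Y (Suc n) \<le> d i" if "i \<le> n" for i unfolding Y_def using that by (intro Min_le) auto
    ultimately show ?thesis by (subst (2) Y_def) auto
  qed
  have Y0: "Y \<longlonglongrightarrow> 0"
    by (rule tendsto_sandwich[OF _ _ tendsto_const LIMSEQ_inverse_real_of_nat]) 
      (use Ypos Yn in \<open>auto simp: inverse_eq_divide less_imp_le\<close>)
  have "nsq lborel (\<lambda>x. ?F (Y (Suc n)) x - ?F (Y n) x) \<le> (1/4)^n" for n
  proof -
    have "nsq lborel (\<lambda>x. ?F (Y (Suc n)) x - ?F (Y n) x) \<le> N (Y (Suc n)) - N (Y n)"
      unfolding N_def by (intro H2_nsq_diff F Ypos Ydec)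
    also have "\<dots> \<le> L - N (d n)" using NL[OF Ypos, of "Suc n"] Nanti[OF Ypos Yd, of n] by linarith
    also have "\<dots> \<le> (1/4)^n" using d(2)[of n] by linarith
    finally show ?thesis .
  qed
  then have conv: "AE x in lborel. convergent (\<lambda>n. ?F (Y n) x)"
    by (intro sq_int_fast_Cauchy_AE_convergent) (auto intro: M(2) Ypos)
  define \<phi> where "\<phi> = (\<lambda>x. lim (\<lambda>n. ?F (Y n) x))"
  have \<phi>m [measurable]: "\<phi> \<in> borel_measurable lborel"
    unfolding \<phi>_def by (intro borel_measurable_lim_metric) measurable
  have lim: "AE x in lborel. (\<lambda>n. ?F (Y n) x) \<longlonglongrightarrow> \<phi> x"
    using conv by eventually_elim (simp add: \<phi>_def convergent_LIMSEQ_iff)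
  have sq\<phi>: "sq_int lborel \<phi>"
    by (rule sq_int_Fatou(1)[OF _ _ \<phi>m lim]) (auto intro: M(2) Ypos M(3)[unfolded N_def])
  \<comment> \<open>Fatou along the chosen sequence estimates the distance from
    \<open>\<phi>\<close> for every height y, so the whole family converges and not just the
    sequence.\<close>
  have dist: "nsq lborel (\<lambda>x. ?F y x - \<phi> x) \<le> L - N y" if y: "0 < y" for y
  proof -
    have "eventually (\<lambda>n. Y n < y) sequentially" using order_tendstoD(2)[OF Y0 y] .
    then obtain n0 where n0: "\<And>n. n0 \<le> n \<Longrightarrow> Y n < y" by (auto simp: eventually_sequentially)
    have "nsq lborel (\<lambda>x. \<phi> x - ?F y x) \<le> L - N y"
    proof (rule sq_int_Fatou(2)[where f = "\<lambda>n x. ?F (Y (n + n0)) x - ?F y x"])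
      show "sq_int lborel (\<lambda>x. ?F (Y (n + n0)) x - ?F y x)" for n
        by (intro sq_int_diff M(2) Ypos y)
      show "nsq lborel (\<lambda>x. ?F (Y (n + n0)) x - ?F y x) \<le> L - N y" for n
        using H2_nsq_diff[OF F Ypos less_imp_le[OF n0], of "n + n0"] NL[OF Ypos, of "n + n0"] by (simp add: N_def)
      show "AE x in lborel. (\<lambda>n. ?F (Y (n + n0)) x - ?F y x) \<longlonglongrightarrow> \<phi> x - ?F y x"
        using lim by eventually_elim (intro tendsto_intros LIMSEQ_ignore_initial_segment)
    qed measurable
    then show ?thesis by (simp add: nsq_def norm_minus_commute)
  qed
  have T0: "((\<lambda>y. nsq lborel (\<lambda>x. F (Complex x y) - \<phi> x)) \<longlongrightarrow> 0) (at_right 0)"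
  proof (rule tendstoI)
    fix e :: real assume "0 < e"
    then obtain \<delta> where \<delta>: "0 < \<delta>" "L - e < N \<delta>" using near by blast
    have "eventually (\<lambda>y. y \<in> {0<..<\<delta>}) (at_right 0)"
      using \<delta> eventually_at_right_less eventually_at_right_real by blast
    then show "eventually (\<lambda>y. dist (nsq lborel (\<lambda>x. F (Complex x y) - \<phi> x)) 0 < e) (at_right 0)"
    proof eventually_elim
      case (elim y)
      then show ?case using dist[of y] Nanti[of y \<delta>] \<delta> by (auto simp: dist_real_def)
    qed
  qed
  have "F (Complex x s) = poisson s \<phi> x" if s: "0 < s" for s x
  proof -
    have "(\<lambda>n. F (Complex x (Y n + s))) \<longlonglongrightarrow> F (Complex x (0 + s))"
    proof -
      have "isCont F (Complex x s)"
        using holomorphic_on_imp_continuous_on[OF H2_holomorphic[OF F]] s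
        by (simp add: continuous_on_eq_continuous_at open_upper_half_plane)
      moreover have "(\<lambda>n. Complex x (Y n + s)) \<longlonglongrightarrow> Complex x (0 + s)"
        by (intro tendsto_intros Y0)
      ultimately show ?thesis by (metis add_0 isCont_tendsto_compose)
    qed
    \<comment> \<open>By the semigroup law the difference is the Poisson integral of F_(Y n) -
      \<open>\<phi>\<close>, which \<open>poisson_bound\<close> controls at every single
      point.\<close>
    moreover have "(\<lambda>n. F (Complex x (Y n + s)) - poisson s \<phi> x) \<longlonglongrightarrow> 0"
    proof (rule tendsto_norm_zero_cancel, rule tendsto_sandwich[OF _ _ tendsto_const])
      have "filterlim Y (at_right 0) sequentially"
        using Y0 Ypos Ypos[THEN less_imp_neq, THEN not_sym] by (simp add: filterlim_at)
      then have "(\<lambda>n. nsq lborel (\<lambda>x. F (Complex x (Y n)) - \<phi> x)) \<longlonglongrightarrow> 0"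
        using T0 by (rule filterlim_compose[rotated])
      then have "(\<lambda>n. sqrt (nsq lborel (\<lambda>x. F (Complex x (Y n)) - \<phi> x) / (pi * s))) \<longlonglongrightarrow> sqrt (0 / (pi * s))"
        by (intro tendsto_intros) (use s in auto)
      then show "(\<lambda>n. sqrt (nsq lborel (\<lambda>x. F (Complex x (Y n)) - \<phi> x) / (pi * s))) \<longlonglongrightarrow> 0" by simp
      show "eventually (\<lambda>n. cmod (F (Complex x (Y n + s)) - poisson s \<phi> x) 
        \<le> sqrt (nsq lborel (\<lambda>x. F (Complex x (Y n)) - \<phi> x) / (pi * s))) sequentially"
      proof (intro always_eventually allI real_le_rsqrt)
        fix n
        have "F (Complex x (Y n + s)) - poisson s \<phi> x = poisson s (\<lambda>t. F (Complex t (Y n)) - \<phi> t) x"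
          by (simp add: H2_poisson[OF F Ypos s] poisson_diff[OF s M(2)[OF Ypos] sq\<phi>])
        then show "(cmod (F (Complex x (Y n + s)) - poisson s \<phi> x))\<^sup>2 \<le> nsq lborel (\<lambda>x. F (Complex x (Y n)) - \<phi> x) / (pi * s)"
          using poisson_bound[OF s sq_int_diff[OF M(2)[OF Ypos] sq\<phi>]] by simp
      qed
    qed auto
    ultimately have "(\<lambda>n. F (Complex x (Y n + s))) \<longlonglongrightarrow> F (Complex x s)" "(\<lambda>n. F (Complex x (Y n + s))) \<longlonglongrightarrow> poisson s \<phi> x"
      by (auto simp: LIM_zero_iff)
    then show ?thesis by (rule LIMSEQ_unique)
  qed
  then show ?thesis using that sq\<phi> T0 by blast
qed

section \<open>Nontangential limits\<close>

text \<open>Lebesgue differentiation for the gauge integral, with one sided intervals. The upper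
  estimate is kept because it will be applied to the deviations |f - q|.\<close>

lemma right_average_converges:
  fixes f :: "real \<Rightarrow> real"
  assumes f: "\<And>a b. set_integrable lborel {a..b} f"
  obtains N where "negligible N" 
    "\<And>x e. x \<notin> N \<Longrightarrow> 0 < e \<Longrightarrow> \<exists>d>0. \<forall>h. 0 < h \<and> h < d \<longrightarrow> (LBINT t:{x..x+h}. f t) \<le> (f x + e) * h"
proof -
  have "f integrable_on cbox a b" for a b
    using set_borel_integral_eq_integral(1)[OF f[of a b]] by simp
  then obtain N where N: "negligible N"
    "\<And>x e. x \<notin> N \<Longrightarrow> 0 < e \<Longrightarrow> \<exists>d>0. \<forall>h. 0 < h \<and> h < d \<longrightarrow> norm (integral (cbox x (x + h *\<^sub>R One)) f /\<^sub>R h ^ DIM(real) - f x) < e"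
    using integrable_ccontinuous_explicit[of f] by metis
  show ?thesis
  proof (rule that[OF N(1)])
    fix x e :: real assume "x \<notin> N" "0 < e"
    then obtain d where d: "d > 0" "\<And>h. 0 < h \<Longrightarrow> h < d \<Longrightarrow> \<bar>integral {x..x+h} f / h - f x\<bar> < e"
      using N(2)[of x e] by (auto simp: divide_inverse_commute)
    have "(LBINT t:{x..x+h}. f t) \<le> (f x + e) * h" if h: "0 < h" "h < d" for h
    proof -
      have "integral {x..x+h} f / h < f x + e" using d(2)[OF h] by (simp add: abs_less_iff)
      then show ?thesis using set_borel_integral_eq_integral(2)[OF f[of x "x+h"]] h by (simp add: divide_less_eq)
    qed
    then show "\<exists>d>0. \<forall>h. 0 < h \<and> h < d \<longrightarrow> (LBINT t:{x..x+h}. f t) \<le> (f x + e) * h"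
      using d(1) by blast
  qed
qed

lemma set_lborel_integral_uminus:
  fixes f :: "real \<Rightarrow> real"
  shows "(LBINT t:{-b..-a}. f (- t)) = (LBINT t:{a..b}. f t)"
proof -
  have "(LBINT t. indicator {-b..-a} t *\<^sub>R f (- t)) = (LBINT t. indicator {a..b} (0 + (-1) * t) *\<^sub>R f (0 + (-1) * t))"
    by (intro Bochner_Integration.integral_cong) (auto split: split_indicator)
  then show ?thesis
    unfolding set_lebesgue_integral_def using lborel_integral_real_affine[of "-1" "\<lambda>t. indicator {a..b} t *\<^sub>R f t" 0] by simp
qed

lemma set_lborel_integrable_uminus:
  fixes f :: "real \<Rightarrow> real"
  assumes "set_integrable lborel {a..b} f"
  shows "set_integrable lborel {-b..-a} (\<lambda>t. f (- t))"
proof -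
  have "integrable lborel (\<lambda>t. indicator {a..b} (0 + (-1) * t) *\<^sub>R f (0 + (-1) * t))"
    using assms unfolding set_integrable_def by (rule lborel_integrable_real_affine) simp
  moreover have "(\<lambda>t. indicator {a..b} (0 + (-1) * t) *\<^sub>R f (0 + (-1) * t)) = (\<lambda>t. indicator {-b..-a} t *\<^sub>R f (- t))"
    by (rule ext) (auto split: split_indicator)
  ultimately show ?thesis by (simp only: set_integrable_def)
qed

text \<open>Left averages of f are right averages of its reflection, and reflection preserves
  negligible sets. The two halves share the endpoint x; as f is nonnegative, counting it twice is
  harmless for an upper bound.\<close>

lemma symmetric_average_converges:
  fixes f :: "real \<Rightarrow> real"
  assumes f: "\<And>a b. set_integrable lborel {a..b} f" and f0: "\<And>x. 0 \<le> f x"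
  obtains N where "negligible N" 
    "\<And>x e. x \<notin> N \<Longrightarrow> 0 < e \<Longrightarrow> \<exists>d>0. \<forall>h. 0 < h \<and> h < d \<longrightarrow> (LBINT t:{x-h..x+h}. f t) \<le> 2 * (f x + e) * h"
proof -
  obtain N1 where N1: "negligible N1" 
    "\<And>x e. x \<notin> N1 \<Longrightarrow> 0 < e \<Longrightarrow> \<exists>d>0. \<forall>h. 0 < h \<and> h < d \<longrightarrow> (LBINT t:{x..x+h}. f t) \<le> (f x + e) * h"
    using right_average_converges[OF f] by blast
  have f': "set_integrable lborel {a..b} (\<lambda>t. f (- t))" for a b
    using set_lborel_integrable_uminus[where a="-b" and b="-a", OF f] by simp
  obtain N2 where N2: "negligible N2" 
    "\<And>x e. x \<notin> N2 \<Longrightarrow> 0 < e \<Longrightarrow> \<exists>d>0. \<forall>h. 0 < h \<and> h < d \<longrightarrow> (LBINT t:{x..x+h}. f (- t)) \<le> (f (- x) + e) * h"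
    using right_average_converges[OF f'] by blast
  have neg: "negligible (uminus ` N2)"
    by (intro negligible_differentiable_image_negligible N2(1))
      (auto simp: differentiable_on_def intro!: derivative_intros)
  show ?thesis
  proof (rule that)
    show "negligible (N1 \<union> uminus ` N2)"
      using N1(1) neg by (rule negligible_Un)
    fix x e :: real assume x: "x \<notin> N1 \<union> uminus ` N2" and e: "0 < e"
    have x2: "- x \<notin> N2"
    proof
      assume "- x \<in> N2"
      then have "- (- x) \<in> uminus ` N2" by blast
      with x show False by simp
    qed
    obtain d1 where d1: "d1 > 0" "\<And>h. 0 < h \<Longrightarrow> h < d1 \<Longrightarrow> (LBINT t:{x..x+h}. f t) \<le> (f x + e) * h"
      using N1(2)[of x e] x e by auto
    obtain d2 where d2: "d2 > 0" "\<And>h. 0 < h \<Longrightarrow> h < d2 \<Longrightarrow> (LBINT t:{-x..-x+h}. f (- t)) \<le> (f x + e) * h"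
      using N2(2)[OF x2 e] by auto
    have "(LBINT t:{x-h..x+h}. f t) \<le> 2 * (f x + e) * h" if h: "0 < h" "h < min d1 d2" for h
    proof -
      have "(LBINT t:{x-h..x+h}. f t) \<le> (LBINT t. indicator {x-h..x} t *\<^sub>R f t + indicator {x..x+h} t *\<^sub>R f t)"
        unfolding set_lebesgue_integral_def 
        using f[unfolded set_integrable_def, of "x-h" "x+h"] f[unfolded set_integrable_def, of "x-h" x] f[unfolded set_integrable_def, of x "x+h"]
        by (intro integral_mono Bochner_Integration.integrable_add) (auto simp: f0 split: split_indicator)
      also have "\<dots> = (LBINT t:{x-h..x}. f t) + (LBINT t:{x..x+h}. f t)"
        unfolding set_lebesgue_integral_def using f[unfolded set_integrable_def]
        by (intro Bochner_Integration.integral_add)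
      also have "(LBINT t:{x-h..x}. f t) = (LBINT t:{-x..-x+h}. f (- t))"
        using set_lborel_integral_uminus[of x "x-h" f] by simp
      finally show ?thesis using d1(2)[OF h(1)] d2(2)[OF h(1)] h by (simp add: algebra_simps)
    qed
    then show "\<exists>d>0. \<forall>h. 0 < h \<and> h < d \<longrightarrow> (LBINT t:{x-h..x+h}. f t) \<le> 2 * (f x + e) * h"
      using d1(1) d2(1) by (intro exI[of _ "min d1 d2"]) auto
  qed
qed

text \<open>For each fixed q the averages of |f - q| behave well off a null set that depends on q. A
  countable dense set of values q leaves one null set, and outside it |f - f x| is compared with |f
  - q| for q close to f x.\<close>

theorem AE_Lebesgue_point:
  fixes f :: "real \<Rightarrow> complex"
  assumes f: "\<And>a b. set_integrable lborel {a..b} f"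
  shows "AE x in lborel. \<forall>e>0. \<exists>d>0. \<forall>h. 0 < h \<and> h < d \<longrightarrow> (LBINT t:{x-h..x+h}. cmod (f t - f x)) \<le> e * h"
proof -
  obtain D :: "complex set" where D: "countable D" "\<And>X. open X \<Longrightarrow> X \<noteq> {} \<Longrightarrow> \<exists>d\<in>D. d \<in> X"
    using countable_dense_exists by (metis)
  have fq: "set_integrable lborel {a..b} (\<lambda>t. cmod (f t - q))" for a b q
  proof -
    have "set_integrable lborel {a..b} (\<lambda>t. q)" 
      by (intro borel_integrable_atLeastAtMost' continuous_intros)
    then show ?thesis using f[of a b] by (intro set_integrable_norm set_integral_diff)
  qed
  have "\<exists>N. negligible N \<and> (\<forall>x e. x \<notin> N \<longrightarrow> 0 < e \<longrightarrow> 
      (\<exists>d>0. \<forall>h. 0 < h \<and> h < d \<longrightarrow> (LBINT t:{x-h..x+h}. cmod (f t - q)) \<le> 2 * (cmod (f x - q) + e) * h))" for q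
    by (rule symmetric_average_converges[of "\<lambda>t. cmod (f t - q)"]) (use fq in auto)
  then obtain N where N: "\<And>q. negligible (N q)" "\<And>q x e. x \<notin> N q \<Longrightarrow> 0 < e \<Longrightarrow>
      (\<exists>d>0. \<forall>h. 0 < h \<and> h < d \<longrightarrow> (LBINT t:{x-h..x+h}. cmod (f t - q)) \<le> 2 * (cmod (f x - q) + e) * h)"
    by metis
  have "negligible (\<Union>(N ` D))"
    using D(1) N(1) by (intro negligible_countable_Union) auto
  then have "AE x in lebesgue. x \<notin> \<Union>(N ` D)"
    by (intro AE_not_in) (simp add: negligible_iff_null_sets)
  then have ae: "AE x in lborel. x \<notin> \<Union>(N ` D)"
    unfolding AE_completion_iff .
  show ?thesis
  proof (use ae in eventually_elim, intro allI impI)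
    fix x e :: real assume x: "x \<notin> \<Union>(N ` D)" and e: "0 < e"
    \<comment> \<open>The triangle inequality leads to 2 (|f x - q| + e/8) h + 2 h |f x - q|, the
      last term from the length 2 h of the interval; with |f x - q| < e/8 this is below 3 e h /
      4.\<close>
    obtain q where q: "q \<in> D" "cmod (f x - q) < e / 8"
      using D(2)[of "ball (f x) (e/8)"] e by (auto simp: dist_norm)
    obtain d where d: "d > 0" "\<And>h. 0 < h \<Longrightarrow> h < d \<Longrightarrow> (LBINT t:{x-h..x+h}. cmod (f t - q)) \<le> 2 * (cmod (f x - q) + e/8) * h"
      using N(2)[of x q "e/8"] x q e by auto
    have "(LBINT t:{x-h..x+h}. cmod (f t - f x)) \<le> e * h" if h: "0 < h" "h < d" for h
    proof -
      have c: "set_integrable lborel {x-h..x+h} (\<lambda>t. cmod (f x - q))"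
        by (intro borel_integrable_atLeastAtMost' continuous_intros)
      have "(LBINT t:{x-h..x+h}. cmod (f t - f x)) \<le> (LBINT t:{x-h..x+h}. cmod (f t - q) + cmod (f x - q))"
        using norm_triangle_ineq4[of "f _ - q" "f x - q"]
        by (intro set_integral_mono fq set_integral_add c) simp
      also have "\<dots> = (LBINT t:{x-h..x+h}. cmod (f t - q)) + (LBINT t:{x-h..x+h}. cmod (f x - q))"
        by (intro set_integral_add fq c)
      also have "(LBINT t:{x-h..x+h}. cmod (f x - q)) = 2 * h * cmod (f x - q)"
        using h by (simp add: set_lebesgue_integral_def)
      also have "(LBINT t:{x-h..x+h}. cmod (f t - q)) + 2 * h * cmod (f x - q) \<le> (4 * cmod (f x - q) + e/4) * h"
        using d(2)[OF h] by (simp add: algebra_simps)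
      also have "\<dots> \<le> e * h" using q(2) h e by (intro mult_right_mono) auto
      finally show ?thesis .
    qed
    then show "\<exists>d>0. \<forall>h. 0 < h \<and> h < d \<longrightarrow> (LBINT t:{x-h..x+h}. cmod (f t - f x)) \<le> e * h"
      using d(1) by blast
  qed
qed

text \<open>The weight is minus the derivative of the kernel in s, so this is the fundamental
  theorem of calculus on the half line from v, where the kernel decays to 0.\<close>

lemma poisson_kernel_layer_cake:
  assumes s: "0 < y" "0 \<le> v"
  shows "(\<integral>\<^sup>+s. ennreal (2 * y * s / (pi * (s\<^sup>2 + y\<^sup>2)\<^sup>2)) * indicator {v..} s \<partial>lborel) = ennreal (poisson_kernel y v)"
proof -
  have pos: "s\<^sup>2 + y\<^sup>2 > 0" for s using s by (simp add: add_nonneg_pos)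
  have "(\<integral>\<^sup>+s. ennreal (2 * y * s / (pi * (s\<^sup>2 + y\<^sup>2)\<^sup>2)) * indicator {v..} s \<partial>lborel) = ennreal (0 - (- poisson_kernel y v))"
  proof (rule nn_integral_FTC_atLeast)
    fix x assume "v \<le> x"
    show "((\<lambda>s. - poisson_kernel y s) has_real_derivative 2 * y * x / (pi * (x\<^sup>2 + y\<^sup>2)\<^sup>2)) (at x)"
    proof -
      have "((\<lambda>s. - (y / pi) * inverse (s\<^sup>2 + y\<^sup>2)) has_real_derivative
          - (y / pi) * - (inverse (x\<^sup>2 + y\<^sup>2) * (2 * x) * inverse (x\<^sup>2 + y\<^sup>2))) (at x)"
        using pos[of x] by (auto intro!: derivative_eq_intros)
      then show ?thesis
        by (simp add: poisson_kernel_def divide_inverse power2_eq_square mult_ac)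
    qed
    show "0 \<le> 2 * y * x / (pi * (x\<^sup>2 + y\<^sup>2)\<^sup>2)"
      using s \<open>v \<le> x\<close> by auto
  next
    have "filterlim (\<lambda>s::real. s\<^sup>2 + y\<^sup>2) at_top at_top"
      by (rule filterlim_at_top_mono[OF filterlim_pow_at_top[where n=2, OF _ filterlim_ident]]) auto
    then have "((\<lambda>s. - (y / pi) * inverse (s\<^sup>2 + y\<^sup>2)) \<longlongrightarrow> - (y / pi) * 0) at_top"
      by (intro tendsto_intros tendsto_inverse_0_at_top)
    then show "((\<lambda>s. - poisson_kernel y s) \<longlongrightarrow> 0) at_top"
      by (simp add: poisson_kernel_def divide_inverse mult_ac)
  qed measurable
  then show ?thesis by simp
qed

(* Near c the layer cake formula writes the Poisson kernel as a mixture of indicators of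
   intervals centred at c; away from c it is at most a multiple of y times the kernel at height 1. *)
lemma poisson_Lebesgue_point:
  fixes \<psi> :: "real \<Rightarrow> real"
  assumes [measurable]: "\<psi> \<in> borel_measurable borel"
    and fin: "(\<integral>\<^sup>+t. ennreal (poisson_kernel 1 (c - t)) * ennreal (\<psi> t) \<partial>lborel) < \<infinity>"
    and leb: "\<And>e. 0 < e \<Longrightarrow> \<exists>d>0. \<forall>h. 0 < h \<and> h < d \<longrightarrow> (\<integral>\<^sup>+t. ennreal (\<psi> t) * indicator {c-h..c+h} t \<partial>lborel) \<le> ennreal (e * h)"
    and e: "0 < e"
  shows "\<exists>d>0. \<forall>y. 0 < y \<and> y < d \<longrightarrow> (\<integral>\<^sup>+t. ennreal (poisson_kernel y (c - t)) * ennreal (\<psi> t) \<partial>lborel) \<le> ennreal e"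
proof -
  \<comment> \<open>The constant e/4 works because s times the layer cake weight is at most twice
    the kernel at s, and the kernel has mass 1: the part near c stays below e/2.\<close>
  obtain d0 where d0: "d0 > 0" "\<And>h. 0 < h \<Longrightarrow> h < d0 \<Longrightarrow> (\<integral>\<^sup>+t. ennreal (\<psi> t) * indicator {c-h..c+h} t \<partial>lborel) \<le> ennreal (e/4 * h)"
    using leb[of "e/4"] e by auto
  define d where "d = d0 / 2"
  have d: "0 < d" "d < d0" using d0 by (auto simp: d_def)
  obtain J where J: "0 \<le> J" "(\<integral>\<^sup>+t. ennreal (poisson_kernel 1 (c - t)) * ennreal (\<psi> t) \<partial>lborel) = ennreal J"
    using fin by (cases "(\<integral>\<^sup>+t. ennreal (poisson_kernel 1 (c - t)) * ennreal (\<psi> t) \<partial>lborel)") auto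
  \<comment> \<open>For u = (c - t)^2 >= d^2 one has 1 + u <= (1 + 1 / d^2) u, which compares the
    kernel at height y with y times the kernel at height 1.\<close>
  define K where "K = 1 + 1 / d\<^sup>2"
  have K: "0 < K" by (simp add: K_def add_pos_nonneg)
  define k where "k = (\<lambda>y s. 2 * y * s / (pi * (s\<^sup>2 + y\<^sup>2)\<^sup>2))"
  have [measurable]: "k y \<in> borel_measurable borel" for y unfolding k_def by measurable
  have near: "(\<integral>\<^sup>+t. ennreal (poisson_kernel y (c - t)) * ennreal (\<psi> t) * indicator {c-d..c+d} t \<partial>lborel) \<le> ennreal (e/2)"
    if y: "0 < y" for y
  proof -
    have "(\<integral>\<^sup>+t. ennreal (poisson_kernel y (c - t)) * ennreal (\<psi> t) * indicator {c-d..c+d} t \<partial>lborel)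
       = (\<integral>\<^sup>+t. \<integral>\<^sup>+s. ennreal (k y s) * indicator {\<bar>c - t\<bar>..} s * (ennreal (\<psi> t) * indicator {c-d..c+d} t) \<partial>lborel \<partial>lborel)"
    proof (intro nn_integral_cong)
      fix t
      have "poisson_kernel y (c - t) = poisson_kernel y \<bar>c - t\<bar>" by (simp add: poisson_kernel_def)
      then show "ennreal (poisson_kernel y (c - t)) * ennreal (\<psi> t) * indicator {c-d..c+d} t
        = (\<integral>\<^sup>+s. ennreal (k y s) * indicator {\<bar>c - t\<bar>..} s * (ennreal (\<psi> t) * indicator {c-d..c+d} t) \<partial>lborel)"
        using poisson_kernel_layer_cake[OF y, of "\<bar>c - t\<bar>"] by (subst nn_integral_multc) (auto simp: k_def mult.assoc)
    qed
    \<comment> \<open>The indicator of an interval that depends on t is rewritten as a condition on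
      the pair, so that joint measurability can be checked.\<close>
    also have "\<dots> = (\<integral>\<^sup>+t. \<integral>\<^sup>+s. ennreal (k y s) * (if \<bar>c - t\<bar> \<le> s then 1 else 0) * (ennreal (\<psi> t) * indicator {c-d..c+d} t) \<partial>lborel \<partial>lborel)"
      by (intro nn_integral_cong) (auto split: split_indicator)
    also have "\<dots> = (\<integral>\<^sup>+s. \<integral>\<^sup>+t. ennreal (k y s) * (if \<bar>c - t\<bar> \<le> s then 1 else 0) * (ennreal (\<psi> t) * indicator {c-d..c+d} t) \<partial>lborel \<partial>lborel)"
      by (intro lborel_pair.Fubini') measurable
    also have "\<dots> \<le> (\<integral>\<^sup>+s. ennreal (e/2) * ennreal (poisson_kernel y (0 - s)) \<partial>lborel)"
    proof (intro nn_integral_mono)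
      fix s :: real
      show "(\<integral>\<^sup>+t. ennreal (k y s) * (if \<bar>c - t\<bar> \<le> s then 1 else 0) * (ennreal (\<psi> t) * indicator {c-d..c+d} t) \<partial>lborel)
         \<le> ennreal (e/2) * ennreal (poisson_kernel y (0 - s))"
      proof (cases "0 < s")
        case False
        then have "k y s \<le> 0" using y by (auto simp: k_def divide_le_0_iff mult_le_0_iff)
        then show ?thesis by (simp add: ennreal_neg)
      next
        case True
        \<comment> \<open>Cutting off at distance d replaces the layer of radius s by one of radius
          min s d, which is below d0 and hence covered by the hypothesis on averages.\<close>
        define h where "h = min s d"
        have h: "0 < h" "h < d0" "h \<le> s" using True d by (auto simp: h_def)
        have "(\<integral>\<^sup>+t. ennreal (k y s) * (if \<bar>c - t\<bar> \<le> s then 1 else 0) * (ennreal (\<psi> t) * indicator {c-d..c+d} t) \<partial>lborel)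
          = (\<integral>\<^sup>+t. ennreal (k y s) * (ennreal (\<psi> t) * indicator {c-h..c+h} t) \<partial>lborel)"
          by (intro nn_integral_cong) (auto simp: h_def split: split_indicator)
        also have "\<dots> = ennreal (k y s) * (\<integral>\<^sup>+t. ennreal (\<psi> t) * indicator {c-h..c+h} t \<partial>lborel)"
          by (intro nn_integral_cmult) measurable
        also have "\<dots> \<le> ennreal (k y s) * ennreal (e/4 * h)"
          by (intro mult_left_mono d0 h) auto
        also have "\<dots> \<le> ennreal (k y s) * ennreal (e/4 * s)"
          using h e by (intro mult_left_mono ennreal_leI) auto
        also have "\<dots> = ennreal (k y s * (e/4 * s))"
          using True y e by (intro ennreal_mult[symmetric]) (auto simp: k_def)
        also have "\<dots> \<le> ennreal (e/2 * poisson_kernel y (0 - s))"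
        proof (rule ennreal_leI)
          define D where "D = s\<^sup>2 + y\<^sup>2"
          have D: "0 < D" "s\<^sup>2 \<le> D" using y by (auto simp: D_def add_nonneg_pos)
          have "k y s * (e/4 * s) = e/2 * (y / (pi * D)) * (s\<^sup>2 / D)"
            unfolding k_def D_def[symmetric] by (simp add: power2_eq_square mult_ac)
          also have "\<dots> \<le> e/2 * (y / (pi * D)) * 1"
            using D e y by (intro mult_left_mono) auto
          finally show "k y s * (e/4 * s) \<le> e/2 * poisson_kernel y (0 - s)"
            by (simp add: poisson_kernel_def D_def)
        qed
        also have "\<dots> = ennreal (e/2) * ennreal (poisson_kernel y (0 - s))"
          using e y by (intro ennreal_mult) auto
        finally show ?thesis .
      qed
    qed
    also have "\<dots> = ennreal (e/2)"
      by (subst nn_integral_cmult, measurable) (simp only: nn_integral_poisson_kernel[OF y] mult_1_right)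
    finally show ?thesis .
  qed
  have far: "(\<integral>\<^sup>+t. ennreal (poisson_kernel y (c - t)) * ennreal (\<psi> t) * indicator (- {c-d..c+d}) t \<partial>lborel) \<le> ennreal (y * K * J)"
    if y: "0 < y" for y
  proof -
    have "(\<integral>\<^sup>+t. ennreal (poisson_kernel y (c - t)) * ennreal (\<psi> t) * indicator (- {c-d..c+d}) t \<partial>lborel)
      \<le> (\<integral>\<^sup>+t. ennreal (y * K) * (ennreal (poisson_kernel 1 (c - t)) * ennreal (\<psi> t)) \<partial>lborel)"
    proof (intro nn_integral_mono)
      fix t
      have "poisson_kernel y (c - t) \<le> y * K * poisson_kernel 1 (c - t)" if "t \<notin> {c-d..c+d}"
      proof -
        define u where "u = (c - t)\<^sup>2"
        have "\<bar>d\<bar> \<le> \<bar>c - t\<bar>" using that d by auto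
        then have "d\<^sup>2 \<le> u" unfolding u_def by (simp add: abs_le_square_iff)
        then have u: "d\<^sup>2 \<le> u" "0 < u" "0 < d\<^sup>2" using d by (auto intro: less_le_trans[of 0 "d\<^sup>2"])
        have "1 + u \<le> K * u" using u by (simp add: K_def field_simps)
        also have "\<dots> \<le> K * (u + y\<^sup>2)" using K by (intro mult_left_mono) auto
        finally have "1 + u \<le> K * (u + y\<^sup>2)" .
        moreover have "0 < u + y\<^sup>2" "0 < 1 + u" using u(2) zero_le_power2[of y] by linarith+
        ultimately have "1 / (u + y\<^sup>2) \<le> K / (1 + u)" by (simp add: pos_divide_le_eq pos_le_divide_eq)
        then have "y / pi * (1 / (u + y\<^sup>2)) \<le> y / pi * (K / (1 + u))"
          using y by (intro mult_left_mono) auto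
        then show ?thesis by (simp add: poisson_kernel_def u_def add.commute)
      qed
      then show "ennreal (poisson_kernel y (c - t)) * ennreal (\<psi> t) * indicator (- {c-d..c+d}) t
        \<le> ennreal (y * K) * (ennreal (poisson_kernel 1 (c - t)) * ennreal (\<psi> t))"
        using y K by (auto simp: mult.assoc[symmetric] split: split_indicator simp flip: ennreal_mult intro!: mult_right_mono ennreal_leI)
    qed
    also have "\<dots> = ennreal (y * K) * ennreal J"
      by (subst nn_integral_cmult) (auto simp: J)
    also have "\<dots> = ennreal (y * K * J)" using y K J by (simp add: ennreal_mult)
    finally show ?thesis .
  qed
  show ?thesis
  \<comment> \<open>This threshold makes y K J at most e/2; the summand 1 keeps the denominator
    positive when J = 0.\<close>
  proof (intro exI[of _ "e / (2 * (K * J + 1))"] conjI allI impI)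
    have pos: "0 < K * J + 1" using K J by (simp add: add_nonneg_pos)
    then show "0 < e / (2 * (K * J + 1))" using e by simp
    fix y assume y: "0 < y \<and> y < e / (2 * (K * J + 1))"
    have "(\<integral>\<^sup>+t. ennreal (poisson_kernel y (c - t)) * ennreal (\<psi> t) \<partial>lborel)
      = (\<integral>\<^sup>+t. ennreal (poisson_kernel y (c - t)) * ennreal (\<psi> t) * indicator {c-d..c+d} t
           + ennreal (poisson_kernel y (c - t)) * ennreal (\<psi> t) * indicator (- {c-d..c+d}) t \<partial>lborel)"
      by (intro nn_integral_cong) (auto split: split_indicator)
    also have "\<dots> = (\<integral>\<^sup>+t. ennreal (poisson_kernel y (c - t)) * ennreal (\<psi> t) * indicator {c-d..c+d} t \<partial>lborel)
        + (\<integral>\<^sup>+t. ennreal (poisson_kernel y (c - t)) * ennreal (\<psi> t) * indicator (- {c-d..c+d}) t \<partial>lborel)"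
      by (intro nn_integral_add) measurable
    also have "\<dots> \<le> ennreal (e/2) + ennreal (y * K * J)"
      using y by (intro add_mono near far) auto
    also have "\<dots> = ennreal (e/2 + y * K * J)" using e y K J by simp
    also have "\<dots> \<le> ennreal e"
    proof (rule ennreal_leI)
      have "y * (K * J) \<le> y * (K * J + 1)" using y by (intro mult_left_mono) auto
      also have "\<dots> \<le> e / 2" using y pos by (simp add: field_simps)
      finally show "e/2 + y * K * J \<le> e" by (simp add: mult.assoc)
    qed
    finally show "(\<integral>\<^sup>+t. ennreal (poisson_kernel y (c - t)) * ennreal (\<psi> t) \<partial>lborel) \<le> ennreal e" .
  qed
qed

section \<open>Limits in cones at Lebesgue points\<close>

lemma sq_int_set_integrable:
  assumes "sq_int lborel f" shows "set_integrable lborel {a..b::real} f"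
proof -
  have "integrable lborel (\<lambda>x. (indicator {a..b} x :: real))" by (simp add: integrable_indicator_iff emeasure_lborel_Icc_eq)
  moreover have "(cmod (indicator {a..b} x))\<^sup>2 = (indicator {a..b} x :: real)" for x :: real
    by (auto split: split_indicator)
  ultimately have "sq_int lborel (\<lambda>x. indicator {a..b} x :: complex)"
    by (simp add: sq_int_def)
  then have "integrable lborel (\<lambda>x. indicator {a..b} x * f x)"
    using assms by (rule sq_int_prod)
  moreover have "(\<lambda>x. indicator {a..b} x * f x) = (\<lambda>x. indicator {a..b} x *\<^sub>R f x)"
    by (rule ext) (auto split: split_indicator)
  ultimately show ?thesis by (simp only: set_integrable_def)
qed

text \<open>In a cone the offset |x - c| is at most a multiple of y, so the centre of the kernel can
  be moved to the vertex c at the cost of a constant factor. Nontangential convergence thus reduces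
  to an estimate on the vertical line over c.\<close>

lemma poisson_kernel_cone:
  assumes "0 < y" "\<bar>x - c\<bar> < \<alpha> * y" "0 < \<alpha>"
  shows "poisson_kernel y (x - t) \<le> (2 + 2 * \<alpha>\<^sup>2) * poisson_kernel y (c - t)"
proof -
  define u v where "u = x - t" and "v = c - t"
  have "\<bar>v - u\<bar> \<le> \<bar>\<alpha> * y\<bar>" using assms by (auto simp: u_def v_def)
  then have "(v - u)\<^sup>2 \<le> \<alpha>\<^sup>2 * y\<^sup>2" by (simp add: abs_le_square_iff power_mult_distrib)
  \<comment> \<open>The difference of the two sides is (2 u - v)^2.\<close>
  moreover have "v\<^sup>2 \<le> 2 * u\<^sup>2 + 2 * (v - u)\<^sup>2"
    using zero_le_power2[of "2 * u - v"] by (simp add: power2_eq_square algebra_simps)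
  ultimately have "v\<^sup>2 + y\<^sup>2 \<le> 2 * u\<^sup>2 + (1 + 2 * \<alpha>\<^sup>2) * y\<^sup>2" by (simp add: algebra_simps)
  also have "\<dots> \<le> (2 + 2 * \<alpha>\<^sup>2) * (u\<^sup>2 + y\<^sup>2)"
    by (simp add: algebra_simps)
  finally have le: "v\<^sup>2 + y\<^sup>2 \<le> (2 + 2 * \<alpha>\<^sup>2) * (u\<^sup>2 + y\<^sup>2)" .
  have "0 < v\<^sup>2 + y\<^sup>2" "0 < u\<^sup>2 + y\<^sup>2" using assms by (auto simp: add_nonneg_pos)
  then have "1 / (u\<^sup>2 + y\<^sup>2) \<le> (2 + 2 * \<alpha>\<^sup>2) / (v\<^sup>2 + y\<^sup>2)"
    using le by (simp add: divide_simps)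
  then have "y / pi * (1 / (u\<^sup>2 + y\<^sup>2)) \<le> y / pi * ((2 + 2 * \<alpha>\<^sup>2) / (v\<^sup>2 + y\<^sup>2))"
    using assms by (intro mult_left_mono) auto
  then show ?thesis by (simp add: poisson_kernel_def u_def v_def mult_ac)
qed

text \<open>As the kernel has mass 1, F z - \<open>\<phi> c\<close> is the Poisson integral of
  \<open>\<phi>\<close> - \<open>\<phi> c\<close>. In a cone \<open>poisson_kernel_cone\<close>
  moves the centre to c, and \<open>poisson_Lebesgue_point\<close> finishes at every Lebesgue point
  c.\<close>

theorem poisson_nontangential_limit:
  assumes \<phi>: "sq_int lborel \<phi>" and F: "\<And>x y. 0 < y \<Longrightarrow> F (Complex x y) = poisson y \<phi> x"
  shows "AE x in lborel. (F \<longlongrightarrow> \<phi> x) (nontangential x)"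
proof -
  have [measurable]: "\<phi> \<in> borel_measurable borel" using \<phi> by (simp add: sq_int_def)
  have si: "set_integrable lborel {a..b} \<phi>" for a b by (rule sq_int_set_integrable[OF \<phi>])
  have "AE x in lborel. \<forall>e>0. \<exists>d>0. \<forall>h. 0 < h \<and> h < d \<longrightarrow> (LBINT t:{x-h..x+h}. cmod (\<phi> t - \<phi> x)) \<le> e * h"
    by (rule AE_Lebesgue_point[OF si])
  then show ?thesis
  proof eventually_elim
    case (elim c)
    define \<psi> where "\<psi> t = cmod (\<phi> t - \<phi> c)" for t
    have [measurable]: "\<psi> \<in> borel_measurable borel" unfolding \<psi>_def by measurable
    have \<psi>0: "0 \<le> \<psi> t" for t by (simp add: \<psi>_def)
    have leb: "\<exists>d>0. \<forall>h. 0 < h \<and> h < d \<longrightarrow> (\<integral>\<^sup>+t. ennreal (\<psi> t) * indicator {c-h..c+h} t \<partial>lborel) \<le> ennreal (e * h)"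
      if e: "0 < e" for e
    proof -
      obtain d where d: "0 < d" "\<And>h. 0 < h \<and> h < d \<Longrightarrow> (LBINT t:{c-h..c+h}. \<psi> t) \<le> e * h"
        using elim e unfolding \<psi>_def by blast
      have "(\<integral>\<^sup>+t. ennreal (\<psi> t) * indicator {c-h..c+h} t \<partial>lborel) \<le> ennreal (e * h)" if h: "0 < h \<and> h < d" for h
      proof -
        have c: "set_integrable lborel {c-h..c+h} (\<lambda>t. \<phi> c)"
          by (intro borel_integrable_atLeastAtMost' continuous_intros)
        have i: "set_integrable lborel {c-h..c+h} \<psi>"
          unfolding \<psi>_def by (intro set_integrable_norm set_integral_diff si c)
        have "(\<integral>\<^sup>+t. ennreal (\<psi> t) * indicator {c-h..c+h} t \<partial>lborel) = (\<integral>\<^sup>+t. ennreal (indicator {c-h..c+h} t *\<^sub>R \<psi> t) \<partial>lborel)"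
          by (intro nn_integral_cong) (auto split: split_indicator)
        also have "\<dots> = ennreal (LBINT t:{c-h..c+h}. \<psi> t)"
          unfolding set_lebesgue_integral_def using i[unfolded set_integrable_def]
          by (intro nn_integral_eq_integral) (auto simp: \<psi>0)
        also have "\<dots> \<le> ennreal (e * h)" by (intro ennreal_leI d h)
        finally show ?thesis .
      qed
      then show ?thesis using d(1) by blast
    qed
    have fin: "(\<integral>\<^sup>+t. ennreal (poisson_kernel 1 (c - t)) * ennreal (\<psi> t) \<partial>lborel) < \<infinity>"
    proof -
      have "(\<integral>\<^sup>+t. ennreal (poisson_kernel 1 (c - t)) * ennreal (\<psi> t) \<partial>lborel)
        \<le> (\<integral>\<^sup>+t. ennreal (poisson_kernel 1 (c - t)) * ennreal (cmod (\<phi> t)) + ennreal (cmod (\<phi> c)) * ennreal (poisson_kernel 1 (c - t)) \<partial>lborel)"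
      proof (intro nn_integral_mono)
        fix t
        have "ennreal (\<psi> t) \<le> ennreal (cmod (\<phi> t)) + ennreal (cmod (\<phi> c))"
          unfolding \<psi>_def by (simp add: ennreal_leI norm_triangle_ineq4 flip: ennreal_plus)
        then have "ennreal (poisson_kernel 1 (c - t)) * ennreal (\<psi> t) \<le> ennreal (poisson_kernel 1 (c - t)) * (ennreal (cmod (\<phi> t)) + ennreal (cmod (\<phi> c)))"
          by (intro mult_left_mono) auto
        then show "ennreal (poisson_kernel 1 (c - t)) * ennreal (\<psi> t) \<le> ennreal (poisson_kernel 1 (c - t)) * ennreal (cmod (\<phi> t)) + ennreal (cmod (\<phi> c)) * ennreal (poisson_kernel 1 (c - t))"
          by (simp add: distrib_left mult.commute)
      qed
      also have "\<dots> = (\<integral>\<^sup>+t. ennreal (poisson_kernel 1 (c - t)) * ennreal (cmod (\<phi> t)) \<partial>lborel) + ennreal (cmod (\<phi> c))"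
        by (subst nn_integral_add, measurable, subst nn_integral_cmult, measurable) (simp add: nn_integral_poisson_kernel)
      also have "\<dots> < \<infinity>"
      proof -
        have "(\<integral>\<^sup>+t. ennreal (cmod (of_real (poisson_kernel 1 (c - t)) * \<phi> t)) \<partial>lborel) < \<infinity>"
          using poisson_integrable[OF _ \<phi>, of 1 c] by (auto simp: integrable_iff_bounded)
        then show ?thesis by (simp add: norm_mult ennreal_mult)
      qed
      finally show ?thesis .
    qed
    have diff: "ennreal (cmod (F z - \<phi> c)) \<le> ennreal (2 + 2 * \<alpha>\<^sup>2) * (\<integral>\<^sup>+t. ennreal (poisson_kernel (Im z) (c - t)) * ennreal (\<psi> t) \<partial>lborel)"
      if z: "z \<in> stolz_cone \<alpha> c" and \<alpha>: "0 < \<alpha>" for z \<alpha>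
    proof -
      define x y where "x = Re z" and "y = Im z"
      have y: "0 < y" and xc: "\<bar>x - c\<bar> < \<alpha> * y" and zz: "z = Complex x y"
        using z by (auto simp: stolz_cone_def x_def y_def)
      have one: "has_bochner_integral lborel (\<lambda>t. of_real (poisson_kernel y (x - t)) :: complex) (of_real 1)"
        by (intro has_bochner_integral_of_real has_bochner_integral_poisson_kernel y)
      then have "integrable lborel (\<lambda>t. of_real (poisson_kernel y (x - t)) * \<phi> c)" 
        "(LINT t|lborel. of_real (poisson_kernel y (x - t)) * \<phi> c) = \<phi> c"
        by (auto simp: has_bochner_integral_iff)
      note one' = this
      have i: "integrable lborel (\<lambda>t. of_real (poisson_kernel y (x - t)) * (\<phi> t - \<phi> c))"
        using poisson_integrable[OF y \<phi>, of x] one'(1) by (simp add: right_diff_distrib)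
      have "F z - \<phi> c = (LINT t|lborel. of_real (poisson_kernel y (x - t)) * \<phi> t) - (LINT t|lborel. of_real (poisson_kernel y (x - t)) * \<phi> c)"
        unfolding one'(2) zz F[OF y] poisson_def ..
      also have "\<dots> = (LINT t|lborel. of_real (poisson_kernel y (x - t)) * (\<phi> t - \<phi> c))"
        using poisson_integrable[OF y \<phi>, of x] one'(1) by (simp add: right_diff_distrib)
      finally have "ennreal (cmod (F z - \<phi> c)) \<le> (\<integral>\<^sup>+t. ennreal (cmod (of_real (poisson_kernel y (x - t)) * (\<phi> t - \<phi> c))) \<partial>lborel)"
        using integral_norm_bound_ennreal[OF i] by simp
      also have "\<dots> \<le> (\<integral>\<^sup>+t. ennreal (2 + 2 * \<alpha>\<^sup>2) * (ennreal (poisson_kernel y (c - t)) * ennreal (\<psi> t)) \<partial>lborel)"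
      proof (intro nn_integral_mono)
        fix t
        have "cmod (of_real (poisson_kernel y (x - t)) * (\<phi> t - \<phi> c)) = poisson_kernel y (x - t) * \<psi> t"
          using y by (simp add: norm_mult \<psi>_def)
        also have "\<dots> \<le> (2 + 2 * \<alpha>\<^sup>2) * poisson_kernel y (c - t) * \<psi> t"
          by (intro mult_right_mono poisson_kernel_cone y xc \<alpha> \<psi>0)
        finally have "ennreal (cmod (of_real (poisson_kernel y (x - t)) * (\<phi> t - \<phi> c))) \<le> ennreal ((2 + 2 * \<alpha>\<^sup>2) * poisson_kernel y (c - t) * \<psi> t)"
          by (rule ennreal_leI)
        also have "\<dots> = ennreal (2 + 2 * \<alpha>\<^sup>2) * (ennreal (poisson_kernel y (c - t)) * ennreal (\<psi> t))"
          using y \<psi>0 by (simp add: ennreal_mult mult.assoc)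
        finally show "ennreal (cmod (of_real (poisson_kernel y (x - t)) * (\<phi> t - \<phi> c))) \<le> ennreal (2 + 2 * \<alpha>\<^sup>2) * (ennreal (poisson_kernel y (c - t)) * ennreal (\<psi> t))" .
      qed
      also have "\<dots> = ennreal (2 + 2 * \<alpha>\<^sup>2) * (\<integral>\<^sup>+t. ennreal (poisson_kernel y (c - t)) * ennreal (\<psi> t) \<partial>lborel)"
        by (intro nn_integral_cmult) measurable
      finally show ?thesis by (simp add: y_def)
    qed
    show ?case unfolding tendsto_nontangential_iff
    proof (intro allI impI)
      fix \<alpha> :: real assume \<alpha>: "0 < \<alpha>"
      define C where "C = 2 + 2 * \<alpha>\<^sup>2"
      have C: "0 < C" by (simp add: C_def add_pos_nonneg)
      show "(F \<longlongrightarrow> \<phi> c) (at (complex_of_real c) within stolz_cone \<alpha> c)"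
      proof (rule tendstoI)
        fix e :: real assume e: "0 < e"
        obtain d where d: "0 < d" "\<And>y. 0 < y \<Longrightarrow> y < d \<Longrightarrow> (\<integral>\<^sup>+t. ennreal (poisson_kernel y (c - t)) * ennreal (\<psi> t) \<partial>lborel) \<le> ennreal (e / (2 * C))"
          using poisson_Lebesgue_point[OF _ fin leb, of "e / (2 * C)"] e C by auto
        have "dist (F z) (\<phi> c) < e" if z: "z \<in> stolz_cone \<alpha> c" "dist z (of_real c) < d" for z
        proof -
          have "0 < Im z" using z by (simp add: stolz_cone_def)
          moreover have "Im z < d"
            using z(2) abs_Im_le_cmod[of "z - of_real c"] by (simp add: dist_norm)
          ultimately have "ennreal (cmod (F z - \<phi> c)) \<le> ennreal C * ennreal (e / (2 * C))"
            using diff[OF z(1) \<alpha>] d(2)[of "Im z"] unfolding C_def[symmetric]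
            by (meson mult_left_mono order_trans zero_le)
          also have "\<dots> = ennreal (e / 2)" using C e by (simp flip: ennreal_mult)
          finally have "cmod (F z - \<phi> c) \<le> e / 2" using e by (simp add: ennreal_le_iff)
          then show ?thesis using e by (simp add: dist_norm)
        qed
        then show "eventually (\<lambda>z. dist (F z) (\<phi> c) < e) (at (complex_of_real c) within stolz_cone \<alpha> c)"
          unfolding eventually_at using d(1) by blast
      qed
    qed
  qed
qed

text \<open>Limits along the trivial filter are not unique, so this is what allows
  \<open>bdry\<close>, a \<open>Lim\<close>, to be evaluated.\<close>

lemma nontangential_nontrivial: "nontangential x \<noteq> bot"
proof
  assume b: "nontangential x = bot"
  have "at (complex_of_real x) within stolz_cone 1 x \<le> nontangential x"
    unfolding nontangential_def by (intro SUP_upper) auto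
  with b have "at (complex_of_real x) within stolz_cone 1 x = bot" by (simp add: bot_unique)
  moreover have "complex_of_real x islimpt stolz_cone 1 x"
    unfolding islimpt_approachable
  proof (intro allI impI)
    fix e :: real assume "0 < e"
    then show "\<exists>z\<in>stolz_cone 1 x. z \<noteq> complex_of_real x \<and> dist z (complex_of_real x) < e"
      by (intro bexI[of _ "complex_of_real x + \<i> * of_real (e/2)"])
        (auto simp: stolz_cone_def dist_norm norm_mult complex_eq_iff)
  qed
  ultimately show False by (simp add: trivial_limit_within)
qed

lemma bdry_eqI: "(F \<longlongrightarrow> l) (nontangential x) \<Longrightarrow> bdry F x = l"
  unfolding bdry_def by (intro tendsto_Lim nontangential_nontrivial)

text \<open>By completeness of Lebesgue measure. \<open>bdry F\<close> is unspecified on a null set,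
  so its measurability has to come from a Borel function equal to it almost everywhere.\<close>

lemma lebesgue_measurable_AE_eq:
  fixes f g :: "real \<Rightarrow> complex"
  assumes f: "f \<in> borel_measurable lborel" and ae: "AE x in lborel. g x = f x"
  shows "g \<in> borel_measurable lebesgue"
proof (rule measurableI)
  fix A :: "complex set" assume A: "A \<in> sets borel"
  have f': "f -` A \<in> sets (completion lborel)"
    using measurable_sets[OF measurable_completion[OF f] A] by simp
  have ae': "AE x in completion lborel. x \<in> f -` A \<longleftrightarrow> x \<in> g -` A"
    using AE_completion[OF ae] by eventually_elim simp
  have "g -` A \<in> sets (completion lborel)"
    by (rule completion.in_sets_AE[OF ae' f']) simp
  then show "g -` A \<inter> space lebesgue \<in> sets lebesgue" by simp
qed simp

lemma sq_int_lebesgue_iff: 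
  assumes "f \<in> borel_measurable lborel"
  shows "sq_int lebesgue f \<longleftrightarrow> sq_int lborel f"
  using assms measurable_completion[OF assms] by (simp add: sq_int_def integrable_completion)

lemma nsq_lebesgue: 
  assumes "f \<in> borel_measurable lborel"
  shows "nsq lebesgue f = nsq lborel f"
  unfolding nsq_def using assms by (intro integral_completion) simp

text \<open>A Borel representative \<open>\<phi>\<close> of \<open>bdry F\<close> together with all
  that later arguments use. Fubini and limits are applied to \<open>\<phi>\<close> and
  \<open>lborel\<close>; the result is then carried over to \<open>bdry F\<close> and
  \<open>lebesgue\<close>.\<close>

definition L2_boundary :: "(complex \<Rightarrow> complex) \<Rightarrow> (real \<Rightarrow> complex) \<Rightarrow> bool" where
  "L2_boundary F \<phi> \<longleftrightarrow> sq_int lborel \<phi> \<and>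
     ((\<lambda>y. nsq lborel (\<lambda>x. F (Complex x y) - \<phi> x)) \<longlongrightarrow> 0) (at_right 0) \<and>
     (\<forall>s>0. \<forall>x. F (Complex x s) = poisson s \<phi> x) \<and> (AE x in lborel. bdry F x = \<phi> x)"

lemma L2_boundaryD:
  assumes "L2_boundary F \<phi>"
  shows "sq_int lborel \<phi>" "((\<lambda>y. nsq lborel (\<lambda>x. F (Complex x y) - \<phi> x)) \<longlongrightarrow> 0) (at_right 0)"
    "\<And>s x. 0 < s \<Longrightarrow> F (Complex x s) = poisson s \<phi> x" "AE x in lborel. bdry F x = \<phi> x"
  using assms unfolding L2_boundary_def by blast+

theorem H2_boundary:
  assumes F: "F \<in> H2"
  shows "\<exists>\<phi>. L2_boundary F \<phi>" and "AE x in lborel. (F \<longlongrightarrow> bdry F x) (nontangential x)"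
proof -
  obtain \<phi> where \<phi>: "sq_int lborel \<phi>"
    "((\<lambda>y. nsq lborel (\<lambda>x. F (Complex x y) - \<phi> x)) \<longlongrightarrow> 0) (at_right 0)"
    "\<And>s x. 0 < s \<Longrightarrow> F (Complex x s) = poisson s \<phi> x" using H2_L2_boundary[OF F] by blast
  have nt: "AE x in lborel. (F \<longlongrightarrow> \<phi> x) (nontangential x)"
    by (rule poisson_nontangential_limit[OF \<phi>(1,3)])
  then have "AE x in lborel. bdry F x = \<phi> x" by eventually_elim (rule bdry_eqI)
  then have "L2_boundary F \<phi>" unfolding L2_boundary_def using \<phi> by blast
  then show "\<exists>\<phi>. L2_boundary F \<phi>" by blast
  show "AE x in lborel. (F \<longlongrightarrow> bdry F x) (nontangential x)"
    using nt by eventually_elim (simp add: bdry_eqI)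
qed

section \<open>The orthogonal projection\<close>

lemma H2_bdry_measurable [measurable_dest]: 
  assumes "F \<in> H2" shows "bdry F \<in> borel_measurable lebesgue"
proof -
  obtain \<phi> where L: "L2_boundary F \<phi>" using H2_boundary(1)[OF assms] by blast
  show ?thesis
    by (rule lebesgue_measurable_AE_eq[OF sq_int_measurable[OF L2_boundaryD(1)[OF L]] L2_boundaryD(4)[OF L]])
qed

lemma H2_nsq_bdry:
  assumes F: "F \<in> H2" and L: "L2_boundary F \<phi>"
  shows "sq_int lebesgue (bdry F)" "nsq lebesgue (bdry F) = nsq lborel \<phi>"
proof -
  note \<phi> = L2_boundaryD(1,4)[OF L]
  have m: "\<phi> \<in> borel_measurable lborel" "\<phi> \<in> borel_measurable lebesgue"
    using sq_int_measurable[OF \<phi>(1)] measurable_completion[OF sq_int_measurable[OF \<phi>(1)]] by blast+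
  have ae: "AE x in lebesgue. \<phi> x = bdry F x"
    using AE_completion[OF \<phi>(2)] by eventually_elim simp
  show "sq_int lebesgue (bdry F)"
    using sq_int_AE_cong[OF sq_int_lebesgue_iff[OF m(1), THEN iffD2, OF \<phi>(1)] H2_bdry_measurable[OF F] ae] .
  show "nsq lebesgue (bdry F) = nsq lborel \<phi>"
    using nsq_AE_cong[OF m(2) H2_bdry_measurable[OF F] ae] nsq_lebesgue[OF m(1)] by (rule trans[OF sym])
qed

lemma H2_bdry_sq_int: 
  assumes "F \<in> H2" shows "sq_int lebesgue (bdry F)"
proof -
  obtain \<phi> where "L2_boundary F \<phi>" using H2_boundary(1)[OF assms] by blast
  then show ?thesis by (rule H2_nsq_bdry(1)[OF assms])
qed

text \<open>Continuity of point evaluations: Cauchy sequences in the boundary norm converge locally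
  uniformly, and a function with vanishing boundary norm is 0.\<close>

lemma H2_point_bound:
  assumes F: "F \<in> H2" and y: "0 < y"
  shows "(cmod (F (Complex x y)))\<^sup>2 \<le> nsq lebesgue (bdry F) / (pi * y)"
proof -
  obtain \<phi> where L: "L2_boundary F \<phi>" using H2_boundary(1)[OF F] by blast
  note \<phi> = L2_boundaryD(1,3)[OF L]
  show ?thesis using poisson_bound[OF y \<phi>(1)] by (simp add: \<phi>(2)[OF y] H2_nsq_bdry[OF F L])
qed

lemma H2_nsq_le:
  assumes F: "F \<in> H2" and y: "0 < y"
  shows "nsq lborel (\<lambda>x. F (Complex x y)) \<le> nsq lebesgue (bdry F)"
proof -
  obtain \<phi> where L: "L2_boundary F \<phi>" using H2_boundary(1)[OF F] by blast
  note \<phi> = L2_boundaryD(1,3)[OF L]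
  show ?thesis using poisson_contraction(2)[OF y \<phi>(1)] by (simp add: \<phi>(2)[OF y] H2_nsq_bdry[OF F L])
qed

text \<open>The norm of \<open>\<phi>\<close> is at most that of F_y plus that of F_y -
  \<open>\<phi>\<close>, and the latter tends to 0. This is the converse estimate to
  \<open>H2_nsq_le\<close>.\<close>

lemma H2_nsq_bdry_le:
  assumes F: "F \<in> H2" and B: "\<And>y. 0 < y \<Longrightarrow> nsq lborel (\<lambda>x. F (Complex x y)) \<le> B"
  shows "nsq lebesgue (bdry F) \<le> B"
proof -
  obtain \<phi> where L: "L2_boundary F \<phi>" using H2_boundary(1)[OF F] by blast
  note \<phi> = L2_boundaryD(1,2)[OF L]
  have "((\<lambda>y. sqrt B + sqrt (nsq lborel (\<lambda>x. F (Complex x y) - \<phi> x))) \<longlongrightarrow> sqrt B + sqrt 0) (at_right 0)"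
    by (intro tendsto_intros \<phi>)
  moreover have "eventually (\<lambda>y. sqrt (nsq lborel \<phi>) \<le> sqrt B + sqrt (nsq lborel (\<lambda>x. F (Complex x y) - \<phi> x))) (at_right 0)"
    using eventually_at_right_less[of "0::real"]
  proof eventually_elim
    case (elim y)
    have "sqrt (nsq lborel (\<lambda>x. F (Complex x y) - (F (Complex x y) - \<phi> x)))
      \<le> sqrt (nsq lborel (\<lambda>x. F (Complex x y))) + sqrt (nsq lborel (\<lambda>x. F (Complex x y) - \<phi> x))"
      by (intro sqrt_nsq_diff_le H2_sq_int F elim sq_int_diff \<phi>)
    then have "sqrt (nsq lborel \<phi>) \<le> sqrt (nsq lborel (\<lambda>x. F (Complex x y))) + sqrt (nsq lborel (\<lambda>x. F (Complex x y) - \<phi> x))"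
      by simp
    moreover have "sqrt (nsq lborel (\<lambda>x. F (Complex x y))) \<le> sqrt B" using B[OF elim] by (rule real_sqrt_le_mono)
    ultimately show ?case by linarith
  qed
  ultimately have "sqrt (nsq lborel \<phi>) \<le> sqrt B + sqrt 0"
    by (intro tendsto_lowerbound) auto
  then show ?thesis by (simp add: H2_nsq_bdry[OF F L])
qed

text \<open>The boundary values combine linearly only where both nontangential limits exist, hence
  almost everywhere; elsewhere \<open>Lim\<close> obeys no rule.\<close>

lemma H2_lincomb:
  assumes F: "F \<in> H2" and G: "G \<in> H2"
  shows "(\<lambda>z. a * F z + b * G z) \<in> H2"
    and "AE x in lebesgue. bdry (\<lambda>z. a * F z + b * G z) x = a * bdry F x + b * bdry G x"
proof -
  obtain M1 where M1: "\<And>y. 0 < y \<Longrightarrow> nsq lborel (\<lambda>x. F (Complex x y)) \<le> M1" using H2_lines_bounded[OF F] by blast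
  obtain M2 where M2: "\<And>y. 0 < y \<Longrightarrow> nsq lborel (\<lambda>x. G (Complex x y)) \<le> M2" using H2_lines_bounded[OF G] by blast
  show "(\<lambda>z. a * F z + b * G z) \<in> H2"
  proof (rule H2_I)
    show "(\<lambda>z. a * F z + b * G z) holomorphic_on upper_half_plane"
      by (intro holomorphic_intros H2_holomorphic F G)
    fix y :: real assume y: "0 < y"
    show "sq_int lborel (\<lambda>x. a * F (Complex x y) + b * G (Complex x y))"
      by (intro sq_int_add sq_int_cmult H2_sq_int F G y)
    have "sqrt (nsq lborel (\<lambda>x. a * F (Complex x y) - (- b) * G (Complex x y))) 
      \<le> sqrt (nsq lborel (\<lambda>x. a * F (Complex x y))) + sqrt (nsq lborel (\<lambda>x. (- b) * G (Complex x y)))"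
      by (intro sqrt_nsq_diff_le sq_int_cmult H2_sq_int F G y)
    also have "\<dots> \<le> cmod a * sqrt M1 + cmod b * sqrt M2"
      unfolding nsq_cmult using M1[OF y] M2[OF y] by (simp add: real_sqrt_mult add_mono mult_left_mono)
    finally have "sqrt (nsq lborel (\<lambda>x. a * F (Complex x y) + b * G (Complex x y))) \<le> cmod a * sqrt M1 + cmod b * sqrt M2"
      by simp
    then show "nsq lborel (\<lambda>x. a * F (Complex x y) + b * G (Complex x y)) \<le> (cmod a * sqrt M1 + cmod b * sqrt M2)\<^sup>2"
      by (rule sqrt_le_D)
  qed (simp add: H2_outside[OF F] H2_outside[OF G])
  have f: "AE x in lebesgue. (F \<longlongrightarrow> bdry F x) (nontangential x)"
    by (rule AE_completion[OF H2_boundary(2)[OF F]])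
  have g: "AE x in lebesgue. (G \<longlongrightarrow> bdry G x) (nontangential x)"
    by (rule AE_completion[OF H2_boundary(2)[OF G]])
  show "AE x in lebesgue. bdry (\<lambda>z. a * F z + b * G z) x = a * bdry F x + b * bdry G x"
    using f g by eventually_elim (intro bdry_eqI tendsto_intros)
qed

section \<open>Best approximation from H^2\<close>

lemma H2_zero: "(\<lambda>z. 0) \<in> H2"
  by (rule H2_I[where M=0]) (auto simp: sq_int_def nsq_def)

lemma nsq_parallelogram:
  assumes "sq_int M u" "sq_int M v"
  shows "nsq M (\<lambda>x. u x - v x) = 2 * nsq M u + 2 * nsq M v - nsq M (\<lambda>x. u x + v x)"
  using nsq_diff[OF assms] nsq_diff[OF assms(1) sq_int_cmult[OF assms(2), of "-1"]]
  by (simp add: nsq_def)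

text \<open>Parallelogram law: the midpoint of F and G lies in H^2 again, so its squared distance
  from f is at least d as well. Near minimisers are therefore close to each other.\<close>

lemma H2_approximants_close:
  fixes f :: "real \<Rightarrow> complex"
  defines "N \<equiv> \<lambda>F. nsq lebesgue (\<lambda>x. f x - bdry F x)"
  assumes f: "sq_int lebesgue f" and d: "\<And>F. F \<in> H2 \<Longrightarrow> d \<le> N F"
    and F: "F \<in> H2" and G: "G \<in> H2"
  shows "nsq lebesgue (bdry (\<lambda>z. F z - G z)) \<le> 2 * (N F - d) + 2 * (N G - d)"
proof -
  note [measurable] = H2_bdry_measurable[OF F] H2_bdry_measurable[OF G] sq_int_measurable[OF f]
  let ?M = "\<lambda>z. 1/2 * F z + 1/2 * G z"
  have MH: "?M \<in> H2" by (rule H2_lincomb[OF F G])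
  have DH: "(\<lambda>z. F z - G z) \<in> H2" using H2_lincomb(1)[OF F G, of 1 "-1"] by simp
  note [measurable] = H2_bdry_measurable[OF MH] H2_bdry_measurable[OF DH]
  let ?u = "\<lambda>x. f x - bdry F x" and ?v = "\<lambda>x. f x - bdry G x"
  have sq: "sq_int lebesgue ?u" "sq_int lebesgue ?v"
    by (intro sq_int_diff f H2_bdry_sq_int F G)+
  have "nsq lebesgue (bdry (\<lambda>z. F z - G z)) = nsq lebesgue (\<lambda>x. ?v x - ?u x)"
  proof (rule nsq_AE_cong)
    show "AE x in lebesgue. bdry (\<lambda>z. F z - G z) x = ?v x - ?u x"
      using H2_lincomb(2)[OF F G, of 1 "-1"] by eventually_elim simp
  qed measurable
  also have "\<dots> = 2 * N G + 2 * N F - nsq lebesgue (\<lambda>x. ?v x + ?u x)"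
    unfolding N_def by (rule nsq_parallelogram[OF sq(2,1)])
  also have "nsq lebesgue (\<lambda>x. ?v x + ?u x) = nsq lebesgue (\<lambda>x. 2 * (f x - bdry ?M x))"
  proof (rule nsq_AE_cong)
    show "AE x in lebesgue. ?v x + ?u x = 2 * (f x - bdry ?M x)"
      using H2_lincomb(2)[OF F G, of "1/2" "1/2"] by eventually_elim simp
  qed measurable
  also have "\<dots> = 4 * N ?M" by (simp only: nsq_cmult N_def) simp
  finally show ?thesis using d[OF MH] by simp
qed

text \<open>Let \<open>\<alpha>\<close> be the inner product and g the squared norm of the boundary
  function of G. Replacing F by F + t \<open>\<alpha>\<close> G changes the squared distance by t^2
  |\<alpha>|^2 g - 2 t |\<alpha>|^2, and the result cannot fall below d. The quantitative form is
  used because the minimiser is reached only as a limit.\<close>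

lemma H2_approximant_near_orthogonal:
  fixes f :: "real \<Rightarrow> complex"
  defines "N \<equiv> \<lambda>F. nsq lebesgue (\<lambda>x. f x - bdry F x)"
  assumes f: "sq_int lebesgue f" and d: "\<And>F. F \<in> H2 \<Longrightarrow> d \<le> N F"
    and F: "F \<in> H2" and G: "G \<in> H2"
  shows "(cmod (L2_inner (bdry G) (\<lambda>x. f x - bdry F x)))\<^sup>2 \<le> (nsq lebesgue (bdry G) + 1) * (N F - d)"
proof -
  define \<alpha> where "\<alpha> = L2_inner (bdry G) (\<lambda>x. f x - bdry F x)"
  define g where "g = nsq lebesgue (bdry G)"
  \<comment> \<open>The choice ensures t g <= 1; \<open>g + 1\<close> instead of g keeps the
    denominator positive when g = 0.\<close>
  define t where "t = 1 / (g + 1)"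
  have g: "0 \<le> g" "0 < g + 1" by (auto simp: g_def add_nonneg_pos)
  have t: "0 < t" "t * g \<le> 1" using g by (auto simp: t_def)
  let ?u = "\<lambda>x. f x - bdry F x" and ?c = "of_real t * \<alpha>"
  let ?M = "\<lambda>z. 1 * F z + ?c * G z"
  have MH: "?M \<in> H2" by (rule H2_lincomb[OF F G])
  note [measurable] = H2_bdry_measurable[OF F] H2_bdry_measurable[OF G] sq_int_measurable[OF f] H2_bdry_measurable[OF MH]
  have sq: "sq_int lebesgue ?u" "sq_int lebesgue (\<lambda>x. ?c * bdry G x)"
    by (intro sq_int_diff sq_int_cmult f H2_bdry_sq_int F G)+
  have "N ?M = nsq lebesgue (\<lambda>x. ?u x - ?c * bdry G x)"
    unfolding N_def
  proof (rule nsq_AE_cong)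
    show "AE x in lebesgue. f x - bdry ?M x = ?u x - ?c * bdry G x"
      using H2_lincomb(2)[OF F G, of 1 ?c] by eventually_elim simp
  qed measurable
  also have "\<dots> = N F + (cmod ?c)\<^sup>2 * g - 2 * Re (LINT x|lebesgue. cnj (?u x) * (?c * bdry G x))"
    unfolding nsq_diff[OF sq] nsq_cmult N_def g_def ..
  also have "(LINT x|lebesgue. cnj (?u x) * (?c * bdry G x)) = (LINT x|lebesgue. ?c * cnj (cnj (bdry G x) * ?u x))"
    by (intro Bochner_Integration.integral_cong) (auto simp: mult_ac)
  also have "\<dots> = ?c * cnj \<alpha>"
    unfolding \<alpha>_def L2_inner_def by (simp only: integral_mult_right_zero Bochner_Integration.integral_cnj)
  also have "Re (?c * cnj \<alpha>) = t * (cmod \<alpha>)\<^sup>2"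
    by (simp add: mult.assoc complex_mult_cnj cmod_power2 del: of_real_add)
  also have "(cmod ?c)\<^sup>2 = t\<^sup>2 * (cmod \<alpha>)\<^sup>2" by (simp add: norm_mult power_mult_distrib)
  finally have e: "N ?M = N F + t\<^sup>2 * (cmod \<alpha>)\<^sup>2 * g - 2 * (t * (cmod \<alpha>)\<^sup>2)" .
  have "t\<^sup>2 * (cmod \<alpha>)\<^sup>2 * g = t * (cmod \<alpha>)\<^sup>2 * (t * g)" by (simp add: power2_eq_square)
  also have "\<dots> \<le> t * (cmod \<alpha>)\<^sup>2 * 1" using t by (intro mult_left_mono) auto
  finally have "t * (cmod \<alpha>)\<^sup>2 \<le> N F - d" using e d[OF MH] by simp
  then show ?thesis unfolding \<alpha>_def[symmetric] g_def[symmetric] t_def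
    using g by (simp add: pos_divide_le_eq mult.commute)
qed

text \<open>A minimising sequence is Cauchy in the boundary norm. By \<open>H2_point_bound\<close>
  it converges locally uniformly in the half plane, so its limit P is holomorphic, and Fatou on each
  line bounds the differences from P. Completeness of H^2 is thus obtained inside the half plane
  rather than on the boundary.\<close>

theorem H2_projection_exists:
  assumes f: "sq_int lebesgue f"
  shows "\<exists>P\<in>H2. \<forall>G\<in>H2. L2_inner (bdry G) (\<lambda>x. f x - bdry P x) = 0"
proof -
  define N where "N = (\<lambda>F. nsq lebesgue (\<lambda>x. f x - bdry F x))"
  define d where "d = (INF F\<in>H2. N F)"
  have bdd: "bdd_below (N ` H2)" by (intro bdd_belowI[of _ 0]) (auto simp: N_def)
  have d: "d \<le> N F" if "F \<in> H2" for F unfolding d_def by (intro cINF_lower bdd that)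
  have ne: "H2 \<noteq> {}" using H2_zero by blast
  have "\<exists>F\<in>H2. N F < d + 1 / real (Suc n)" for n
    using cINF_less_iff[OF ne bdd, of "d + 1 / real (Suc n)", folded d_def] by simp
  then obtain S where S: "\<And>n. S n \<in> H2" "\<And>n. N (S n) < d + 1 / real (Suc n)" by metis
  have DH: "(\<lambda>z. S n z - S m z) \<in> H2" for n m using H2_lincomb(1)[OF S(1)[of n] S(1)[of m], of 1 "-1"] by simp
  \<comment> \<open>For n <= m the two excesses contribute 2 / (n + 1) + 2 / (m + 1), at most 4 / (n
    + 1).\<close>
  define \<epsilon> where "\<epsilon> n = 4 / real (Suc n)" for n
  have close: "nsq lebesgue (bdry (\<lambda>z. S n z - S m z)) \<le> \<epsilon> n" if "n \<le> m" for n m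
  proof -
    have "nsq lebesgue (bdry (\<lambda>z. S n z - S m z)) \<le> 2 * (N (S n) - d) + 2 * (N (S m) - d)"
      unfolding N_def by (intro H2_approximants_close f S) (use d in \<open>auto simp: N_def\<close>)
    also have "\<dots> \<le> 2 * (1 / real (Suc n)) + 2 * (1 / real (Suc m))"
      using S(2)[of n] S(2)[of m] by simp
    also have "1 / real (Suc m) \<le> 1 / real (Suc n)" using that by (simp add: divide_simps)
    finally show ?thesis by (simp add: \<epsilon>_def)
  qed
  have \<epsilon>0: "\<epsilon> \<longlonglongrightarrow> 0"
    using tendsto_mult_right_zero[OF LIMSEQ_inverse_real_of_nat, of 4] by (simp add: \<epsilon>_def[abs_def] divide_inverse)
  have \<epsilon>pos: "0 < \<epsilon> n" for n by (simp add: \<epsilon>_def)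
  have pt: "(cmod (S n z - S m z))\<^sup>2 \<le> \<epsilon> n / (pi * Im z)" if "n \<le> m" "0 < Im z" for n m z
  proof -
    have "(cmod (S n z - S m z))\<^sup>2 \<le> nsq lebesgue (bdry (\<lambda>z. S n z - S m z)) / (pi * Im z)"
      using H2_point_bound[OF DH that(2), where x="Re z"] by simp
    also have "\<dots> \<le> \<epsilon> n / (pi * Im z)" using close[OF that(1)] that(2) by (intro divide_right_mono) auto
    finally show ?thesis .
  qed
  have conv: "convergent (\<lambda>n. S n z)" for z
  proof (cases "0 < Im z")
    case True
    have "Cauchy (\<lambda>n. S n z)"
    proof (rule metric_CauchyI)
      fix e :: real assume e: "0 < e"
      have "(\<lambda>n. \<epsilon> n / (pi * Im z)) \<longlonglongrightarrow> 0 / (pi * Im z)" by (intro tendsto_intros \<epsilon>0) (use True in auto)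
      then have "eventually (\<lambda>n. \<epsilon> n / (pi * Im z) < (e/2)\<^sup>2) sequentially"
        by (rule order_tendstoD) (use e in auto)
      then obtain k where k: "\<epsilon> k / (pi * Im z) < (e/2)\<^sup>2" by (auto simp: eventually_sequentially)
      have half: "dist (S n z) (S k z) < e / 2" if "k \<le> n" for n
      proof -
        have "(cmod (S k z - S n z))\<^sup>2 < (e/2)\<^sup>2" using pt[OF that True] k by simp
        then have "cmod (S k z - S n z) < e/2" by (rule power2_less_imp_less) (use e in simp)
        then show ?thesis by (simp add: dist_norm norm_minus_commute)
      qed
      have "dist (S m z) (S n z) < e" if "k \<le> m" "k \<le> n" for m n
        by (rule dist_triangle_half_l[OF half[OF that(1)] half[OF that(2)]])
      then show "\<exists>M. \<forall>m\<ge>M. \<forall>n\<ge>M. dist (S m z) (S n z) < e" by blast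
    qed
    then show ?thesis by (simp add: Cauchy_convergent_iff)
  next
    case False
    then have "S n z = 0" for n using H2_outside[OF S(1)] by simp
    then show ?thesis by (simp add: convergent_const)
  qed
  define P where "P z = lim (\<lambda>n. S n z)" for z
  have lim: "(\<lambda>n. S n z) \<longlonglongrightarrow> P z" for z using conv[of z] by (simp add: P_def convergent_LIMSEQ_iff)
  have P0: "P z = 0" if "Im z \<le> 0" for z
    using lim[of z] H2_outside[OF S(1) that] by (simp add: LIMSEQ_const_iff)
  have pt': "(cmod (S n z - P z))\<^sup>2 \<le> \<epsilon> n / (pi * Im z)" if "0 < Im z" for n z
  proof (rule tendsto_upperbound)
    show "(\<lambda>m. (cmod (S n z - S m z))\<^sup>2) \<longlonglongrightarrow> (cmod (S n z - P z))\<^sup>2" by (intro tendsto_intros lim)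
    show "eventually (\<lambda>m. (cmod (S n z - S m z))\<^sup>2 \<le> \<epsilon> n / (pi * Im z)) sequentially"
      using eventually_ge_at_top[of n] by eventually_elim (rule pt[OF _ that])
  qed auto
  have holP: "P holomorphic_on upper_half_plane"
  proof (rule holomorphic_uniform_sequence[OF open_upper_half_plane H2_holomorphic[OF S(1)]])
    fix x assume "x \<in> upper_half_plane"
    then have x: "0 < Im x" by simp
    define r where "r = Im x / 2"
    have r: "0 < r" using x by (simp add: r_def)
    have low: "r \<le> Im z" if "z \<in> cball x r" for z
    proof -
      have "Im x - Im z \<le> r" using that abs_Im_le_cmod[of "x - z"] by (simp add: dist_norm)
      then show ?thesis by (simp add: r_def)
    qed
    have "uniform_limit (cball x r) S P sequentially"
    proof (rule uniform_limitI)
      fix e :: real assume e: "0 < e"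
      have "(\<lambda>n. \<epsilon> n / (pi * r)) \<longlonglongrightarrow> 0 / (pi * r)" by (intro tendsto_intros \<epsilon>0) (use r in auto)
      then have "eventually (\<lambda>n. \<epsilon> n / (pi * r) < e\<^sup>2) sequentially"
        by (rule order_tendstoD) (use e in auto)
      then show "eventually (\<lambda>n. \<forall>z\<in>cball x r. dist (S n z) (P z) < e) sequentially"
      proof eventually_elim
        case (elim n)
        show ?case
        proof
          fix z assume z: "z \<in> cball x r"
          have "(cmod (S n z - P z))\<^sup>2 \<le> \<epsilon> n / (pi * Im z)" using pt' low[OF z] r by simp
          also have "\<dots> \<le> \<epsilon> n / (pi * r)" using low[OF z] r \<epsilon>pos[of n] by (intro divide_left_mono mult_left_mono mult_pos_pos) auto
          also have "\<dots> < e\<^sup>2" by (rule elim)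
          finally have "cmod (S n z - P z) < e" by (rule power2_less_imp_less) (use e in simp)
          then show "dist (S n z) (P z) < e" by (simp add: dist_norm)
        qed
      qed
    qed
    then show "\<exists>d>0. cball x d \<subseteq> upper_half_plane \<and> uniform_limit (cball x d) S P sequentially"
      using r less_le_trans[OF r low] by (intro exI[of _ r]) auto
  qed
  \<comment> \<open>The difference is treated instead of P, because Fatou in the second index yields
    its membership in H^2 and its norm bound at once; P itself is then S 0 minus such a
    difference.\<close>
  have DP: "(\<lambda>z. S n z - P z) \<in> H2" and DPb: "nsq lebesgue (bdry (\<lambda>z. S n z - P z)) \<le> \<epsilon> n" for n
  proof -
    have Pm: "(\<lambda>x. P (Complex x y)) \<in> borel_measurable lborel" for y
    proof -
      have "(\<lambda>x. S n (Complex x y)) \<in> borel_measurable lborel" for n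
        using H2_measurable[OF S(1), of n] by measurable
      then show ?thesis using lim by (rule borel_measurable_LIMSEQ_metric)
    qed
    have *: "sq_int lborel (\<lambda>x. S n (Complex x y) - P (Complex x y))"
      "nsq lborel (\<lambda>x. S n (Complex x y) - P (Complex x y)) \<le> \<epsilon> n" if y: "0 < y" for y
    proof -
      have a: "sq_int lborel (\<lambda>x. S n (Complex x y) - S (n + m) (Complex x y))" for m
        by (intro sq_int_diff H2_sq_int S y)
      have b: "nsq lborel (\<lambda>x. S n (Complex x y) - S (n + m) (Complex x y)) \<le> \<epsilon> n" for m
        using H2_nsq_le[OF DH y, of n "n + m"] close[of n "n + m"] by simp
      have c: "(\<lambda>x. S n (Complex x y) - P (Complex x y)) \<in> borel_measurable lborel"
        using Pm H2_sq_int[OF S(1) y, of n] by (auto simp: sq_int_def)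
      have l: "AE x in lborel. (\<lambda>m. S n (Complex x y) - S (n + m) (Complex x y)) \<longlonglongrightarrow> S n (Complex x y) - P (Complex x y)"
      proof (intro AE_I2 tendsto_intros)
        fix x
        show "(\<lambda>m. S (n + m) (Complex x y)) \<longlonglongrightarrow> P (Complex x y)"
          using LIMSEQ_ignore_initial_segment[OF lim[of "Complex x y"], of n] by (simp add: add.commute)
      qed
      show "sq_int lborel (\<lambda>x. S n (Complex x y) - P (Complex x y))"
        "nsq lborel (\<lambda>x. S n (Complex x y) - P (Complex x y)) \<le> \<epsilon> n"
        using sq_int_Fatou[OF a b c l] by auto
    qed
    show D: "(\<lambda>z. S n z - P z) \<in> H2"
    proof (rule H2_I)
      show "(\<lambda>z. S n z - P z) holomorphic_on upper_half_plane"
        by (intro holomorphic_intros holP H2_holomorphic S)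
      show "S n z - P z = 0" if "Im z \<le> 0" for z using P0[OF that] H2_outside[OF S(1) that] by simp
    qed (use * in auto)
    show "nsq lebesgue (bdry (\<lambda>z. S n z - P z)) \<le> \<epsilon> n" by (rule H2_nsq_bdry_le[OF D *(2)])
  qed
  have PH: "P \<in> H2" using H2_lincomb(1)[OF S(1)[of 0] DP[of 0], of 1 "-1"] by simp
  have "L2_inner (bdry G) (\<lambda>x. f x - bdry P x) = 0" if G: "G \<in> H2" for G
  proof -
    define g where "g = nsq lebesgue (bdry G)"
    have "cmod (L2_inner (bdry G) (\<lambda>x. f x - bdry P x)) \<le> sqrt ((g + 1) * \<epsilon> n) + sqrt g * sqrt (\<epsilon> n)" for n
    proof -
      note [measurable] = H2_bdry_measurable[OF G] H2_bdry_measurable[OF PH] H2_bdry_measurable[OF S(1)] H2_bdry_measurable[OF DP] sq_int_measurable[OF f]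
      have i: "integrable lebesgue (\<lambda>x. cnj (bdry G x) * (f x - bdry (S n) x))"
        "integrable lebesgue (\<lambda>x. cnj (bdry G x) * bdry (\<lambda>z. S n z - P z) x)"
        "integrable lebesgue (\<lambda>x. cnj (bdry G x) * (f x - bdry P x))"
        by (intro sq_int_cnj_prod sq_int_diff H2_bdry_sq_int f G S DP PH)+
      have "L2_inner (bdry G) (\<lambda>x. f x - bdry P x) = (LINT x|lebesgue. cnj (bdry G x) * (f x - bdry (S n) x) + cnj (bdry G x) * bdry (\<lambda>z. S n z - P z) x)"
        unfolding L2_inner_def
      proof (rule integral_cong_AE)
        show "AE x in lebesgue. cnj (bdry G x) * (f x - bdry P x) = cnj (bdry G x) * (f x - bdry (S n) x) + cnj (bdry G x) * bdry (\<lambda>z. S n z - P z) x"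
          using H2_lincomb(2)[OF S(1)[of n] PH, of 1 "-1"]
          by eventually_elim (simp flip: distrib_left)
      qed (use i in auto)
      also have "\<dots> = L2_inner (bdry G) (\<lambda>x. f x - bdry (S n) x) + (LINT x|lebesgue. cnj (bdry G x) * bdry (\<lambda>z. S n z - P z) x)"
        unfolding L2_inner_def by (intro Bochner_Integration.integral_add i)
      finally have "cmod (L2_inner (bdry G) (\<lambda>x. f x - bdry P x)) \<le> cmod (L2_inner (bdry G) (\<lambda>x. f x - bdry (S n) x)) + cmod (LINT x|lebesgue. cnj (bdry G x) * bdry (\<lambda>z. S n z - P z) x)"
        by (simp add: norm_triangle_ineq)
      moreover have "cmod (L2_inner (bdry G) (\<lambda>x. f x - bdry (S n) x)) \<le> sqrt ((g + 1) * \<epsilon> n)"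
      proof (rule real_le_rsqrt)
        have "(cmod (L2_inner (bdry G) (\<lambda>x. f x - bdry (S n) x)))\<^sup>2 \<le> (g + 1) * (N (S n) - d)"
          unfolding g_def N_def by (intro H2_approximant_near_orthogonal f S G) (use d in \<open>auto simp: N_def\<close>)
        also have "\<dots> \<le> (g + 1) * \<epsilon> n"
        proof (rule mult_left_mono)
          have "1 / real (Suc n) \<le> 4 / real (Suc n)" by (intro divide_right_mono) auto
          then show "N (S n) - d \<le> \<epsilon> n" using S(2)[of n] by (simp add: \<epsilon>_def)
        qed (simp add: g_def)
        finally show "(cmod (L2_inner (bdry G) (\<lambda>x. f x - bdry (S n) x)))\<^sup>2 \<le> (g + 1) * \<epsilon> n" .
      qed
      moreover have "cmod (LINT x|lebesgue. cnj (bdry G x) * bdry (\<lambda>z. S n z - P z) x) \<le> sqrt g * sqrt (\<epsilon> n)"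
      proof -
        have "cmod (LINT x|lebesgue. cnj (bdry G x) * bdry (\<lambda>z. S n z - P z) x) \<le> sqrt g * sqrt (nsq lebesgue (bdry (\<lambda>z. S n z - P z)))"
          using Cauchy_Schwarz_int[OF sq_int_cnj[OF H2_bdry_sq_int[OF G]] H2_bdry_sq_int[OF DP]] by (simp add: g_def)
        also have "\<dots> \<le> sqrt g * sqrt (\<epsilon> n)" using DPb by (intro mult_left_mono) (auto simp: g_def)
        finally show ?thesis .
      qed
      ultimately show ?thesis by linarith
    qed
    moreover have "(\<lambda>n. sqrt ((g + 1) * \<epsilon> n) + sqrt g * sqrt (\<epsilon> n)) \<longlonglongrightarrow> sqrt ((g + 1) * 0) + sqrt g * sqrt 0"
      by (intro tendsto_intros \<epsilon>0)
    ultimately have "cmod (L2_inner (bdry G) (\<lambda>x. f x - bdry P x)) \<le> sqrt ((g + 1) * 0) + sqrt g * sqrt 0"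
      by (intro tendsto_lowerbound[OF _ always_eventually]) auto
    then show ?thesis by simp
  qed
  with PH show ?thesis by blast
qed

text \<open>P - Q is orthogonal to itself, so its boundary norm is 0 and
  \<open>H2_point_bound\<close> makes it vanish in the half plane. Off the half plane both functions
  are 0 by convention, which gives equality as functions.\<close>

lemma H2_projection_unique:
  assumes f: "sq_int lebesgue f" and P: "P \<in> H2" and Q: "Q \<in> H2"
    and "\<forall>G\<in>H2. L2_inner (bdry G) (\<lambda>x. f x - bdry P x) = 0"
    and "\<forall>G\<in>H2. L2_inner (bdry G) (\<lambda>x. f x - bdry Q x) = 0"
  shows "P = Q"
proof -
  let ?D = "\<lambda>z. 1 * P z + (-1) * Q z"
  have D: "?D \<in> H2" by (rule H2_lincomb[OF P Q])
  note [measurable] = H2_bdry_measurable[OF D] H2_bdry_measurable[OF P] H2_bdry_measurable[OF Q] sq_int_measurable[OF f]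
  have i: "integrable lebesgue (\<lambda>x. cnj (bdry ?D x) * (f x - bdry P x))" "integrable lebesgue (\<lambda>x. cnj (bdry ?D x) * (f x - bdry Q x))"
    "integrable lebesgue (\<lambda>x. cnj (bdry ?D x) * bdry ?D x)"
    by (intro sq_int_cnj_prod sq_int_diff H2_bdry_sq_int f P Q D)+
  have "of_real (nsq lebesgue (bdry ?D)) = (LINT x|lebesgue. cnj (bdry ?D x) * bdry ?D x)"
    by (rule nsq_eq_inner[OF H2_bdry_sq_int[OF D], symmetric])
  also have "\<dots> = (LINT x|lebesgue. cnj (bdry ?D x) * (f x - bdry Q x) - cnj (bdry ?D x) * (f x - bdry P x))"
  proof (rule integral_cong_AE)
    show "AE x in lebesgue. cnj (bdry ?D x) * bdry ?D x = cnj (bdry ?D x) * (f x - bdry Q x) - cnj (bdry ?D x) * (f x - bdry P x)"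
      using H2_lincomb(2)[OF P Q, of 1 "-1"]
    proof eventually_elim
      case (elim x)
      have "cnj (bdry ?D x) * (f x - bdry Q x) - cnj (bdry ?D x) * (f x - bdry P x) = cnj (bdry ?D x) * (1 * bdry P x + (- 1) * bdry Q x)"
        by (simp add: right_diff_distrib)
      then show ?case unfolding elim by simp
    qed
  qed (use i in auto)
  also have "\<dots> = L2_inner (bdry ?D) (\<lambda>x. f x - bdry Q x) - L2_inner (bdry ?D) (\<lambda>x. f x - bdry P x)"
    unfolding L2_inner_def by (intro Bochner_Integration.integral_diff i)
  also have "\<dots> = 0" using assms(4,5) D by simp
  finally have z: "nsq lebesgue (bdry ?D) = 0" by simp
  have "P z = Q z" for z
  proof (cases "0 < Im z")
    case True
    then have "(cmod (?D z))\<^sup>2 \<le> 0" using H2_point_bound[OF D True, of "Re z"] z by simp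
    then show ?thesis by simp
  next
    case False then show ?thesis using H2_outside[OF P] H2_outside[OF Q] by simp
  qed
  then show ?thesis by (rule ext)
qed

text \<open>Existence and uniqueness justify the definite description in \<open>P_plus\<close>; from
  here on the projection is handled through membership in H^2 and orthogonality.\<close>

theorem P_plus_H2:
  assumes f: "sq_int lebesgue f"
  shows "P_plus f \<in> H2" "\<And>G. G \<in> H2 \<Longrightarrow> L2_inner (bdry G) (\<lambda>x. f x - bdry (P_plus f) x) = 0"
proof -
  let ?R = "\<lambda>F. F \<in> H2 \<and> (\<forall>G\<in>H2. L2_inner (bdry G) (\<lambda>x. f x - bdry F x) = 0)"
  have "\<exists>!F. ?R F"
    using H2_projection_exists[OF f] H2_projection_unique[OF f] by blast
  then have "?R (P_plus f)" unfolding P_plus_def by (rule theI')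
  then show "P_plus f \<in> H2" "\<And>G. G \<in> H2 \<Longrightarrow> L2_inner (bdry G) (\<lambda>x. f x - bdry (P_plus f) x) = 0"
    by auto
qed

section \<open>Products of Hardy functions\<close>

text \<open>Expand about the limits as u v - u' v' = (u - u') (v - v') + (u - u') v' + u' (v - v')
  and apply Cauchy-Schwarz to each term.\<close>

lemma tendsto_integral_prod_L2:
  assumes u: "\<And>n::nat. sq_int M (u n)" "sq_int M u'" "(\<lambda>n. nsq M (\<lambda>x. u n x - u' x)) \<longlonglongrightarrow> 0"
    and v: "\<And>n. sq_int M (v n)" "sq_int M v'" "(\<lambda>n. nsq M (\<lambda>x. v n x - v' x)) \<longlonglongrightarrow> 0"
  shows "(\<lambda>n. LINT x|M. u n x * v n x) \<longlonglongrightarrow> (LINT x|M. u' x * v' x)"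
proof (rule LIM_zero_cancel, rule Lim_null_comparison)
  let ?a = "\<lambda>n. sqrt (nsq M (\<lambda>x. u n x - u' x))" and ?b = "\<lambda>n. sqrt (nsq M (\<lambda>x. v n x - v' x))"
  show "eventually (\<lambda>n. norm ((LINT x|M. u n x * v n x) - (LINT x|M. u' x * v' x))
     \<le> ?a n * ?b n + ?a n * sqrt (nsq M v') + sqrt (nsq M u') * ?b n) sequentially"
  proof (intro always_eventually allI)
    fix n
    let ?d = "\<lambda>x. u n x - u' x" and ?e = "\<lambda>x. v n x - v' x"
    have sq: "sq_int M ?d" "sq_int M ?e" by (intro sq_int_diff u v)+
    have "(LINT x|M. u n x * v n x) - (LINT x|M. u' x * v' x) = (LINT x|M. u n x * v n x - u' x * v' x)"
      by (intro Bochner_Integration.integral_diff[symmetric] sq_int_prod u v)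
    also have "\<dots> = (LINT x|M. ?d x * ?e x + ?d x * v' x + u' x * ?e x)"
      by (intro Bochner_Integration.integral_cong) (auto simp: algebra_simps)
    also have "\<dots> = (LINT x|M. ?d x * ?e x + ?d x * v' x) + (LINT x|M. u' x * ?e x)"
      by (intro Bochner_Integration.integral_add Bochner_Integration.integrable_add sq_int_prod sq u v)
    also have "(LINT x|M. ?d x * ?e x + ?d x * v' x) = (LINT x|M. ?d x * ?e x) + (LINT x|M. ?d x * v' x)"
      by (intro Bochner_Integration.integral_add sq_int_prod sq u v)
    finally have "norm ((LINT x|M. u n x * v n x) - (LINT x|M. u' x * v' x))
       \<le> norm (LINT x|M. ?d x * ?e x) + norm (LINT x|M. ?d x * v' x) + norm (LINT x|M. u' x * ?e x)"
      by (simp add: norm_triangle_le)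
    also have "\<dots> \<le> ?a n * ?b n + ?a n * sqrt (nsq M v') + sqrt (nsq M u') * ?b n"
      by (intro add_mono Cauchy_Schwarz_int sq u v)
    finally show "norm ((LINT x|M. u n x * v n x) - (LINT x|M. u' x * v' x))
       \<le> ?a n * ?b n + ?a n * sqrt (nsq M v') + sqrt (nsq M u') * ?b n" .
  qed
  have "(\<lambda>n. ?a n * ?b n + ?a n * sqrt (nsq M v') + sqrt (nsq M u') * ?b n)
     \<longlonglongrightarrow> sqrt 0 * sqrt 0 + sqrt 0 * sqrt (nsq M v') + sqrt (nsq M u') * sqrt 0"
    by (intro tendsto_intros u v)
  then show "(\<lambda>n. ?a n * ?b n + ?a n * sqrt (nsq M v') + sqrt (nsq M u') * ?b n) \<longlonglongrightarrow> 0" by simp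
qed

text \<open>A product of two H^2 functions has bounded absolute integrals on horizontal lines by
  Cauchy-Schwarz. The weight 1 / |w + i| is at most 1 / (y + 1) there, which supplies the decay that
  \<open>half_plane_Cauchy\<close> needs.\<close>

lemma H2_prod_Cauchy:
  assumes A: "A \<in> H2" and B: "B \<in> H2" and a: "0 < a" and z: "Im z \<noteq> a"
  shows "integrable lborel (\<lambda>x. A (Complex x a) * B (Complex x a) / (Complex x a - z))"
    and "(LBINT x. A (Complex x a) * B (Complex x a) / (Complex x a - z)) = (if a < Im z then 2 * of_real pi * \<i> * (A z * B z) else 0)"
proof -
  obtain M1 where M1: "0 \<le> M1" "\<And>y. 0 < y \<Longrightarrow> nsq lborel (\<lambda>x. A (Complex x y)) \<le> M1" using H2_lines_bounded[OF A] by blast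
  obtain M2 where M2: "0 \<le> M2" "\<And>y. 0 < y \<Longrightarrow> nsq lborel (\<lambda>x. B (Complex x y)) \<le> M2" using H2_lines_bounded[OF B] by blast
  note [measurable] = H2_measurable[OF A] H2_measurable[OF B]
  define m where "m = (\<lambda>y. sqrt M1 * sqrt M2 * inverse (y + 1))"
  have bound: "(\<integral>\<^sup>+x. ennreal (cmod (A (Complex x y) * B (Complex x y)) / cmod (Complex x y + \<i>)) \<partial>lborel) \<le> ennreal (m y)" if "a \<le> y" for y
  proof -
    have y: "0 < y" using a that by simp
    note sq = H2_sq_int[OF A y] H2_sq_int[OF B y]
    have "(\<integral>\<^sup>+x. ennreal (cmod (A (Complex x y) * B (Complex x y)) / cmod (Complex x y + \<i>)) \<partial>lborel)
      \<le> (\<integral>\<^sup>+x. ennreal (cmod (A (Complex x y)) * cmod (B (Complex x y)) * inverse (y + 1)) \<partial>lborel)"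
    proof (intro nn_integral_mono ennreal_leI)
      fix x
      have "y + 1 \<le> cmod (Complex x y + \<i>)" using abs_Im_le_cmod[of "Complex x y + \<i>"] y by simp
      then show "cmod (A (Complex x y) * B (Complex x y)) / cmod (Complex x y + \<i>) \<le> cmod (A (Complex x y)) * cmod (B (Complex x y)) * inverse (y + 1)"
        using y by (simp add: norm_mult divide_inverse mult_left_mono le_imp_inverse_le)
    qed
    also have "\<dots> = ennreal (LBINT x. cmod (A (Complex x y)) * cmod (B (Complex x y)) * inverse (y + 1))"
      using y by (intro nn_integral_eq_integral integrable_mult_left integrable_norm[OF sq_int_prod[OF sq], unfolded norm_mult]) auto
    also have "\<dots> \<le> ennreal (m y)"
    proof (rule ennreal_leI)
      have "(LBINT x. cmod (A (Complex x y)) * cmod (B (Complex x y))) \<le> sqrt (nsq lborel (\<lambda>x. A (Complex x y))) * sqrt (nsq lborel (\<lambda>x. B (Complex x y)))"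
        by (rule Cauchy_Schwarz_abs[OF sq])
      also have "\<dots> \<le> sqrt M1 * sqrt M2" using M1 M2 y by (intro mult_mono) auto
      finally have "(LBINT x. cmod (A (Complex x y)) * cmod (B (Complex x y))) * inverse (y + 1) \<le> m y"
        using y unfolding m_def by (intro mult_right_mono) auto
      then show "(LBINT x. cmod (A (Complex x y)) * cmod (B (Complex x y)) * inverse (y + 1)) \<le> m y"
        by simp
    qed
    finally show ?thesis .
  qed
  have m: "0 \<le> m y" "m y \<le> m a" if "a \<le> y" for y
    using that a M1(1) M2(1) unfolding m_def by (auto intro!: mult_left_mono le_imp_inverse_le)
  have "((\<lambda>y. sqrt M1 * sqrt M2 * inverse (1 + y)) \<longlongrightarrow> sqrt M1 * sqrt M2 * 0) at_top"
    by (intro tendsto_intros tendsto_inverse_0_at_top filterlim_tendsto_add_at_top[OF tendsto_const filterlim_ident])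
  then have m0: "(m \<longlongrightarrow> 0) at_top" by (simp add: m_def[abs_def] add.commute)
  have hol: "(\<lambda>z. A z * B z) holomorphic_on upper_half_plane"
    by (intro holomorphic_intros H2_holomorphic A B)
  have meas: "(\<lambda>z. A z * B z) \<in> borel_measurable borel" by measurable
  show "integrable lborel (\<lambda>x. A (Complex x a) * B (Complex x a) / (Complex x a - z))"
    by (rule half_plane_Cauchy(1)[OF hol meas a z bound m m0])
  show "(LBINT x. A (Complex x a) * B (Complex x a) / (Complex x a - z)) = (if a < Im z then 2 * of_real pi * \<i> * (A z * B z) else 0)"
    by (rule half_plane_Cauchy(2)[OF hol meas a z bound m m0])
qed

text \<open>Here the Cauchy formulas for i (y + l) and its mirror image i (y - l) are added, not
  subtracted as in \<open>H2_poisson\<close>. The sum of the kernels is 2 x / (l^2 + x^2), the lower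
  point contributes 0, and half of 2 pi i remains.\<close>

lemma H2_prod_conjugate_poisson_line:
  assumes A: "A \<in> H2" and B: "B \<in> H2" and y: "0 < y" and l: "0 < l"
  shows "(LBINT x. A (Complex x y) * (of_real (x / (l\<^sup>2 + x\<^sup>2)) * B (Complex x y))) = of_real pi * \<i> * (A (Complex 0 (y + l)) * B (Complex 0 (y + l)))"
proof -
  let ?z = "Complex 0 (y + l)" and ?z' = "Complex 0 (y - l)"
  let ?K = "\<lambda>x. A (Complex x y) * B (Complex x y)"
  have i: "integrable lborel (\<lambda>x. ?K x / (Complex x y - ?z))" "integrable lborel (\<lambda>x. ?K x / (Complex x y - ?z'))"
    using l by (intro H2_prod_Cauchy(1)[OF A B y]; simp)+
  have "(LBINT x. A (Complex x y) * (of_real (x / (l\<^sup>2 + x\<^sup>2)) * B (Complex x y))) 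
     = (LBINT x. 1/2 * (?K x / (Complex x y - ?z) + ?K x / (Complex x y - ?z')))"
  proof (rule Bochner_Integration.integral_cong[OF refl])
    fix x
    have e: "Complex x y - ?z = of_real x - \<i> * of_real l" "Complex x y - ?z' = of_real x + \<i> * of_real l"
      by (auto simp: complex_eq_iff)
    have n: "of_real x - \<i> * of_real l \<noteq> 0" "of_real x + \<i> * of_real l \<noteq> 0" using l by (auto simp: complex_eq_iff)
    have p: "(of_real x - \<i> * of_real l) * (of_real x + \<i> * of_real l) = complex_of_real (l\<^sup>2 + x\<^sup>2)"
      by (simp add: algebra_simps power2_eq_square)
    have s: "k / (of_real x - \<i> * of_real l) + k / (of_real x + \<i> * of_real l) = k * (2 * of_real x) / complex_of_real (l\<^sup>2 + x\<^sup>2)" for k :: complex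
      unfolding p[symmetric] add_frac_eq[OF n] by (simp add: algebra_simps)
    show "A (Complex x y) * (of_real (x / (l\<^sup>2 + x\<^sup>2)) * B (Complex x y)) = 1/2 * (?K x / (Complex x y - ?z) + ?K x / (Complex x y - ?z'))"
      unfolding e s by simp
  qed
  also have "\<dots> = 1/2 * ((LBINT x. ?K x / (Complex x y - ?z)) + (LBINT x. ?K x / (Complex x y - ?z')))"
    unfolding integral_mult_right_zero by (subst Bochner_Integration.integral_add[OF i]) simp
  also have "\<dots> = of_real pi * \<i> * (A ?z * B ?z)"
    using l by (simp add: H2_prod_Cauchy(2)[OF A B y])
  finally show ?thesis .
qed

lemma conjugate_poisson_bound:
  fixes x l :: real assumes "0 < l" shows "\<bar>x / (l\<^sup>2 + x\<^sup>2)\<bar> \<le> 1 / l"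
proof -
  have "0 < l\<^sup>2 + x\<^sup>2" using assms by (simp add: add_pos_nonneg)
  moreover have "l * \<bar>x\<bar> \<le> l\<^sup>2 + x\<^sup>2"
    using sum_squares_bound[of l "\<bar>x\<bar>"] assms by (simp add: mult.assoc) (smt (verit) mult_nonneg_nonneg abs_ge_zero)
  ultimately show ?thesis using assms by (simp add: abs_divide divide_simps mult.commute)
qed

text \<open>The kernel is bounded by 1 / l and independent of y, so it can be attached to the second
  factor without disturbing mean square convergence. As y tends to 0 the right hand side converges
  by continuity at i l.\<close>

lemma H2_prod_conjugate_poisson:
  assumes A: "A \<in> H2" and B: "B \<in> H2" and l: "0 < l"
    and \<phi>: "sq_int lborel \<phi>" "((\<lambda>y. nsq lborel (\<lambda>x. A (Complex x y) - \<phi> x)) \<longlongrightarrow> 0) (at_right 0)"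
    and \<psi>: "sq_int lborel \<psi>" "((\<lambda>y. nsq lborel (\<lambda>x. B (Complex x y) - \<psi> x)) \<longlongrightarrow> 0) (at_right 0)"
  shows "(LBINT x. \<phi> x * (of_real (x / (l\<^sup>2 + x\<^sup>2)) * \<psi> x)) = of_real pi * \<i> * (A (Complex 0 l) * B (Complex 0 l))"
proof -
  define Y where "Y n = inverse (real (Suc n))" for n
  have Y: "0 < Y n" for n by (simp add: Y_def)
  have Y0: "Y \<longlonglongrightarrow> 0" unfolding Y_def[abs_def] by (rule LIMSEQ_inverse_real_of_nat)
  have Yr: "filterlim Y (at_right 0) sequentially"
    using Y0 Y Y[THEN less_imp_neq, THEN not_sym] by (simp add: filterlim_at)
  let ?w = "\<lambda>x. complex_of_real (x / (l\<^sup>2 + x\<^sup>2))"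
  have wm: "?w \<in> borel_measurable lborel" by measurable
  have w: "sq_int lborel (\<lambda>x. ?w x * f x)" if "sq_int lborel f" for f
    by (rule sq_int_bounded_mult[OF that wm, of "1/l"]) (simp only: norm_of_real conjugate_poisson_bound[OF l] AE_I2)
  have wn: "nsq lborel (\<lambda>x. ?w x * f x) \<le> (1/l)\<^sup>2 * nsq lborel f" if f: "sq_int lborel f" for f
    unfolding nsq_def integral_mult_right_zero[symmetric]
  proof (rule integral_mono)
    fix x
    have "(cmod (?w x))\<^sup>2 \<le> (1/l)\<^sup>2"
      by (intro power_mono) (simp_all only: norm_of_real conjugate_poisson_bound[OF l] norm_ge_zero)
    then show "(cmod (?w x * f x))\<^sup>2 \<le> (1/l)\<^sup>2 * (cmod (f x))\<^sup>2"
      unfolding norm_mult power_mult_distrib by (rule mult_right_mono) simp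
  qed (use w[OF f] f in \<open>auto simp: sq_int_def\<close>)
  have "(\<lambda>n. LBINT x. A (Complex x (Y n)) * (?w x * B (Complex x (Y n)))) \<longlonglongrightarrow> (LBINT x. \<phi> x * (?w x * \<psi> x))"
  proof (rule tendsto_integral_prod_L2)
    show "(\<lambda>n. nsq lborel (\<lambda>x. A (Complex x (Y n)) - \<phi> x)) \<longlonglongrightarrow> 0"
      by (rule filterlim_compose[OF \<phi>(2) Yr])
    show "(\<lambda>n. nsq lborel (\<lambda>x. ?w x * B (Complex x (Y n)) - ?w x * \<psi> x)) \<longlonglongrightarrow> 0"
    proof (rule tendsto_sandwich[OF _ _ tendsto_const])
      show "eventually (\<lambda>n. nsq lborel (\<lambda>x. ?w x * B (Complex x (Y n)) - ?w x * \<psi> x) \<le> (1/l)\<^sup>2 * nsq lborel (\<lambda>x. B (Complex x (Y n)) - \<psi> x)) sequentially"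
        using wn[OF sq_int_diff[OF H2_sq_int[OF B Y] \<psi>(1)]] by (simp add: right_diff_distrib)
      have "(\<lambda>n. (1/l)\<^sup>2 * nsq lborel (\<lambda>x. B (Complex x (Y n)) - \<psi> x)) \<longlonglongrightarrow> (1/l)\<^sup>2 * 0"
        by (intro tendsto_intros filterlim_compose[OF \<psi>(2) Yr])
      then show "(\<lambda>n. (1/l)\<^sup>2 * nsq lborel (\<lambda>x. B (Complex x (Y n)) - \<psi> x)) \<longlonglongrightarrow> 0" by simp
    qed simp
  qed (intro w H2_sq_int A B Y \<phi> \<psi>)+
  moreover have "(\<lambda>n. LBINT x. A (Complex x (Y n)) * (?w x * B (Complex x (Y n)))) \<longlonglongrightarrow> of_real pi * \<i> * (A (Complex 0 (0 + l)) * B (Complex 0 (0 + l)))"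
  proof -
    have c: "(\<lambda>n. F (Complex 0 (Y n + l))) \<longlonglongrightarrow> F (Complex 0 (0 + l))" if F: "F \<in> H2" for F
    proof -
      have "isCont F (Complex 0 (0 + l))"
        using holomorphic_on_imp_continuous_on[OF H2_holomorphic[OF F]] l
        by (simp add: continuous_on_eq_continuous_at open_upper_half_plane)
      moreover have "(\<lambda>n. Complex 0 (Y n + l)) \<longlonglongrightarrow> Complex 0 (0 + l)"
        by (intro tendsto_intros Y0)
      ultimately show ?thesis by (rule isCont_tendsto_compose)
    qed
    show ?thesis unfolding H2_prod_conjugate_poisson_line[OF A B Y l] by (intro tendsto_intros c A B)
  qed
  ultimately show ?thesis using LIMSEQ_unique by fastforce
qed

section \<open>Reflection in the imaginary axis\<close>

lemma nsq_cnj_uminus: "nsq lborel (\<lambda>x::real. cnj (u (- x))) = nsq lborel u"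
  unfolding nsq_def complex_mod_cnj using lborel_integral_real_affine[of "-1" "\<lambda>x. (cmod (u x))\<^sup>2" 0] by simp

lemma sq_int_uminus: 
  assumes "sq_int lborel (u :: real \<Rightarrow> complex)" shows "sq_int lborel (\<lambda>x. u (- x))"
proof -
  have "integrable lborel (\<lambda>x. (cmod (u (0 + (-1) * x)))\<^sup>2)"
    using sq_int_integrable[OF assms] by (rule lborel_integrable_real_affine) simp
  moreover have "(\<lambda>x. u (- x)) \<in> borel_measurable borel"
    using assms by (intro measurable_compose[OF borel_measurable_uminus]) (auto simp: sq_int_def)
  ultimately show ?thesis by (simp add: sq_int_def)
qed

text \<open>The map z to - cnj z preserves the half plane and fixes each i l, so the conjugate of F
  (i l) becomes the value of a function in H^2. On the real line it is x to - x, the reflection in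
  the definition of \<open>hankel\<close>.\<close>

lemma H2_reflection:
  assumes F: "F \<in> H2" shows "(\<lambda>z. cnj (F (- cnj z))) \<in> H2"
proof -
  obtain M where M: "\<And>y. 0 < y \<Longrightarrow> nsq lborel (\<lambda>x. F (Complex x y)) \<le> M" using H2_lines_bounded[OF F] by blast
  have e: "- cnj (Complex x y) = Complex (- x) y" for x y by (simp add: complex_eq_iff)
  show ?thesis
  proof (rule H2_I)
    have "(cnj \<circ> (\<lambda>w. F (- w)) \<circ> cnj) holomorphic_on upper_half_plane"
    proof (rule holomorphic_on_compose_cnj_cnj[OF _ open_upper_half_plane])
      show "(\<lambda>w. F (- w)) holomorphic_on cnj ` upper_half_plane"
        by (rule holomorphic_on_compose_gen[of uminus _ F upper_half_plane, unfolded o_def])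
          (auto intro!: holomorphic_intros H2_holomorphic F)
    qed
    then show "(\<lambda>z. cnj (F (- cnj z))) holomorphic_on upper_half_plane" by (simp add: o_def)
    show "cnj (F (- cnj z)) = 0" if "Im z \<le> 0" for z using H2_outside[OF F, of "- cnj z"] that by simp
    fix y :: real assume y: "0 < y"
    show "sq_int lborel (\<lambda>x. cnj (F (- cnj (Complex x y))))"
      unfolding e by (intro sq_int_cnj sq_int_uminus[of "\<lambda>x. F (Complex x y)"] H2_sq_int F y)
    show "nsq lborel (\<lambda>x. cnj (F (- cnj (Complex x y)))) \<le> M"
      unfolding e using nsq_cnj_uminus[of "\<lambda>x. F (Complex x y)"] M[OF y] by simp
  qed
qed

lemma H2_reflection_boundary:
  assumes "((\<lambda>y. nsq lborel (\<lambda>x. F (Complex x y) - \<phi> x)) \<longlongrightarrow> 0) (at_right 0)"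
  shows "((\<lambda>y. nsq lborel (\<lambda>x. cnj (F (- cnj (Complex x y))) - cnj (\<phi> (- x)))) \<longlongrightarrow> 0) (at_right 0)"
proof -
  have e: "- cnj (Complex x y) = Complex (- x) y" for x y by (simp add: complex_eq_iff)
  show ?thesis
    unfolding e using nsq_cnj_uminus[of "\<lambda>x. F (Complex x _) - \<phi> x"] assms by simp
qed

section \<open>Hankel operators and Carleson measures\<close>

lemma AE_lborel_uminus:
  assumes "AE x in lborel. P x" shows "AE x::real in lborel. P (- x)"
proof -
  have "AE x in distr lborel borel uminus. P x" unfolding lborel_distr_uminus using assms .
  then show ?thesis by (rule AE_distrD[rotated]) measurable
qed

lemma H2_reflect_bdry:
  assumes F: "F \<in> H2" and L: "L2_boundary F \<phi>"
  shows "AE x in lebesgue. bdry F (- x) = \<phi> (- x)" "sq_int lebesgue (\<lambda>x. bdry F (- x))"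
proof -
  have ae: "AE x in lborel. bdry F (- x) = \<phi> (- x)" by (rule AE_lborel_uminus[OF L2_boundaryD(4)[OF L]])
  then show ae': "AE x in lebesgue. bdry F (- x) = \<phi> (- x)" by (rule AE_completion)
  have s: "sq_int lborel (\<lambda>x. \<phi> (- x))" by (rule sq_int_uminus[OF L2_boundaryD(1)[OF L]])
  note m = sq_int_measurable[OF s]
  have "AE x in lebesgue. \<phi> (- x) = bdry F (- x)" using ae' by eventually_elim simp
  with s show "sq_int lebesgue (\<lambda>x. bdry F (- x))"
    by (intro sq_int_AE_cong[OF sq_int_lebesgue_iff[OF m, THEN iffD2] lebesgue_measurable_AE_eq[OF m ae]])
qed

lemma hankel_data_sq_int:
  assumes h: "h \<in> Linf" and G: "G \<in> H2"
  shows "sq_int lebesgue (\<lambda>x. h x * reflect (bdry G) x)"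
proof -
  obtain C where C: "AE x in lebesgue. cmod (h x) \<le> C" "h \<in> borel_measurable lebesgue" using h by (auto simp: Linf_def)
  obtain \<phi> where L: "L2_boundary G \<phi>" using H2_boundary(1)[OF G] by blast
  show ?thesis unfolding reflect_def
    by (rule sq_int_bounded_mult[OF H2_reflect_bdry(2)[OF G L] C(2,1)])
qed

text \<open>The projection drops out of the form, because what it removes is orthogonal to all
  boundary functions of H^2.\<close>

lemma hankel_inner:
  assumes h: "h \<in> Linf" and F: "F \<in> H2" and G: "G \<in> H2"
  shows "H2_inner F (hankel h G) = (LINT x|lebesgue. cnj (bdry F x) * (h x * reflect (bdry G) x))"
proof -
  let ?f = "\<lambda>x. h x * reflect (bdry G) x"
  note f = hankel_data_sq_int[OF h G]
  have P: "hankel h G \<in> H2" "L2_inner (bdry F) (\<lambda>x. ?f x - bdry (hankel h G) x) = 0"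
    unfolding hankel_def using P_plus_H2[OF f] F by auto
  have "0 = (LINT x|lebesgue. cnj (bdry F x) * ?f x - cnj (bdry F x) * bdry (hankel h G) x)"
    using P(2) unfolding L2_inner_def right_diff_distrib by simp
  also have "\<dots> = (LINT x|lebesgue. cnj (bdry F x) * ?f x) - (LINT x|lebesgue. cnj (bdry F x) * bdry (hankel h G) x)"
    by (intro Bochner_Integration.integral_diff sq_int_cnj_prod H2_bdry_sq_int F P f)
  finally show ?thesis unfolding H2_inner_def L2_inner_def by simp
qed

text \<open>Different symbols may give the same operator, so the symbols are compared only through
  their forms. If these agree, the projection of one datum also satisfies the orthogonality
  relations of the other, and uniqueness applies.\<close>

lemma hankel_eqI:
  assumes h: "h \<in> Linf" and k: "k \<in> Linf" and G: "G \<in> H2"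
    and eq: "\<And>F. F \<in> H2 \<Longrightarrow> (LINT x|lebesgue. cnj (bdry F x) * (h x * reflect (bdry G) x))
       = (LINT x|lebesgue. cnj (bdry F x) * (k x * reflect (bdry G) x))"
  shows "hankel h G = hankel k G"
proof -
  let ?f = "\<lambda>x. h x * reflect (bdry G) x" and ?g = "\<lambda>x. k x * reflect (bdry G) x"
  note f = hankel_data_sq_int[OF h G] and g = hankel_data_sq_int[OF k G]
  note P = P_plus_H2[OF f] and Q = P_plus_H2[OF g]
  have "L2_inner (bdry F) (\<lambda>x. ?g x - bdry (P_plus ?f) x) = 0" if F: "F \<in> H2" for F
  proof -
    have "L2_inner (bdry F) (\<lambda>x. ?g x - bdry (P_plus ?f) x) = (LINT x|lebesgue. cnj (bdry F x) * ?g x) - (LINT x|lebesgue. cnj (bdry F x) * bdry (P_plus ?f) x)"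
      unfolding L2_inner_def right_diff_distrib
      by (intro Bochner_Integration.integral_diff sq_int_cnj_prod H2_bdry_sq_int F P g)
    also have "\<dots> = (LINT x|lebesgue. cnj (bdry F x) * ?f x) - (LINT x|lebesgue. cnj (bdry F x) * bdry (P_plus ?f) x)"
      by (simp only: eq[OF F])
    also have "\<dots> = L2_inner (bdry F) (\<lambda>x. ?f x - bdry (P_plus ?f) x)"
      unfolding L2_inner_def right_diff_distrib
      by (intro Bochner_Integration.integral_diff[symmetric] sq_int_cnj_prod H2_bdry_sq_int F P f)
    also have "\<dots> = 0" by (rule P(2)[OF F])
    finally show ?thesis .
  qed
  then show ?thesis
    unfolding hankel_def using H2_projection_unique[OF g P(1) Q(1)] Q(2) by blast
qed

text \<open>Up to a constant factor the reproducing kernel of H^2 at the point i p, set to 0 off the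
  half plane as \<open>H2\<close> demands.\<close>

definition szego :: "real \<Rightarrow> complex \<Rightarrow> complex" where
  "szego p z = (if 0 < Im z then 1 / (z + \<i> * of_real p) else 0)"

lemma szego_H2:
  assumes p: "0 < p" shows "szego p \<in> H2"
proof (rule H2_I)
  have "(\<lambda>z. 1 / (z + \<i> * of_real p)) holomorphic_on upper_half_plane"
    using p by (intro holomorphic_intros) (auto simp: complex_eq_iff)
  then show "szego p holomorphic_on upper_half_plane"
    by (rule holomorphic_transform) (simp add: szego_def)
  show "szego p z = 0" if "Im z \<le> 0" for z using that by (simp add: szego_def)
  fix y :: real assume y: "0 < y"
  have e: "(\<lambda>x. szego p (Complex x y)) = (\<lambda>x. 1 / (of_real x - Complex 0 (- (y + p))))"
  proof
    fix x
    have "Complex x y + \<i> * of_real p = of_real x - Complex 0 (- (y + p))" by (simp add: complex_eq_iff)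
    then show "szego p (Complex x y) = 1 / (of_real x - Complex 0 (- (y + p)))" using y by (simp add: szego_def)
  qed
  show "sq_int lborel (\<lambda>x. szego p (Complex x y))" 
    unfolding e using y p by (intro sq_int_inv_linear) simp
  have "nsq lborel (\<lambda>x. szego p (Complex x y)) = pi / (y + p)"
    unfolding e using y p by (subst sq_int_inv_linear) auto
  also have "\<dots> \<le> pi / p" using y p by (intro divide_left_mono) auto
  finally show "nsq lborel (\<lambda>x. szego p (Complex x y)) \<le> pi / p" .
qed

lemma szego_bdry:
  assumes p: "0 < p" shows "bdry (szego p) x = 1 / (of_real x + \<i> * of_real p)"
proof (rule bdry_eqI, unfold tendsto_nontangential_iff, intro allI impI)
  fix \<alpha> :: real assume "0 < \<alpha>"
  have "((\<lambda>z. 1 / (z + \<i> * of_real p)) \<longlongrightarrow> 1 / (of_real x + \<i> * of_real p)) (at (complex_of_real x) within stolz_cone \<alpha> x)"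
    using p by (intro tendsto_intros) (auto simp: complex_eq_iff)
  moreover have "eventually (\<lambda>z. 1 / (z + \<i> * of_real p) = szego p z) (at (complex_of_real x) within stolz_cone \<alpha> x)"
    by (auto simp: eventually_at_filter szego_def stolz_cone_def)
  ultimately show "(szego p \<longlongrightarrow> 1 / (of_real x + \<i> * of_real p)) (at (complex_of_real x) within stolz_cone \<alpha> x)"
    by (rule Lim_transform_eventually)
qed

text \<open>|1 / (x + i p)| is even in x, so the reflection in the Hankel form leaves it unchanged
  and the integrand is at most C / |x + i p|^2, whose integral is C pi / p.\<close>

lemma hankel_szego_bound:
  assumes h: "h \<in> borel_measurable lebesgue" and C: "AE x in lebesgue. cmod (h x) \<le> C" and p: "0 < p"
  shows "cmod (H2_inner (szego p) (hankel h (szego p))) \<le> C * pi / p"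
proof -
  have hL: "h \<in> Linf" using h C by (auto simp: Linf_def)
  let ?w = "Complex 0 (- p)"
  let ?k = "\<lambda>x. 1 / (complex_of_real x - ?w)"
  have kk: "sq_int lborel ?k" "nsq lborel ?k = pi / p" using sq_int_inv_linear[of ?w] p by auto
  have k: "sq_int lebesgue ?k" "nsq lebesgue ?k = pi / p" 
    using kk sq_int_lebesgue_iff[OF sq_int_measurable[OF kk(1)]] nsq_lebesgue[OF sq_int_measurable[OF kk(1)]] by auto
  have e: "of_real x + \<i> * of_real p = complex_of_real x - ?w" for x by (simp add: complex_eq_iff)
  have ch: "cmod (complex_of_real (- x) - ?w) = cmod (complex_of_real x - ?w)" for x
    by (simp add: cmod_def)
  have "cmod (H2_inner (szego p) (hankel h (szego p))) \<le> (LINT x|lebesgue. cmod (cnj (bdry (szego p) x) * (h x * reflect (bdry (szego p)) x)))"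
    unfolding hankel_inner[OF hL szego_H2[OF p] szego_H2[OF p]] by (rule integral_norm_bound)
  also have "\<dots> \<le> (LINT x|lebesgue. C * (cmod (?k x))\<^sup>2)"
  proof (rule integral_mono_AE)
    show "integrable lebesgue (\<lambda>x. cmod (cnj (bdry (szego p) x) * (h x * reflect (bdry (szego p)) x)))"
      by (intro integrable_norm sq_int_cnj_prod H2_bdry_sq_int szego_H2 p hankel_data_sq_int hL)
    show "integrable lebesgue (\<lambda>x. C * (cmod (?k x))\<^sup>2)" using k(1) by (auto simp: sq_int_def)
    show "AE x in lebesgue. cmod (cnj (bdry (szego p) x) * (h x * reflect (bdry (szego p)) x)) \<le> C * (cmod (?k x))\<^sup>2"
      using C
    proof eventually_elim
      case (elim x)
      have "cmod (cnj (bdry (szego p) x) * (h x * reflect (bdry (szego p)) x)) = cmod (h x) * (cmod (?k x))\<^sup>2"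
        unfolding reflect_def szego_bdry[OF p] e complex_mod_cnj norm_mult norm_divide ch power2_eq_square by simp
      then show ?case using elim by (simp add: mult_right_mono)
    qed
  qed
  also have "\<dots> = C * nsq lebesgue ?k" unfolding nsq_def by (rule integral_mult_right_zero)
  finally show ?thesis by (simp add: k(2))
qed

text \<open>h is any bounded symbol of H. Its bound C yields the estimates for \<open>\<mu>\<close>,
  and its form is the one that \<open>hankel_symbol \<mu>\<close> has to reproduce.\<close>

locale carleson_data =
  fixes H :: "(complex \<Rightarrow> complex) \<Rightarrow> complex \<Rightarrow> complex" and \<mu> :: "real measure" and h :: "real \<Rightarrow> complex" and C :: real
  assumes carl: "carleson_measure H \<mu>"
    and h: "h \<in> borel_measurable lebesgue" and C: "AE x in lebesgue. cmod (h x) \<le> C"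
    and Hh: "\<And>F. F \<in> H2 \<Longrightarrow> H F = hankel h F"
begin

lemma h_Linf: "h \<in> Linf" using h C by (auto simp: Linf_def)

lemma sets_mu: "sets \<mu> = sets (restrict_space borel {0<..})"
  using carl by (simp add: carleson_measure_def)

lemma space_mu: "space \<mu> = {0<..}"
  using sets_eq_imp_space_eq[OF sets_mu] by (simp add: space_restrict_space)

lemma id_measurable_mu [measurable]: "(\<lambda>l. l) \<in> borel_measurable \<mu>"
  unfolding measurable_cong_sets[OF sets_mu refl] by (rule measurable_restrict_space1) simp

lemma inner_eq:
  assumes "F \<in> H2" "G \<in> H2"
  shows "integrable \<mu> (\<lambda>l. cnj (F (\<i> * of_real l)) * G (\<i> * of_real l))"
    "H2_inner F (hankel h G) = (LINT l|\<mu>. cnj (F (\<i> * of_real l)) * G (\<i> * of_real l))"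
proof -
  have i: "integrable \<mu> (\<lambda>l. cnj (F (\<i> * of_real l)) * G (\<i> * of_real l))"
    and e: "H2_inner F (H G) = (LINT l|\<mu>. cnj (F (\<i> * of_real l)) * G (\<i> * of_real l))"
    using carl assms unfolding carleson_measure_def by blast+
  show "integrable \<mu> (\<lambda>l. cnj (F (\<i> * of_real l)) * G (\<i> * of_real l))" by (rule i)
  show "H2_inner F (hankel h G) = (LINT l|\<mu>. cnj (F (\<i> * of_real l)) * G (\<i> * of_real l))"
    using e unfolding Hh[OF assms(2)] .
qed

text \<open>At i l the Szego kernel is 1 / (i (l + p)). Inserting it on both sides of the identity
  that defines \<open>\<mu>\<close> gives the integral, and \<open>hankel_szego_bound\<close>
  estimates it.\<close>

lemma szego_mu:
  assumes p: "0 < p"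
  shows "integrable \<mu> (\<lambda>l. 1 / (l + p)\<^sup>2)" "(LINT l|\<mu>. 1 / (l + p)\<^sup>2) \<le> C * pi / p"
proof -
  have e: "cnj (szego p (\<i> * of_real l)) * szego p (\<i> * of_real l) = of_real (1 / (l + p)\<^sup>2)" if "l \<in> space \<mu>" for l
  proof -
    have l: "0 < l" using that by (simp add: space_mu)
    have s: "szego p (\<i> * of_real l) = 1 / (\<i> * of_real (l + p))" using l by (simp add: szego_def distrib_left)
    have "cmod (szego p (\<i> * of_real l)) = 1 / (l + p)" unfolding s using l p by (simp add: norm_divide norm_mult del: of_real_add)
    then have "(cmod (szego p (\<i> * of_real l)))\<^sup>2 = 1 / (l + p)\<^sup>2" by (simp add: power_divide)
    then show ?thesis using complex_norm_square[of "szego p (\<i> * of_real l)"] by (simp add: mult.commute)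
  qed
  have i: "integrable \<mu> (\<lambda>l. complex_of_real (1 / (l + p)\<^sup>2))"
  proof (rule iffD1[OF Bochner_Integration.integrable_cong[OF refl]])
    show "integrable \<mu> (\<lambda>l. cnj (szego p (\<i> * of_real l)) * szego p (\<i> * of_real l))"
      by (rule inner_eq(1)[OF szego_H2[OF p] szego_H2[OF p]])
  qed (erule e)
  show "integrable \<mu> (\<lambda>l. 1 / (l + p)\<^sup>2)" using integrable_Re[OF i] by simp
  have "H2_inner (szego p) (hankel h (szego p)) = (LINT l|\<mu>. complex_of_real (1 / (l + p)\<^sup>2))"
    unfolding inner_eq(2)[OF szego_H2[OF p] szego_H2[OF p]] by (rule Bochner_Integration.integral_cong[OF refl]) (erule e)
  also have "\<dots> = of_real (LINT l|\<mu>. 1 / (l + p)\<^sup>2)" by (rule integral_complex_of_real)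
  finally have "\<bar>LINT l|\<mu>. 1 / (l + p)\<^sup>2\<bar> \<le> C * pi / p"
    using hankel_szego_bound[OF h C p] by (simp only: norm_of_real)
  then show "(LINT l|\<mu>. 1 / (l + p)\<^sup>2) \<le> C * pi / p" by linarith
qed

text \<open>Since (l + |p|)^2 <= 2 (l^2 + p^2), the integrand is at most 2 |p| / (l + |p|)^2, and
  the factor |p| cancels the 1 / |p| of \<open>szego_mu\<close>; hence a bound independent of p. At
  p = 0 the integrand is 0.\<close>

lemma conjugate_poisson_mu:
  shows "integrable \<mu> (\<lambda>l. p / (l\<^sup>2 + p\<^sup>2))" "(LINT l|\<mu>. \<bar>p / (l\<^sup>2 + p\<^sup>2)\<bar>) \<le> 2 * \<bar>C\<bar> * pi"
proof -
  have "integrable \<mu> (\<lambda>l. p / (l\<^sup>2 + p\<^sup>2)) \<and> (LINT l|\<mu>. \<bar>p / (l\<^sup>2 + p\<^sup>2)\<bar>) \<le> 2 * \<bar>C\<bar> * pi"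
  proof (cases "p = 0")
    case False
    then have p: "0 < \<bar>p\<bar>" by simp
    have le: "\<bar>p / (l\<^sup>2 + p\<^sup>2)\<bar> \<le> 2 * \<bar>p\<bar> * (1 / (l + \<bar>p\<bar>)\<^sup>2)" if "l \<in> space \<mu>" for l
    proof -
      have l: "0 < l" using that by (simp add: space_mu)
      have "0 < l\<^sup>2 + p\<^sup>2" "0 < (l + \<bar>p\<bar>)\<^sup>2" using l by (auto simp: add_pos_nonneg)
      moreover have "(l + \<bar>p\<bar>)\<^sup>2 \<le> 2 * (l\<^sup>2 + p\<^sup>2)"
        using sum_squares_bound[of l "\<bar>p\<bar>"] by (simp add: power2_sum)
      ultimately have "1 / (l\<^sup>2 + p\<^sup>2) \<le> 2 * (1 / (l + \<bar>p\<bar>)\<^sup>2)" by (simp add: divide_simps mult.commute)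
      then have "\<bar>p\<bar> * (1 / (l\<^sup>2 + p\<^sup>2)) \<le> \<bar>p\<bar> * (2 * (1 / (l + \<bar>p\<bar>)\<^sup>2))" by (rule mult_left_mono) simp
      then show ?thesis by (simp add: abs_divide mult_ac)
    qed
    have i: "integrable \<mu> (\<lambda>l. 2 * \<bar>p\<bar> * (1 / (l + \<bar>p\<bar>)\<^sup>2))"
      by (intro integrable_mult_right szego_mu p)
    have i': "integrable \<mu> (\<lambda>l. p / (l\<^sup>2 + p\<^sup>2))"
    proof (rule Bochner_Integration.integrable_bound[OF i])
      show "AE l in \<mu>. norm (p / (l\<^sup>2 + p\<^sup>2)) \<le> norm (2 * \<bar>p\<bar> * (1 / (l + \<bar>p\<bar>)\<^sup>2))"
        using le by (intro AE_I2) (force simp: real_norm_def)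
    qed measurable
    moreover have "(LINT l|\<mu>. \<bar>p / (l\<^sup>2 + p\<^sup>2)\<bar>) \<le> (LINT l|\<mu>. 2 * \<bar>p\<bar> * (1 / (l + \<bar>p\<bar>)\<^sup>2))"
      by (intro integral_mono integrable_abs i i' le)
    moreover have "(LINT l|\<mu>. 2 * \<bar>p\<bar> * (1 / (l + \<bar>p\<bar>)\<^sup>2)) \<le> 2 * \<bar>C\<bar> * pi"
    proof -
      have "(LINT l|\<mu>. 2 * \<bar>p\<bar> * (1 / (l + \<bar>p\<bar>)\<^sup>2)) = 2 * \<bar>p\<bar> * (LINT l|\<mu>. 1 / (l + \<bar>p\<bar>)\<^sup>2)"
        by (rule integral_mult_right_zero)
      also have "\<dots> \<le> 2 * \<bar>p\<bar> * (C * pi / \<bar>p\<bar>)"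
        by (intro mult_left_mono szego_mu p) simp
      also have "\<dots> \<le> 2 * \<bar>C\<bar> * pi" using p by simp
      finally show ?thesis .
    qed
    ultimately show ?thesis by linarith
  qed simp
  then show "integrable \<mu> (\<lambda>l. p / (l\<^sup>2 + p\<^sup>2))" "(LINT l|\<mu>. \<bar>p / (l\<^sup>2 + p\<^sup>2)\<bar>) \<le> 2 * \<bar>C\<bar> * pi" by auto
qed

text \<open>1 / (l + 1)^2 is integrable and strictly positive, so its superlevel sets have finite
  measure and exhaust the space. Fubini with respect to \<open>\<mu>\<close> rests on this.\<close>

lemma sigma_finite_mu: "sigma_finite_measure \<mu>"
proof
  define A where "A n = {l \<in> space \<mu>. 1 / real (Suc n) \<le> 1 / (l + 1)\<^sup>2}" for n
  have meas: "A n \<in> sets \<mu>" for n unfolding A_def by measurable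
  have fin: "emeasure \<mu> (A n) \<noteq> \<infinity>" for n
  proof -
    have "ennreal (1 / real (Suc n)) * emeasure \<mu> (A n) = (\<integral>\<^sup>+l. ennreal (1 / real (Suc n)) * indicator (A n) l \<partial>\<mu>)"
      using meas by (simp add: nn_integral_cmult_indicator)
    also have "\<dots> \<le> (\<integral>\<^sup>+l. ennreal (1 / (l + 1)\<^sup>2) \<partial>\<mu>)"
      by (intro nn_integral_mono) (auto simp: A_def split: split_indicator intro!: ennreal_leI)
    also have "\<dots> < \<infinity>"
      using szego_mu(1)[of 1] by (simp add: integrable_iff_bounded)
    finally show ?thesis by (auto simp: ennreal_mult_less_top)
  qed
  have cover: "\<Union>(range A) = space \<mu>"
  proof
    show "space \<mu> \<subseteq> \<Union>(range A)"
    proof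
      fix l assume l: "l \<in> space \<mu>"
      then have "0 < (l + 1)\<^sup>2" by (simp add: space_mu)
      obtain n where n: "(l + 1)\<^sup>2 \<le> real n" using real_arch_simple by blast
      have "1 / real (Suc n) \<le> 1 / (l + 1)\<^sup>2" using n \<open>0 < (l + 1)\<^sup>2\<close> by (intro divide_left_mono) auto
      then show "l \<in> \<Union>(range A)" using l by (auto simp: A_def)
    qed
  qed (auto simp: A_def)
  show "\<exists>A. countable A \<and> A \<subseteq> sets \<mu> \<and> \<Union>A = space \<mu> \<and> (\<forall>a\<in>A. emeasure \<mu> a \<noteq> \<infinity>)"
    using meas fin cover by (intro exI[of _ "range A"]) auto
qed

sublocale mu: sigma_finite_measure \<mu> by (rule sigma_finite_mu)
sublocale pair: pair_sigma_finite lborel \<mu> ..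

section \<open>The symbol built from the Carleson measure and its form\<close>

lemma snd_measurable_pair [measurable]: "snd \<in> borel_measurable (lborel \<Otimes>\<^sub>M \<mu>)"
  using measurable_compose[OF measurable_snd id_measurable_mu] by simp

lemma snd_measurable_pair' [measurable]: "snd \<in> borel_measurable (borel \<Otimes>\<^sub>M \<mu>)"
  using measurable_compose[OF measurable_snd id_measurable_mu] by simp

lemma hankel_symbol_measurable: "hankel_symbol \<mu> \<in> borel_measurable borel"
proof -
  have "(\<lambda>p. LINT l|\<mu>. p / (l\<^sup>2 + p\<^sup>2)) \<in> borel_measurable borel"
    by (rule mu.borel_measurable_lebesgue_integral) measurable
  then show ?thesis unfolding hankel_symbol_def[abs_def] by measurable
qed

lemma hankel_symbol_bound: "cmod (hankel_symbol \<mu> p) \<le> 2 * \<bar>C\<bar>"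
proof -
  have "\<bar>LINT l|\<mu>. p / (l\<^sup>2 + p\<^sup>2)\<bar> \<le> (LINT l|\<mu>. \<bar>p / (l\<^sup>2 + p\<^sup>2)\<bar>)" by (rule integral_abs_bound)
  also have "\<dots> \<le> 2 * \<bar>C\<bar> * pi" by (rule conjugate_poisson_mu)
  finally have "\<bar>LINT l|\<mu>. p / (l\<^sup>2 + p\<^sup>2)\<bar> / pi \<le> 2 * \<bar>C\<bar>" by (simp add: pos_divide_le_eq)
  then show ?thesis by (simp add: hankel_symbol_def norm_mult norm_divide del: of_real_divide)
qed

lemma hankel_symbol_Linf: "hankel_symbol \<mu> \<in> Linf"
proof -
  have "hankel_symbol \<mu> \<in> borel_measurable lborel" using hankel_symbol_measurable by simp
  then have "hankel_symbol \<mu> \<in> borel_measurable lebesgue" by (rule measurable_completion)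
  then show ?thesis using hankel_symbol_bound unfolding Linf_def by blast
qed

text \<open>Fubini reduces the claim to the kernel x / (l^2 + x^2) at a fixed l. Substituting - x
  for x moves the reflection from the boundary function of G to that of F, whose conjugate becomes
  the boundary function of \<open>cnj (F (- cnj z))\<close>; then
  \<open>H2_prod_conjugate_poisson\<close> applies.\<close>

lemma hankel_symbol_inner:
  assumes F: "F \<in> H2" and G: "G \<in> H2"
  shows "(LINT x|lebesgue. cnj (bdry F x) * (hankel_symbol \<mu> x * reflect (bdry G) x))
    = (LINT l|\<mu>. cnj (F (\<i> * of_real l)) * G (\<i> * of_real l))"
proof -
  obtain \<phi> where L: "L2_boundary F \<phi>" using H2_boundary(1)[OF F] by blast
  obtain \<psi> where M: "L2_boundary G \<psi>" using H2_boundary(1)[OF G] by blast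
  note \<phi> = L2_boundaryD[OF L] and \<psi> = L2_boundaryD[OF M]
  note \<phi>m = sq_int_measurable[OF \<phi>(1)] and \<psi>m = sq_int_measurable[OF sq_int_uminus[OF \<psi>(1)]]
  have \<phi>c: "sq_int lborel (\<lambda>x. cnj (\<phi> x))" by (rule sq_int_cnj[OF \<phi>(1)])
  define u where "u x = cnj (\<phi> x) * \<psi> (- x)" for x
  have ui: "integrable lborel u" unfolding u_def by (intro sq_int_prod \<phi>c sq_int_uminus \<psi>(1))
  have um [measurable]: "u \<in> borel_measurable borel" using borel_measurable_integrable[OF ui] by simp
  have hm: "hankel_symbol \<mu> \<in> borel_measurable lborel" using hankel_symbol_measurable by simp
  define k where "k = (\<lambda>(x, l). u x * complex_of_real (x / (l\<^sup>2 + x\<^sup>2)))"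
  have km [measurable]: "k \<in> borel_measurable (lborel \<Otimes>\<^sub>M \<mu>)" unfolding k_def by measurable
  \<comment> \<open>The integral over l comes first: its bound 2 |C| pi does not depend on x, and u
    is integrable as a product of square integrable functions.\<close>
  have kint: "integrable (lborel \<Otimes>\<^sub>M \<mu>) k"
  proof (rule integrableI_bounded[OF km])
    have "(\<integral>\<^sup>+p. ennreal (cmod (k p)) \<partial>(lborel \<Otimes>\<^sub>M \<mu>)) = (\<integral>\<^sup>+x. \<integral>\<^sup>+l. ennreal (cmod (k (x, l))) \<partial>\<mu> \<partial>lborel)"
      by (rule mu.nn_integral_fst[symmetric]) measurable
    also have "\<dots> \<le> (\<integral>\<^sup>+x. ennreal (cmod (u x)) * ennreal (2 * \<bar>C\<bar> * pi) \<partial>lborel)"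
    proof (rule nn_integral_mono)
      fix x
      have "(\<integral>\<^sup>+l. ennreal (cmod (k (x, l))) \<partial>\<mu>) = (\<integral>\<^sup>+l. ennreal (cmod (u x)) * ennreal \<bar>x / (l\<^sup>2 + x\<^sup>2)\<bar> \<partial>\<mu>)"
        unfolding k_def by (simp only: prod.case norm_mult norm_of_real ennreal_mult norm_ge_zero abs_ge_zero)
      also have "\<dots> = ennreal (cmod (u x)) * (\<integral>\<^sup>+l. ennreal \<bar>x / (l\<^sup>2 + x\<^sup>2)\<bar> \<partial>\<mu>)"
        by (rule nn_integral_cmult) measurable
      also have "(\<integral>\<^sup>+l. ennreal \<bar>x / (l\<^sup>2 + x\<^sup>2)\<bar> \<partial>\<mu>) = ennreal (LINT l|\<mu>. \<bar>x / (l\<^sup>2 + x\<^sup>2)\<bar>)"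
        by (intro nn_integral_eq_integral integrable_abs conjugate_poisson_mu) auto
      also have "ennreal (cmod (u x)) * \<dots> \<le> ennreal (cmod (u x)) * ennreal (2 * \<bar>C\<bar> * pi)"
        by (intro mult_left_mono ennreal_leI conjugate_poisson_mu) auto
      finally show "(\<integral>\<^sup>+l. ennreal (cmod (k (x, l))) \<partial>\<mu>) \<le> ennreal (cmod (u x)) * ennreal (2 * \<bar>C\<bar> * pi)" .
    qed
    also have "\<dots> = (\<integral>\<^sup>+x. ennreal (cmod (u x)) \<partial>lborel) * ennreal (2 * \<bar>C\<bar> * pi)"
      by (rule nn_integral_multc[OF measurable_compose[OF measurable_compose[OF borel_measurable_integrable[OF ui] borel_measurable_norm] measurable_ennreal]])
    also have "\<dots> < \<infinity>" using ui by (simp add: integrable_iff_bounded ennreal_mult_less_top)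
    finally show "(\<integral>\<^sup>+p. ennreal (cmod (k p)) \<partial>(lborel \<Otimes>\<^sub>M \<mu>)) < \<infinity>" .
  qed
  \<comment> \<open>The kernel is odd in x, hence the minus sign after the substitution. It is
    absorbed at the end, since i / pi times - (pi i) is 1.\<close>
  have inner_l: "(LINT x|lborel. k (x, l)) = - (of_real pi * \<i>) * (cnj (F (\<i> * of_real l)) * G (\<i> * of_real l))" if l: "l \<in> space \<mu>" for l
  proof -
    have l0: "0 < l" using l by (simp add: space_mu)
    have "(LINT x|lborel. k (x, l)) = (LINT x|lborel. k (0 + (-1) * x, l))"
      using lborel_integral_real_affine[of "-1" "\<lambda>x. k (x, l)" 0] by simp
    also have "\<dots> = (LINT x|lborel. - (cnj (\<phi> (- x)) * (of_real (x / (l\<^sup>2 + x\<^sup>2)) * \<psi> x)))"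
      by (rule Bochner_Integration.integral_cong) (simp_all add: k_def u_def)
    also have "\<dots> = - (LINT x|lborel. cnj (\<phi> (- x)) * (of_real (x / (l\<^sup>2 + x\<^sup>2)) * \<psi> x))"
      by (rule integral_minus)
    also have "(LINT x|lborel. cnj (\<phi> (- x)) * (of_real (x / (l\<^sup>2 + x\<^sup>2)) * \<psi> x)) 
      = of_real pi * \<i> * (cnj (F (- cnj (Complex 0 l))) * G (Complex 0 l))"
      by (rule H2_prod_conjugate_poisson[OF H2_reflection[OF F] G l0 sq_int_cnj[OF sq_int_uminus[OF \<phi>(1)]] H2_reflection_boundary[OF \<phi>(2)] \<psi>(1,2)])
    also have "Complex 0 l = \<i> * of_real l" by (simp add: complex_eq_iff)
    finally show ?thesis by simp
  qed
  have sym: "cnj (\<phi> x) * (hankel_symbol \<mu> x * \<psi> (- x)) = \<i> / of_real pi * (LINT l|\<mu>. k (x, l))" for x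
  proof -
    have "(LINT l|\<mu>. k (x, l)) = u x * of_real (LINT l|\<mu>. x / (l\<^sup>2 + x\<^sup>2))"
      unfolding k_def prod.case integral_mult_right_zero integral_complex_of_real ..
    then show ?thesis by (simp add: hankel_symbol_def u_def)
  qed
  have "(LINT x|lebesgue. cnj (bdry F x) * (hankel_symbol \<mu> x * reflect (bdry G) x))
     = (LINT x|lebesgue. cnj (\<phi> x) * (hankel_symbol \<mu> x * \<psi> (- x)))"
  proof (rule integral_cong_AE)
    show "(\<lambda>x. cnj (bdry F x) * (hankel_symbol \<mu> x * reflect (bdry G) x)) \<in> borel_measurable lebesgue"
      by (intro borel_measurable_integrable[OF sq_int_cnj_prod] H2_bdry_sq_int hankel_data_sq_int hankel_symbol_Linf F G)
    have "(\<lambda>x. cnj (\<phi> x) * (hankel_symbol \<mu> x * \<psi> (- x))) \<in> borel_measurable lborel"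
      by (intro borel_measurable_times sq_int_measurable[OF \<phi>c] hm \<psi>m)
    then show "(\<lambda>x. cnj (\<phi> x) * (hankel_symbol \<mu> x * \<psi> (- x))) \<in> borel_measurable lebesgue"
      by (rule measurable_completion)
    show "AE x in lebesgue. cnj (bdry F x) * (hankel_symbol \<mu> x * reflect (bdry G) x) = cnj (\<phi> x) * (hankel_symbol \<mu> x * \<psi> (- x))"
      using AE_completion[OF \<phi>(4)] H2_reflect_bdry(1)[OF G M] by eventually_elim (simp add: reflect_def)
  qed
  also have "\<dots> = (LINT x|lborel. cnj (\<phi> x) * (hankel_symbol \<mu> x * \<psi> (- x)))"
  proof (rule integral_completion)
    show "(\<lambda>x. cnj (\<phi> x) * (hankel_symbol \<mu> x * \<psi> (- x))) \<in> borel_measurable lborel"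
      by (intro borel_measurable_times sq_int_measurable[OF \<phi>c] hm \<psi>m)
  qed
  also have "\<dots> = \<i> / of_real pi * (LINT x|lborel. LINT l|\<mu>. k (x, l))"
    unfolding sym by (rule integral_mult_right_zero)
  also have "(LINT x|lborel. LINT l|\<mu>. k (x, l)) = (LINT l|\<mu>. LINT x|lborel. k (x, l))"
    using pair.Fubini_integral[of "\<lambda>x l. k (x, l)"] kint by simp
  also have "\<dots> = (LINT l|\<mu>. - (of_real pi * \<i>) * (cnj (F (\<i> * of_real l)) * G (\<i> * of_real l)))"
    by (rule Bochner_Integration.integral_cong[OF refl]) (erule inner_l)
  also have "\<dots> = - (of_real pi * \<i>) * (LINT l|\<mu>. cnj (F (\<i> * of_real l)) * G (\<i> * of_real l))"
    by (rule integral_mult_right_zero)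
  finally show ?thesis by simp
qed

lemma hankel_symbol_represents:
  assumes G: "G \<in> H2" shows "hankel (hankel_symbol \<mu>) G = H G"
  unfolding Hh[OF G]
  by (rule hankel_eqI[OF hankel_symbol_Linf h_Linf G])
    (simp only: hankel_symbol_inner G inner_eq(2)[symmetric] hankel_inner[OF h_Linf])

end

text \<open>The integrability statement ensures that \<open>hankel_symbol \<mu> p\<close> is a
  genuine integral and not the default value 0 of a divergent one.\<close>

theorem theorem4p1:
  fixes H :: "(complex \<Rightarrow> complex) \<Rightarrow> complex \<Rightarrow> complex" and \<mu> :: "real measure"
  assumes "hankel_operator H" and "positive_operator H" and "carleson_measure H \<mu>"
  shows "(\<forall>p. integrable \<mu> (\<lambda>l. p / (l\<^sup>2 + p\<^sup>2))) \<and>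
         hankel_symbol \<mu> \<in> Linf \<and>
         (\<forall>F\<in>H2. hankel (hankel_symbol \<mu>) F = H F)"
proof -
  obtain h C where "h \<in> borel_measurable lebesgue" "AE x in lebesgue. cmod (h x) \<le> C" "\<And>F. F \<in> H2 \<Longrightarrow> H F = hankel h F"
    using assms(1) unfolding hankel_operator_def Linf_def by blast
  then interpret carleson_data H \<mu> h C
    using assms(3) by unfold_locales
  show ?thesis
    using conjugate_poisson_mu(1) hankel_symbol_Linf hankel_symbol_represents by blast
qed

end
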